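(* Let $G=\frac1n\sum_{i=1}^nG_i$ with $G_i:\mathbb{R}^p\to\mathbb{R}^p$ and $T:\mathbb{R}^p\rightrightarrows2^{\mathbb{R}^p}$. Suppose that: $\{x:0\in Gx+Tx\}\ne\emptyset$; $T$ is maximally monotone; there is $L>0$ with $\frac1n\sum_{i=1}^n\|G_ix-G_iy\|^2\le L^2\|x-y\|^2$ for all $x,y\in\mathbb{R}^p$; and there exist $x^\star$ with $0\in Gx^\star+Tx^\star$ and $\kappa\ge0$ such that $\langle Gx+v,x-x^\star\rangle\ge-\kappa\|Gx+v\|^2$ for all $x\in\mathrm{dom}(T)$, $v\in Tx$. Let $\gamma\in(\frac12,1)$, let $b$ be an integer with $1\le b\le n^{2/3}$, and set $$\rho:=\frac b{2n},\quad C:=\frac{2(n-b)(2n+b)+b^2}{nb^2},\quad\hat C:=\frac{2(n-b)(2n+b)\gamma^2}{nb^2},\quad M:=4\gamma^2+\frac{4\gamma}{1-\gamma}\cdot\frac{C+\hat C}\rho.$$ Assume $L\kappa<\delta:=\frac{\gamma(2\gamma-1)}{(3\gamma-1)\sqrt M}$. Let $\{(x^k,v^k)\}$ be generated from $x^0\in\mathrm{dom}(T)$, $v^0\in Tx^0$ by $$x^{k+1}=x^k-\eta\widetilde S^k_\gamma-\eta\big(\gamma v^{k+1}-(2\gamma-1)v^k\big),\qquad v^{k+1}\in Tx^{k+1},\quad k\ge0,$$ using the SAGA estimator $\widetilde S^k_\gamma$ (see context) with batch size $b$, and $\eta:=\frac1{L\sqrt M}$. Then $\eta\ge\frac{\sigma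 b^{3/2}}{nL}$ with $\sigma:=\frac{\sqrt{1-\gamma}}{2\sqrt{\gamma(10+\gamma+7\gamma^2)}}$, and for every $K\ge0$, $$\frac1{K+1}\sum_{k=0}^K\mathbb{E}\big[\|Gx^k+v^k\|^2\big]\le\frac{n^2\hat\Theta_1L^2\hat R_0^2}{\sigma^2b^3(K+1)},$$ where $\hat R_0^2:=\|x^0-x^\star\|^2+\gamma^2\eta^2\|Gx^0+v^0\|^2$ and $\hat\Theta_1:=\frac{(3\gamma-1)\eta}{(1-\gamma)[\gamma(2\gamma-1)\eta-(3\gamma-1)\kappa]}$. Moreover, for given $\epsilon>0$, if $b:=\lfloor n^{2/3}\rfloor$, then with $\Gamma:=\hat\Theta_1/\sigma^2$ the method requires $$\mathcal{T}_{G_i}:=n+\Big\lfloor\frac{3\Gamma L^2\hat R_0^2n^{2/3}}{\epsilon^2}\Big\rfloor\ \text{evaluations of the }G_i\quad\text{and}\quad\mathcal{T}_T:=\Big\lfloor\frac{\Gamma L^2\hat R_0^2}{\epsilon^2}\Big\rfloor\ \text{evaluations of }J_{\gamma\eta T}$$ to achieve $\frac1{K+1}\sum_{k=0}^K\mathbb{E}[\|Gx^k+v^k\|^2]\le\epsilon^2$; that is, there is $K$ for which this inequality holds and such that producing $x^0,\dots,x^K$ uses at most $\mathcal{T}_{G_i}$ evaluations of the $G_i$ and at most $\mathcal{T}_T$ evaluations of $J_{\gamma\eta T}$.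
   Context: Norms and inner products are Euclidean; $x^0,v^0$ are deterministic and $x^{-1}:=x^0$. $J_{\gamma\eta T}:=(I+\gamma\eta T)^{-1}$; one step of the scheme is $x^{k+1}=J_{\gamma\eta T}\big(x^k-\eta\widetilde S^k_\gamma+(2\gamma-1)\eta v^k\big)$, with $v^{k+1}$ then determined by the displayed recursion. SAGA estimator. Put $\hat G_i^0:=G_ix^0$ for all $i$. At each iteration $k\ge0$, a mini-batch $\mathcal{B}_k\subseteq\{1,\dots,n\}$ of fixed size $b$ is drawn uniformly at random, independently of everything generated before; with $G_{\mathcal{B}_k}z:=\frac1b\sum_{i\in\mathcal{B}_k}G_iz$ and $\hat G^k_{\mathcal{B}_k}:=\frac1b\sum_{i\in\mathcal{B}_k}\hat G_i^k$ one sets $$\widetilde S^k_\gamma:=\big[G_{\mathcal{B}_k}x^k-\gamma G_{\mathcal{B}_k}x^{k-1}-(1-\gamma)\hat G^k_{\mathcal{B}_k}\big]+\frac{1-\gamma}n\sum_{i=1}^n\hat G_i^k$$ (so $\widetilde S^0_\gamma=(1-\gamma)Gx^0$), and the table is updated by $\hat G_i^{k+1}:=G_ix^k$ if $i\in\mathcal{B}_k$ and $\hat G_i^{k+1}:=\hat G_i^k$ otherwise. Counting of evaluations: $n$ for the initial table $G_ix^0$, and at each iteration the values $G_ix^k$ and $G_ix^{k-1}$ for $i\in\mathcal{B}_k$; one evaluation of $J_{\gamma\eta T}$ per iteration. Producing $x^0,\dots,x^K$ takes $K$ iterations. *)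

theory Defs
  imports "HOL-Probability.Probability"
begin

type_synonym 'a operator = "'a \<Rightarrow> 'a set"

definition op_dom :: "'a operator \<Rightarrow> 'a set" where
  "op_dom T = {x. T x \<noteq> {}}"

definition inclusion_zeros :: "('a::ab_group_add \<Rightarrow> 'a) \<Rightarrow> 'a operator \<Rightarrow> 'a set" where
  "inclusion_zeros G T = {x. 0 \<in> (\<lambda>v. G x + v) ` T x}"

definition monotone_operator :: "'a::real_inner operator \<Rightarrow> bool" where
  "monotone_operator T \<longleftrightarrow>
     (\<forall>x y. \<forall>u\<in>T x. \<forall>w\<in>T y. inner (u - w) (x - y) \<ge> 0)"

definition maximally_monotone :: "'a::real_inner operator \<Rightarrow> bool" where
  "maximally_monotone T \<longleftrightarrow> monotone_operator T \<and>
     (\<forall>S. monotone_operator S \<and> (\<forall>x. T x \<subseteq> S x) \<longrightarrow> S = T)"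

definition average :: "nat set \<Rightarrow> (nat \<Rightarrow> 'a::real_vector) \<Rightarrow> 'a" where
  "average I f = (1 / real (card I)) *\<^sub>R (\<Sum>i\<in>I. f i)"

definition batches :: "nat \<Rightarrow> nat \<Rightarrow> nat set set" where
  "batches n b = {S. S \<subseteq> {1..n} \<and> card S = b}"

text \<open>
  The SAGA table and estimator along one realisation: \<open>x\<close> is the sequence of iterates and \<open>B\<close> the
  sequence of mini-batches. The value at step \<open>k\<close> only depends on \<open>x 0, \<dots>, x k\<close> and \<open>B 0, \<dots>, B k\<close>.
\<close>

primrec saga_table ::
  "(nat \<Rightarrow> 'a \<Rightarrow> 'a) \<Rightarrow> (nat \<Rightarrow> 'a) \<Rightarrow> (nat \<Rightarrow> nat set) \<Rightarrow> nat \<Rightarrow> nat \<Rightarrow> 'a" where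
  "saga_table Gs x B 0 i = Gs i (x 0)"
| "saga_table Gs x B (Suc k) i = (if i \<in> B k then Gs i (x k) else saga_table Gs x B k i)"

text \<open>
  For \<open>k = 0\<close> the truncated subtraction gives \<open>x (k - 1) = x 0\<close>, which is the convention
  \<open>x\<^sup>-\<^sup>1 = x\<^sup>0\<close>.
\<close>

definition saga_estimator ::
  "nat \<Rightarrow> real \<Rightarrow> (nat \<Rightarrow> 'a \<Rightarrow> 'a) \<Rightarrow> (nat \<Rightarrow> 'a) \<Rightarrow> (nat \<Rightarrow> nat set) \<Rightarrow> nat \<Rightarrow> 'a::real_vector" where
  "saga_estimator n \<gamma> Gs x B k =
     (average (B k) (\<lambda>i. Gs i (x k)) - \<gamma> *\<^sub>R average (B k) (\<lambda>i. Gs i (x (k - 1)))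
        - (1 - \<gamma>) *\<^sub>R average (B k) (saga_table Gs x B k))
     + ((1 - \<gamma>) / real n) *\<^sub>R (\<Sum>i=1..n. saga_table Gs x B k i)"

text \<open>The resolvent \<open>(I + c T)\<^sup>-\<^sup>1\<close>, as a set-valued map.\<close>

definition resolvent :: "real \<Rightarrow> 'a::real_vector operator \<Rightarrow> 'a operator" where
  "resolvent c T z = {y. \<exists>u\<in>T y. z = y + c *\<^sub>R u}"

text \<open>
  A step of the scheme is one evaluation of the resolvent, after which the new \<open>v\<close> is obtained
  without a further evaluation. This is why \<open>resolvent_evals\<close> counts one per iteration.
\<close>

lemma step_iff_resolvent:
  fixes x x' v v' S :: "'a::real_vector"
  assumes "\<gamma> * \<eta> \<noteq> 0"
  defines "z \<equiv> x - \<eta> *\<^sub>R S + ((2 * \<gamma> - 1) * \<eta>) *\<^sub>R v"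
  shows "x' = x - \<eta> *\<^sub>R S - \<eta> *\<^sub>R (\<gamma> *\<^sub>R v' - (2 * \<gamma> - 1) *\<^sub>R v) \<and> v' \<in> T x' \<longleftrightarrow>
         x' \<in> resolvent (\<gamma> * \<eta>) T z \<and> v' = (1 / (\<gamma> * \<eta>)) *\<^sub>R (z - x')"
proof -
  have "x' = x - \<eta> *\<^sub>R S - \<eta> *\<^sub>R (\<gamma> *\<^sub>R v' - (2 * \<gamma> - 1) *\<^sub>R v) \<longleftrightarrow> z - x' = (\<gamma> * \<eta>) *\<^sub>R v'"
    by (auto simp: z_def algebra_simps)
  also have "\<dots> \<longleftrightarrow> v' = (1 / (\<gamma> * \<eta>)) *\<^sub>R (z - x')"
    using assms(1) by auto
  finally have step: "x' = x - \<eta> *\<^sub>R S - \<eta> *\<^sub>R (\<gamma> *\<^sub>R v' - (2 * \<gamma> - 1) *\<^sub>R v) \<longleftrightarrow>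
    v' = (1 / (\<gamma> * \<eta>)) *\<^sub>R (z - x')" .
  have "x' \<in> resolvent (\<gamma> * \<eta>) T z \<longleftrightarrow> (1 / (\<gamma> * \<eta>)) *\<^sub>R (z - x') \<in> T x'"
    unfolding resolvent_def using assms(1)
    by (auto intro!: bexI[where x = "(1 / (\<gamma> * \<eta>)) *\<^sub>R (z - x')"])
  with step show ?thesis by auto
qed

text \<open>
  Costs of producing the iterates up to index \<open>K\<close>, i.e. of the iterations \<open>0, \<dots>, K - 1\<close>:
  \<open>n\<close> component evaluations for the initial table, and in iteration \<open>k\<close> the component values at
  \<open>x k\<close> and those at \<open>x (k - 1)\<close> for the indices in the mini-batch \<open>B k\<close>.
\<close>

definition component_evals :: "nat \<Rightarrow> (nat \<Rightarrow> nat set) \<Rightarrow> nat \<Rightarrow> nat" where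
  "component_evals n B K = n + (\<Sum>k<K. card (B k) + card (B k))"

definition resolvent_evals :: "nat \<Rightarrow> nat" where
  "resolvent_evals K = (\<Sum>k<K. 1)"

text \<open>
  A stochastic run on the probability space \<open>P\<close>. The mini-batches are the only source of
  randomness, so drawing each one independently of everything generated before means that they
  are mutually independent. Measurability of \<open>x k\<close> and \<open>v k\<close> is not required: for monotone \<open>T\<close> and
  \<open>\<gamma> \<eta> > 0\<close> the recursion makes them functions of the mini-batches \<open>B 0, \<dots>, B (k - 1)\<close>, hence
  measurable with finitely many values on \<open>space P\<close> (for \<open>b \<le> n\<close>).
\<close>

definition saga_run ::
  "'w measure \<Rightarrow> nat \<Rightarrow> nat \<Rightarrow> real \<Rightarrow> real \<Rightarrow> (nat \<Rightarrow> 'a \<Rightarrow> 'a) \<Rightarrow> 'a operator \<Rightarrow> 'a \<Rightarrow> 'a \<Rightarrow>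
   (nat \<Rightarrow> 'w \<Rightarrow> nat set) \<Rightarrow> (nat \<Rightarrow> 'w \<Rightarrow> 'a) \<Rightarrow> (nat \<Rightarrow> 'w \<Rightarrow> 'a::real_vector) \<Rightarrow> bool" where
  "saga_run P n b \<gamma> \<eta> Gs T x0 v0 B x v \<longleftrightarrow>
     prob_space P \<and>
     prob_space.indep_vars P (\<lambda>_. count_space (batches n b)) B UNIV \<and>
     (\<forall>k. distr P (count_space (batches n b)) (B k) = uniform_count_measure (batches n b)) \<and>
     (\<forall>\<omega>\<in>space P. x 0 \<omega> = x0 \<and> v 0 \<omega> = v0) \<and>
     (\<forall>\<omega>\<in>space P. \<forall>k.
        x (Suc k) \<omega> = x k \<omega>
          - \<eta> *\<^sub>R saga_estimator n \<gamma> Gs (\<lambda>j. x j \<omega>) (\<lambda>j. B j \<omega>) k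
          - \<eta> *\<^sub>R (\<gamma> *\<^sub>R v (Suc k) \<omega> - (2 * \<gamma> - 1) *\<^sub>R v k \<omega>) \<and>
        v (Suc k) \<omega> \<in> T (x (Suc k) \<omega>))"

end

theory Submission
  imports Defs
begin

text \<open>
  Write \<open>w k = G (x k) + v k\<close>. In the variables \<open>X k = x k - x_star\<close>, \<open>y k = \<gamma> \<eta> w k\<close>,
  \<open>Y k = \<gamma> \<eta> (G (x (k - 1)) + v k)\<close>, \<open>D k = y k - Y k\<close> and \<open>\<theta> = (1 - \<gamma>) / \<gamma>\<close> the scheme is the
  recursion \<open>X (k + 1) + Y (k + 1) = X k + Y k - \<theta> y k - N k\<close>, where \<open>N k\<close> is \<open>\<eta>\<close> times the error of
  the estimator. Three facts drive the analysis. The weak Minty condition says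
  \<open>\<langle>X k, y k\<rangle> \<ge> - \<kappa>' \<parallel>y k\<parallel>\<^sup>2\<close> with \<open>\<kappa>' = \<kappa> / (\<gamma> \<eta>)\<close>. The drift \<open>D k\<close> is controlled by the last move
  \<open>x k - x (k - 1)\<close> through the Lipschitz condition. The noise \<open>N k\<close> is conditionally centred, and its
  summed second moments are controlled by the summed moves (\<open>sum_mean_sq_noise_le\<close>): a table entry is
  refreshed with probability \<open>b / n\<close> by a draw that is independent of the past, so the staleness of
  the table contracts geometrically. All random variables depend on finitely many mini-batches only,
  because monotonicity of \<open>T\<close> makes each step deterministic given its batch (\<open>adapted_iterates\<close>).

  For the first two claims, \<open>\<parallel>X + Y\<parallel>\<^sup>2 + \<mu> \<parallel>\<Delta>x + Y\<parallel>\<^sup>2\<close> with \<open>\<mu> = \<theta> / (2 - \<theta>)\<close> is a Lyapunov function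
  (\<open>reflected_step\<close>). For this \<open>\<mu>\<close> the \<open>\<parallel>Y\<parallel>\<^sup>2\<close> terms cancel, and the remaining error terms are absorbed by
  the moves because \<open>\<eta>\<^sup>2 L\<^sup>2 M = 1\<close>. Summation bounds the sum of \<open>E \<parallel>w k\<parallel>\<^sup>2\<close> by \<open>M \<Theta> L\<^sup>2 R0_sq\<close>
  (\<open>sum_mean_sq_residual_le\<close>), and \<open>M \<le> n\<^sup>2 / (\<sigma>\<^sup>2 b\<^sup>3)\<close>.

  The last claim is more delicate. Since \<open>b = \<lfloor>n powr (2/3)\<rfloor>\<close> only gives \<open>b\<^sup>3 \<le> n\<^sup>2\<close>, the factor
  \<open>n\<^sup>2 / b\<^sup>3\<close> may exceed \<open>1\<close> (it is \<open>4\<close> for \<open>n = 2\<close>), whereas the number of resolvent evaluations is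
  claimed without it. What is needed is the bound \<open>\<Theta> L\<^sup>2 R0_sq / \<sigma>\<^sup>2\<close> for the sum. This follows at once
  if \<open>M \<sigma>\<^sup>2 \<le> 1\<close>. Otherwise \<open>M \<sigma>\<^sup>2 \<le> 7/3\<close> (\<open>variance_factor_le_of_floor\<close>), the extreme case being
  \<open>n = 2\<close>, \<open>b = 1\<close>, \<open>\<gamma> \<rightarrow> 1\<close>; and then \<open>M\<close> is so large, hence \<open>\<eta>\<close> so small, that drift and noise
  become minor perturbations (\<open>variance_factor_large\<close>). In this regime the sum can be bounded with the
  additional factor \<open>3/7\<close> (\<open>sum_mean_sq_residual_le_improved\<close>).

  The gain has two sources. First, without perturbations \<open>Y\<close> and \<open>y\<close> agree and \<open>\<parallel>X + Y\<parallel>\<^sup>2\<close> alone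
  decreases by \<open>\<theta> (2 - \<theta> - 2 \<kappa>') \<parallel>y\<parallel>\<^sup>2\<close> per step, where
  \<open>(2 - \<theta>)\<^sup>2 \<ge> 4 (1 - \<theta>)\<close> makes this at least twice the decrease used above. Second, the
  initial bound \<open>\<parallel>X + Y\<parallel>\<^sup>2 \<le> 2 R0_sq\<close> is attained only if \<open>X = Y\<close>, and then
  \<open>\<langle>X, y\<rangle>\<close>, whose contribution the basic argument discards, stays positive for a while because
  \<open>T\<close> is monotone. The potential \<open>start_potential s\<close>, in which \<open>s\<close> decreases from \<open>1/2\<close> to \<open>0\<close> by at
  most \<open>\<theta>\<close> per step, quantifies this: it starts at \<open>17/10 * R0_sq\<close> at most and ends as \<open>\<parallel>X + Y\<parallel>\<^sup>2\<close>. The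
  numbers fit together because \<open>17/10 * 7/3 = 119/30 < 4\<close>; the gap between \<open>119/30\<close> and \<open>4\<close> pays for
  the perturbations.
\<close>

section \<open>Averages over a uniformly random mini-batch\<close>

lemma finite_batches: "finite (batches n b)"
  unfolding batches_def by (rule finite_subset[of _ "Pow {1..n}"]) auto

lemma card_batches: "card (batches n b) = n choose b"
  unfolding batches_def using n_subsets[of "{1..n}" b] by simp

text \<open>
  Removing \<open>J\<close> is a bijection onto the subsets of size \<open>b - card J\<close> of the remaining indices.
\<close>

lemma card_batches_superset:
  assumes "J \<subseteq> {1..n}" "card J \<le> b"
  shows "card {S \<in> batches n b. J \<subseteq> S} = (n - card J) choose (b - card J)"
proof -
  have fJ: "finite J" using assms(1) finite_subset by blast
  have "bij_betw (\<lambda>S. S - J) {S \<in> batches n b. J \<subseteq> S} {S. S \<subseteq> {1..n} - J \<and> card S = b - card J}"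
  proof (rule bij_betw_byWitness[where f' = "\<lambda>S. S \<union> J"])
    show "(\<lambda>S. S \<union> J) ` {S. S \<subseteq> {1..n} - J \<and> card S = b - card J} \<subseteq> {S \<in> batches n b. J \<subseteq> S}"
    proof (rule image_subsetI)
      fix S assume "S \<in> {S. S \<subseteq> {1..n} - J \<and> card S = b - card J}"
      then have S: "S \<subseteq> {1..n} - J" "card S = b - card J"
        by auto
      then have "finite S" using finite_subset by blast
      then have "card (S \<union> J) = card S + card J"
        using S fJ by (intro card_Un_disjoint) auto
      then show "S \<union> J \<in> {S \<in> batches n b. J \<subseteq> S}"
        using S assms by (auto simp: batches_def)
    qed
  qed (use assms fJ in \<open>auto simp: batches_def card_Diff_subset\<close>)
  then have "card {S \<in> batches n b. J \<subseteq> S} = card {S. S \<subseteq> {1..n} - J \<and> card S = b - card J}"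
    by (rule bij_betw_same_card)
  also have "\<dots> = card ({1..n} - J) choose (b - card J)"
    by (rule n_subsets) simp
  also have "card ({1..n} - J) = n - card J"
    using assms fJ by (simp add: card_Diff_subset)
  finally show ?thesis .
qed

lemma card_batches_containing:
  assumes "i \<in> {1..n}" "1 \<le> b"
  shows "real (card {S \<in> batches n b. i \<in> S}) = real b / real n * real (card (batches n b))"
proof -
  have "card {S \<in> batches n b. i \<in> S} = (n - 1) choose (b - 1)"
    using card_batches_superset[of "{i}" n b] assms by simp
  moreover have "b * (n choose b) = n * ((n - 1) choose (b - 1))"
    using times_binomial_minus1_eq[of b n] assms by simp
  then have "real b * real (n choose b) = real n * real ((n - 1) choose (b - 1))"
    by (metis of_nat_mult)
  ultimately show ?thesis using assms by (simp add: card_batches field_simps)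
qed

lemma sum_batches_members:
  fixes f :: "nat \<Rightarrow> 'a::real_vector"
  assumes "1 \<le> b"
  shows "(\<Sum>S\<in>batches n b. \<Sum>i\<in>S. f i) = (real b / real n * real (card (batches n b))) *\<^sub>R (\<Sum>i=1..n. f i)"
proof -
  have "(\<Sum>S\<in>batches n b. \<Sum>i\<in>S. f i) = (\<Sum>S\<in>batches n b. \<Sum>i=1..n. if i \<in> S then f i else 0)"
  proof (rule sum.cong[OF refl])
    fix S assume "S \<in> batches n b"
    then show "(\<Sum>i\<in>S. f i) = (\<Sum>i=1..n. if i \<in> S then f i else 0)"
      by (subst sum.inter_restrict[symmetric]) (auto simp: batches_def intro!: sum.cong)
  qed
  also have "\<dots> = (\<Sum>i=1..n. \<Sum>S\<in>batches n b. if i \<in> S then f i else 0)"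
    by (rule sum.swap)
  also have "\<dots> = (\<Sum>i=1..n. real (card {S \<in> batches n b. i \<in> S}) *\<^sub>R f i)"
    by (intro sum.cong refl, subst sum.inter_filter[OF finite_batches, symmetric])
       (simp add: sum_constant_scaleR)
  also have "\<dots> = (\<Sum>i=1..n. (real b / real n * real (card (batches n b))) *\<^sub>R f i)"
    using assms card_batches_containing by (intro sum.cong refl) (metis (no_types, lifting))
  finally show ?thesis by (simp add: scaleR_sum_right)
qed

text \<open>
  Two distinct indices lie together in the same number \<open>N2\<close> of batches, whatever the indices are. In
  the expanded square the off-diagonal part is therefore \<open>N2\<close> times the squared norm of the full sum,
  which vanishes, minus a diagonal correction of favourable sign.
\<close>

lemma sum_batches_norm_sq_le:
  fixes f :: "nat \<Rightarrow> 'a::real_inner"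
  assumes b: "1 \<le> b" and zero: "(\<Sum>i=1..n. f i) = 0"
  shows "(\<Sum>S\<in>batches n b. (norm (\<Sum>i\<in>S. f i))\<^sup>2)
    \<le> real b / real n * real (card (batches n b)) * (\<Sum>i=1..n. (norm (f i))\<^sup>2)"
proof -
  define N1 where "N1 = real b / real n * real (card (batches n b))"
  \<comment> \<open>For \<open>b = 1\<close> no batch contains two indices, but the truncated \<open>b - 2\<close> would make the binomial \<open>1\<close>.\<close>
  define N2 where "N2 = (if 2 \<le> b then real ((n - 2) choose (b - 2)) else 0)"
  let ?c = "\<lambda>i j. real (card {S \<in> batches n b. i \<in> S \<and> j \<in> S})"
  have diag: "?c i i = N1" if "i \<in> {1..n}" for i
    using card_batches_containing[OF that b] by (simp add: N1_def)
  have offdiag: "?c i j = N2" if "i \<in> {1..n}" "j \<in> {1..n}" "i \<noteq> j" for i j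
  proof (cases "2 \<le> b")
    case True
    then show ?thesis using card_batches_superset[of "{i, j}" n b] that by (simp add: N2_def numeral_2_eq_2)
  next
    case False
    have "\<not> (i \<in> S \<and> j \<in> S)" if "S \<in> batches n b" for S
    proof
      assume "i \<in> S \<and> j \<in> S"
      moreover have "finite S" using that finite_subset by (auto simp: batches_def)
      ultimately have "card {i, j} \<le> card S" by (intro card_mono) auto
      then show False using \<open>i \<noteq> j\<close> False that by (simp add: batches_def)
    qed
    then have "{S \<in> batches n b. i \<in> S \<and> j \<in> S} = {}" by blast
    then show ?thesis unfolding N2_def using False by (simp only: card.empty) simp
  qed
  have "(\<Sum>S\<in>batches n b. (norm (\<Sum>i\<in>S. f i))\<^sup>2)
      = (\<Sum>S\<in>batches n b. \<Sum>i=1..n. \<Sum>j=1..n. if i \<in> S \<and> j \<in> S then inner (f i) (f j) else 0)"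
  proof (rule sum.cong[OF refl])
    fix S assume S: "S \<in> batches n b"
    have r: "(\<Sum>i\<in>S. f i) = (\<Sum>i=1..n. if i \<in> S then f i else 0)"
      using S by (subst sum.inter_restrict[symmetric]) (auto simp: batches_def intro!: sum.cong)
    show "(norm (\<Sum>i\<in>S. f i))\<^sup>2
        = (\<Sum>i=1..n. \<Sum>j=1..n. if i \<in> S \<and> j \<in> S then inner (f i) (f j) else 0)"
      unfolding power2_norm_eq_inner r inner_sum_left inner_sum_right
      by (intro sum.cong refl) (auto simp: inner_commute)
  qed
  also have "\<dots> = (\<Sum>i=1..n. \<Sum>j=1..n. \<Sum>S\<in>batches n b. if i \<in> S \<and> j \<in> S then inner (f i) (f j) else 0)"
    by (subst sum.swap, intro sum.cong refl, rule sum.swap)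
  also have "\<dots> = (\<Sum>i=1..n. \<Sum>j=1..n. ?c i j * inner (f i) (f j))"
    by (intro sum.cong refl, subst sum.inter_filter[OF finite_batches, symmetric]) simp
  also have "\<dots> = (\<Sum>i=1..n. \<Sum>j=1..n. N2 * inner (f i) (f j) + (if i = j then (N1 - N2) * inner (f i) (f i) else 0))"
    by (intro sum.cong refl) (use diag offdiag in \<open>auto simp: algebra_simps\<close>)
  also have "\<dots> = N2 * inner (\<Sum>i=1..n. f i) (\<Sum>j=1..n. f j) + (N1 - N2) * (\<Sum>i=1..n. inner (f i) (f i))"
  proof -
    have "inner (\<Sum>i=1..n. f i) (\<Sum>j=1..n. f j) = (\<Sum>i=1..n. \<Sum>j=1..n. inner (f i) (f j))"
      by (subst inner_sum_left, subst inner_sum_right) (rule refl)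
    then show ?thesis
      by (simp add: sum.distrib sum_distrib_left sum.delta cong: if_cong)
  qed
  also have "\<dots> = (N1 - N2) * (\<Sum>i=1..n. (norm (f i))\<^sup>2)"
    unfolding zero by (simp add: power2_norm_eq_inner)
  also have "\<dots> \<le> N1 * (\<Sum>i=1..n. (norm (f i))\<^sup>2)"
    by (intro mult_right_mono sum_nonneg) (auto simp: N2_def)
  finally show ?thesis by (simp add: N1_def)
qed

lemma average_batches_unbiased:
  fixes f :: "nat \<Rightarrow> 'a::real_vector"
  assumes b: "1 \<le> b"
  shows "(\<Sum>S\<in>batches n b. average S f - average {1..n} f) = 0"
proof -
  let ?N = "real (card (batches n b))"
  have "(\<Sum>S\<in>batches n b. average S f) = (1 / real b) *\<^sub>R (\<Sum>S\<in>batches n b. \<Sum>i\<in>S. f i)"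
    by (simp add: average_def batches_def scaleR_sum_right)
  also have "\<dots> = ?N *\<^sub>R average {1..n} f"
    using b by (simp add: sum_batches_members average_def)
  finally show ?thesis by (simp add: sum_subtractf sum_constant_scaleR)
qed

text \<open>
  Sampling without replacement is no worse than sampling with replacement: centring the values reduces
  the claim to sums over batches of a family with total zero.
\<close>

lemma average_batches_variance_le:
  fixes f :: "nat \<Rightarrow> 'a::real_inner"
  assumes b: "1 \<le> b" and n: "b \<le> n"
  shows "(1 / real (card (batches n b))) * (\<Sum>S\<in>batches n b. (norm (average S f - average {1..n} f))\<^sup>2)
     \<le> 1 / (real b * real n) * (\<Sum>i=1..n. (norm (f i))\<^sup>2)"
proof -
  let ?N = "real (card (batches n b))"
  define m where "m = average {1..n} f"
  have N: "?N > 0" using n by (simp add: card_batches)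
  have m: "(\<Sum>i=1..n. f i) = real n *\<^sub>R m" using b n by (simp add: m_def average_def del: One_nat_def)
  have c0: "(\<Sum>i=1..n. f i - m) = 0"
    unfolding sum_subtractf m by (simp add: sum_constant_scaleR)
  have avg: "average S f - m = (1 / real b) *\<^sub>R (\<Sum>i\<in>S. f i - m)" if "S \<in> batches n b" for S
    using that b by (simp add: average_def batches_def sum_subtractf sum_constant_scaleR scaleR_diff_right)
  have "(\<Sum>S\<in>batches n b. (norm (average S f - m))\<^sup>2)
      = (1 / real b)\<^sup>2 * (\<Sum>S\<in>batches n b. (norm (\<Sum>i\<in>S. f i - m))\<^sup>2)"
    by (simp add: avg power_mult_distrib sum_distrib_left power_divide cong: sum.cong)
  also have "\<dots> \<le> (1 / real b)\<^sup>2 * (real b / real n * ?N * (\<Sum>i=1..n. (norm (f i - m))\<^sup>2))"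
    by (intro mult_left_mono sum_batches_norm_sq_le b c0) auto
  also have "(\<Sum>i=1..n. (norm (f i - m))\<^sup>2) = (\<Sum>i=1..n. (norm (f i))\<^sup>2) - real n * (norm m)\<^sup>2"
  proof -
    have "(\<Sum>i=1..n. (norm (f i - m))\<^sup>2)
        = (\<Sum>i=1..n. (norm (f i))\<^sup>2) - 2 * inner (\<Sum>i=1..n. f i) m + real n * (norm m)\<^sup>2"
    proof -
      have "(norm (f i - m))\<^sup>2 = (norm (f i))\<^sup>2 - 2 * inner (f i) m + (norm m)\<^sup>2" for i
        by (simp add: power2_norm_eq_inner inner_diff_left inner_diff_right inner_commute)
      then show ?thesis
        by (simp add: sum.distrib sum_subtractf inner_sum_left sum_distrib_left)
    qed
    also have "\<dots> = (\<Sum>i=1..n. (norm (f i))\<^sup>2) - real n * (norm m)\<^sup>2"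
      unfolding m by (simp add: power2_norm_eq_inner)
    finally show ?thesis .
  qed
  also have "(1 / real b)\<^sup>2 * (real b / real n * ?N * ((\<Sum>i=1..n. (norm (f i))\<^sup>2) - real n * (norm m)\<^sup>2))
      \<le> (1 / real b)\<^sup>2 * (real b / real n * ?N * (\<Sum>i=1..n. (norm (f i))\<^sup>2))"
    by (intro mult_left_mono) auto
  finally have "(1 / ?N) * (\<Sum>S\<in>batches n b. (norm (average S f - m))\<^sup>2)
      \<le> (1 / ?N) * ((1 / real b)\<^sup>2 * (real b / real n * ?N * (\<Sum>i=1..n. (norm (f i))\<^sup>2)))"
    by (rule mult_left_mono) simp
  also have "\<dots> = 1 / (real b * real n) * (\<Sum>i=1..n. (norm (f i))\<^sup>2)"
    using N b n by (simp add: field_simps power2_eq_square)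
  finally show ?thesis unfolding m_def .
qed

section \<open>Random variables determined by the first mini-batches\<close>

text \<open>
  The mini-batches are the only source of randomness. Everything that the algorithm has produced
  before step \<open>k\<close> is a function of the batches \<open>B j\<close> with \<open>j < k\<close>, of which there are finitely many
  values.
\<close>

locale batch_process = prob_space P for P :: "'w measure" +
  fixes n b :: nat and B :: "nat \<Rightarrow> 'w \<Rightarrow> nat set"
  assumes b_pos: "1 \<le> b" and b_le_n: "b \<le> n"
    and indep_batches: "indep_vars (\<lambda>_. count_space (batches n b)) B UNIV"
    and uniform_batches: "\<And>k. distr P (count_space (batches n b)) (B k) = uniform_count_measure (batches n b)"
begin

text \<open>
  This replaces measurability with respect to the sigma-algebra generated by the first \<open>k\<close> batches.
  It makes sense for values of any type, and real-valued adapted functions are automatically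
  integrable because they take finitely many values.
\<close>

definition adapted :: "nat \<Rightarrow> ('w \<Rightarrow> 'c) \<Rightarrow> bool" where
  "adapted k f \<longleftrightarrow> (\<forall>\<omega>\<in>space P. \<forall>\<omega>'\<in>space P. (\<forall>j<k. B j \<omega> = B j \<omega>') \<longrightarrow> f \<omega> = f \<omega>')"

definition hist :: "nat \<Rightarrow> 'w \<Rightarrow> nat \<Rightarrow> nat set" where
  "hist k \<omega> = restrict (\<lambda>j. B j \<omega>) {..<k}"

abbreviation hists :: "nat \<Rightarrow> (nat \<Rightarrow> nat set) set" where
  "hists k \<equiv> {..<k} \<rightarrow>\<^sub>E batches n b"

lemma card_batches_pos: "0 < card (batches n b)"
  using b_le_n by (simp add: card_batches)

lemma batch_measurable: "random_variable (count_space (batches n b)) (B k)"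
  using indep_vars_def2[of "\<lambda>_. count_space (batches n b)" B UNIV] indep_batches by auto

lemma batch_in_batches [simp]: "\<omega> \<in> space P \<Longrightarrow> B k \<omega> \<in> batches n b"
  using measurable_space[OF batch_measurable, of \<omega> k] by simp

lemma batch_event: "B k -` {S} \<inter> space P \<in> events"
proof -
  have *: "B k -` ({S} \<inter> batches n b) \<inter> space P \<in> events"
    by (rule measurable_sets[OF batch_measurable]) simp
  have "B k -` ({S} \<inter> batches n b) \<inter> space P = B k -` {S} \<inter> space P" by auto
  with * show ?thesis by simp
qed

lemma prob_batch:
  assumes "S \<in> batches n b"
  shows "prob (B k -` {S} \<inter> space P) = 1 / real (card (batches n b))"
proof -
  have "prob (B k -` {S} \<inter> space P) = measure (distr P (count_space (batches n b)) (B k)) {S}"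
    using assms batch_measurable by (simp add: measure_distr)
  also have "\<dots> = 1 / real (card (batches n b))"
    unfolding uniform_batches using assms finite_batches
    by (simp add: measure_uniform_count_measure)
  finally show ?thesis .
qed

lemma hist_in: "\<omega> \<in> space P \<Longrightarrow> hist k \<omega> \<in> hists k"
  by (auto simp: hist_def)

lemma finite_hists: "finite (hists k)"
  by (intro finite_PiE finite_batches) auto

lemma hist_eq_iff: "a \<in> hists k \<Longrightarrow> hist k \<omega> = a \<longleftrightarrow> (\<forall>j<k. B j \<omega> = a j)"
  unfolding hist_def PiE_iff extensional_def restrict_def fun_eq_iff by auto

lemma hist_event:
  assumes "a \<in> hists k"
  shows "{\<omega> \<in> space P. hist k \<omega> = a} \<in> events"
proof (cases "k = 0")
  case False
  then have "{\<omega> \<in> space P. hist k \<omega> = a} = (\<Inter>j\<in>{..<k}. B j -` {a j} \<inter> space P)"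
    using hist_eq_iff[OF assms] by auto
  moreover have "(\<Inter>j\<in>{..<k}. B j -` {a j} \<inter> space P) \<in> events"
    by (rule sets.finite_INT) (use batch_event False in auto)
  ultimately show ?thesis by simp
qed (use hist_eq_iff[OF assms] in simp)

lemma prob_hist:
  assumes "a \<in> hists k"
  shows "prob {\<omega> \<in> space P. hist k \<omega> = a} = (\<Prod>j<k. prob (B j -` {a j} \<inter> space P))"
proof (cases "k = 0")
  case False
  then have "{\<omega> \<in> space P. hist k \<omega> = a} = (\<Inter>j\<in>{..<k}. B j -` {a j} \<inter> space P)"
    using hist_eq_iff[OF assms] by auto
  moreover have "prob (\<Inter>j\<in>{..<k}. B j -` {a j} \<inter> space P) = (\<Prod>j<k. prob (B j -` {a j} \<inter> space P))"
    by (rule indep_varsD[OF indep_batches]) (use assms False in auto)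
  ultimately show ?thesis by simp
qed (use hist_eq_iff[OF assms] in \<open>simp add: prob_space\<close>)

text \<open>
  Prolonging a history by one batch multiplies its probability by that of the batch, by independence;
  the batch is uniform.
\<close>

lemma prob_hist_batch:
  assumes a: "a \<in> hists k" and S: "S \<in> batches n b"
  shows "prob {\<omega> \<in> space P. hist k \<omega> = a \<and> B k \<omega> = S}
     = prob {\<omega> \<in> space P. hist k \<omega> = a} / real (card (batches n b))"
proof -
  define a' where "a' = a(k := S)"
  have a': "a' \<in> hists (Suc k)"
    using a S by (auto simp: a'_def PiE_iff extensional_def less_Suc_eq)
  have "{\<omega> \<in> space P. hist k \<omega> = a \<and> B k \<omega> = S} = {\<omega> \<in> space P. hist (Suc k) \<omega> = a'}"
    using hist_eq_iff[OF a] hist_eq_iff[OF a'] by (auto simp: a'_def less_Suc_eq)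
  then have "prob {\<omega> \<in> space P. hist k \<omega> = a \<and> B k \<omega> = S}
      = (\<Prod>j<Suc k. prob (B j -` {a' j} \<inter> space P))"
    by (simp only: prob_hist[OF a'])
  also have "\<dots> = (\<Prod>j<k. prob (B j -` {a j} \<inter> space P)) * prob (B k -` {S} \<inter> space P)"
    by (auto simp: a'_def intro!: prod.cong)
  finally show ?thesis by (simp add: prob_hist[OF a] prob_batch[OF S])
qed

lemma adapted_hist:
  assumes "adapted k f"
  obtains \<phi> where "\<And>\<omega>. \<omega> \<in> space P \<Longrightarrow> f \<omega> = \<phi> (hist k \<omega>)"
proof
  fix \<omega> assume \<omega>: "\<omega> \<in> space P"
  define \<omega>' where "\<omega>' = (SOME \<omega>'. \<omega>' \<in> space P \<and> hist k \<omega>' = hist k \<omega>)"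
  have w': "\<omega>' \<in> space P \<and> hist k \<omega>' = hist k \<omega>"
    unfolding \<omega>'_def by (rule someI[of _ \<omega>]) (use \<omega> in simp)
  have eq: "B j \<omega> = B j \<omega>'" if "j < k" for j
  proof -
    have "hist k \<omega>' j = hist k \<omega> j" using w' by simp
    then show ?thesis using that by (simp add: hist_def)
  qed
  have "f \<omega> = f \<omega>'"
    using assms \<omega> w' eq unfolding adapted_def by blast
  then show "f \<omega> = (\<lambda>a. f (SOME \<omega>'. \<omega>' \<in> space P \<and> hist k \<omega>' = a)) (hist k \<omega>)"
    unfolding \<omega>'_def .
qed

lemma adapted_integrable:
  fixes f :: "'w \<Rightarrow> real"
  assumes "adapted k f"
  shows "integrable P f"
proof -
  from adapted_hist[OF assms] obtain \<phi> where \<phi>: "\<And>\<omega>. \<omega> \<in> space P \<Longrightarrow> f \<omega> = \<phi> (hist k \<omega>)" by metis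
  have "integrable P (\<lambda>\<omega>. \<Sum>a\<in>hists k. \<phi> a * indicator {\<omega> \<in> space P. hist k \<omega> = a} \<omega>)"
    by (intro Bochner_Integration.integrable_sum integrable_mult_right)
       (use hist_event in \<open>auto simp: emeasure_eq_measure\<close>)
  moreover have "f \<omega> = (\<Sum>a\<in>hists k. \<phi> a * indicator {\<omega> \<in> space P. hist k \<omega> = a} \<omega>)" if "\<omega> \<in> space P" for \<omega>
    using that hist_in[OF that, of k] finite_hists[of k]
    by (simp add: \<phi> indicator_def sum.delta' if_distrib cong: if_cong)
  ultimately show ?thesis by (subst Bochner_Integration.integrable_cong) auto
qed

text \<open>
  The conditional expectation given the past in the only form that is needed: if \<open>g \<omega>\<close> depends on the
  past only, then averaging over the next batch may be done before the expectation is taken. Both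
  sides are the same finite sum over histories and batches.
\<close>

lemma expectation_next_batch:
  fixes g :: "'w \<Rightarrow> nat set \<Rightarrow> real"
  assumes "adapted k g"
  shows "(LINT \<omega>|P. g \<omega> (B k \<omega>))
    = (LINT \<omega>|P. (1 / real (card (batches n b))) * (\<Sum>S\<in>batches n b. g \<omega> S))"
proof -
  let ?N = "real (card (batches n b))"
  from adapted_hist[OF assms] obtain \<phi> where \<phi>: "\<And>\<omega>. \<omega> \<in> space P \<Longrightarrow> g \<omega> = \<phi> (hist k \<omega>)" by metis
  let ?H = "\<lambda>a. {\<omega> \<in> space P. hist k \<omega> = a}"
  let ?HS = "\<lambda>a S. {\<omega> \<in> space P. hist k \<omega> = a \<and> B k \<omega> = S}"
  have ev: "?HS a S \<in> events" if "a \<in> hists k" for a S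
  proof -
    have "?HS a S = ?H a \<inter> (B k -` {S} \<inter> space P)" by auto
    then show ?thesis using hist_event[OF that] batch_event by (metis sets.Int)
  qed
  have "(LINT \<omega>|P. g \<omega> (B k \<omega>))
      = (LINT \<omega>|P. (\<Sum>a\<in>hists k. \<Sum>S\<in>batches n b. \<phi> a S * indicator (?HS a S) \<omega>))"
  proof (rule Bochner_Integration.integral_cong[OF refl])
    fix \<omega> assume w: "\<omega> \<in> space P"
    have "(\<Sum>a\<in>hists k. \<Sum>S\<in>batches n b. \<phi> a S * indicator (?HS a S) \<omega>)
        = (\<Sum>a\<in>hists k. if a = hist k \<omega> then (\<Sum>S\<in>batches n b. if S = B k \<omega> then \<phi> a S else 0) else 0)"
      using w by (intro sum.cong refl) (auto simp: indicator_def intro!: sum.cong)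
    also have "\<dots> = g \<omega> (B k \<omega>)"
      using w hist_in[OF w, of k] finite_hists[of k] finite_batches[of n b] by (simp add: \<phi> sum.delta)
    finally show "g \<omega> (B k \<omega>) = (\<Sum>a\<in>hists k. \<Sum>S\<in>batches n b. \<phi> a S * indicator (?HS a S) \<omega>)" by simp
  qed
  also have "\<dots> = (\<Sum>a\<in>hists k. \<Sum>S\<in>batches n b. \<phi> a S * prob (?HS a S))"
    using ev by (simp add: Bochner_Integration.integral_sum emeasure_eq_measure less_top[symmetric])
  also have "\<dots> = (\<Sum>a\<in>hists k. (1 / ?N * (\<Sum>S\<in>batches n b. \<phi> a S)) * prob (?H a))"
    by (intro sum.cong refl) (simp add: prob_hist_batch sum_distrib_left sum_distrib_right sum_divide_distrib)
  also have "\<dots> = (LINT \<omega>|P. (\<Sum>a\<in>hists k. (1 / ?N * (\<Sum>S\<in>batches n b. \<phi> a S)) * indicator (?H a) \<omega>))"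
    using hist_event by (simp add: Bochner_Integration.integral_sum emeasure_eq_measure less_top[symmetric])
  also have "\<dots> = (LINT \<omega>|P. (1 / ?N) * (\<Sum>S\<in>batches n b. g \<omega> S))"
  proof (rule Bochner_Integration.integral_cong[OF refl])
    fix \<omega> assume w: "\<omega> \<in> space P"
    have "(\<Sum>a\<in>hists k. (1 / ?N * (\<Sum>S\<in>batches n b. \<phi> a S)) * indicator (?H a) \<omega>)
        = (\<Sum>a\<in>hists k. if a = hist k \<omega> then (1 / ?N * (\<Sum>S\<in>batches n b. \<phi> a S)) else 0)"
      using w by (intro sum.cong refl) (auto simp: indicator_def)
    also have "\<dots> = (1 / ?N) * (\<Sum>S\<in>batches n b. g \<omega> S)"
      using w hist_in[OF w, of k] finite_hists[of k] by (simp add: \<phi> sum.delta)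
    finally show "(\<Sum>a\<in>hists k. (1 / ?N * (\<Sum>S\<in>batches n b. \<phi> a S)) * indicator (?H a) \<omega>) = (1 / ?N) * (\<Sum>S\<in>batches n b. g \<omega> S)" .
  qed
  finally show ?thesis .
qed

lemma adapted_mono: "adapted k f \<Longrightarrow> k \<le> l \<Longrightarrow> adapted l f"
  unfolding adapted_def by (meson order_less_le_trans)

lemma adapted_const [simp]: "adapted k (\<lambda>_. c)"
  by (simp add: adapted_def)

lemma adapted_comp: "adapted k f \<Longrightarrow> adapted k (\<lambda>\<omega>. h (f \<omega>))"
  unfolding adapted_def by (intro ballI impI arg_cong[of _ _ h]) blast

lemma adapted_comp2: "adapted k f \<Longrightarrow> adapted k g \<Longrightarrow> adapted k (\<lambda>\<omega>. h (f \<omega>) (g \<omega>))"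
  unfolding adapted_def by (intro ballI impI arg_cong2[of _ _ _ _ h]) blast+

lemma adapted_fun: "(\<And>i. adapted k (\<lambda>\<omega>. f \<omega> i)) \<Longrightarrow> adapted k f"
  unfolding adapted_def by (intro ballI impI ext) blast

lemma adapted_batch: "j < k \<Longrightarrow> adapted k (B j)"
  unfolding adapted_def by blast

lemma adapted_add: "adapted k f \<Longrightarrow> adapted k g \<Longrightarrow> adapted k (\<lambda>\<omega>. f \<omega> + g \<omega>)"
  and adapted_diff: "adapted k f' \<Longrightarrow> adapted k g' \<Longrightarrow> adapted k (\<lambda>\<omega>. f' \<omega> - g' \<omega>)"
  and adapted_scaleR: "adapted k f'' \<Longrightarrow> adapted k (\<lambda>\<omega>. c *\<^sub>R f'' \<omega>)"
  and adapted_mult: "adapted k u \<Longrightarrow> adapted k (\<lambda>\<omega>. d * u \<omega>)"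
  and adapted_inner: "adapted k p \<Longrightarrow> adapted k q \<Longrightarrow> adapted k (\<lambda>\<omega>. inner (p \<omega>) (q \<omega>))"
  and adapted_norm_sq: "adapted k r \<Longrightarrow> adapted k (\<lambda>\<omega>. (norm (r \<omega>))\<^sup>2)"
  by (erule (1) adapted_comp2 | erule adapted_comp)+

lemmas adapted_intros = adapted_add adapted_diff adapted_scaleR adapted_mult adapted_inner adapted_norm_sq
  adapted_const

end

section \<open>One step of the recursion in a real inner product space\<close>

lemma norm_add_sq: "(norm (a + b))\<^sup>2 = (norm a)\<^sup>2 + 2 * inner a b + (norm (b::'a::real_inner))\<^sup>2"
  by (simp add: power2_norm_eq_inner inner_add_left inner_add_right inner_commute)

lemma norm_diff_sq: "(norm (a - b))\<^sup>2 = (norm a)\<^sup>2 - 2 * inner a b + (norm (b::'a::real_inner))\<^sup>2"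
  by (simp add: power2_norm_eq_inner inner_diff_left inner_diff_right inner_commute)

lemma young_inner:
  fixes a b :: "'a::real_inner"
  assumes "0 < \<alpha>"
  shows "2 * inner a b \<le> \<alpha> * (norm a)\<^sup>2 + (1 / \<alpha>) * (norm b)\<^sup>2"
proof -
  have "0 \<le> (1 / \<alpha>) * (norm (\<alpha> *\<^sub>R a - b))\<^sup>2" using assms by simp
  also have "\<dots> = \<alpha> * (norm a)\<^sup>2 + (1 / \<alpha>) * (norm b)\<^sup>2 - 2 * inner a b"
    unfolding norm_diff_sq using assms
    by (simp add: power_mult_distrib field_simps power2_eq_square)
  finally show ?thesis by simp
qed

lemma norm_add_sq_le:
  fixes a b :: "'a::real_inner"
  assumes "0 < \<alpha>"
  shows "(norm (a + b))\<^sup>2 \<le> (1 + \<alpha>) * (norm a)\<^sup>2 + (1 + 1 / \<alpha>) * (norm b)\<^sup>2"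
  using young_inner[OF assms, of a b] unfolding norm_add_sq by (simp add: algebra_simps)

text \<open>
  The Lyapunov inequality of the reflected scheme, with \<open>\<kappa>\<close> in the role of \<open>\<kappa> / (\<gamma> \<eta>)\<close>. The two squares
  on the left contribute the term \<open>(1 + \<mu>) \<theta> (\<theta> \<parallel>y\<parallel>\<^sup>2 - 2 \<langle>y, Y\<rangle>)\<close>, and \<open>(1 + \<mu>) \<theta> = 2 \<mu>\<close>.
  Writing \<open>2 \<langle>y, Y\<rangle>\<close> as \<open>\<parallel>y\<parallel>\<^sup>2 + \<parallel>Y\<parallel>\<^sup>2 - \<parallel>D\<parallel>\<^sup>2\<close> leaves \<open>- \<mu> \<parallel>Y\<parallel>\<^sup>2\<close>, which is what the move-dependent
  half of the Lyapunov function at the previous step can compensate. The term linear in \<open>N\<close> is kept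
  because its expectation vanishes.
\<close>

lemma reflected_step:
  fixes x Y D N :: "'a::real_inner"
  assumes \<theta>: "0 < \<theta>" "\<theta> < 1"
    and y: "y = Y + D"
    and star: "- inner x y \<le> \<kappa> * (norm y)\<^sup>2"
    and \<mu>: "\<mu> = \<theta> / (2 - \<theta>)"
  shows "(norm (x + Y - \<theta> *\<^sub>R y - N))\<^sup>2 + \<mu> * (norm (Y - \<theta> *\<^sub>R y - N))\<^sup>2
    \<le> (norm (x + Y))\<^sup>2 - \<mu> * (norm Y)\<^sup>2 - 2 * \<theta> * ((1 - \<theta>) / (2 - \<theta>) - \<kappa>) * (norm y)\<^sup>2
      + 2 * \<mu> * (norm D)\<^sup>2 + (1 + \<mu>) * (norm N)\<^sup>2
      + inner (- 2 *\<^sub>R ((x + Y - \<theta> *\<^sub>R y) + \<mu> *\<^sub>R (Y - \<theta> *\<^sub>R y))) N"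
proof -
  have m1: "(1 + \<mu>) * \<theta> = 2 * \<mu>" and m2: "\<theta> * ((1 - \<theta>) / (2 - \<theta>)) = \<mu> * (1 - \<theta>)"
    using \<theta> by (simp_all add: \<mu> field_simps)
  have D: "(norm D)\<^sup>2 = (norm y)\<^sup>2 - 2 * inner y Y + (norm Y)\<^sup>2"
    using norm_diff_sq[of y Y] y by simp
  have "(norm (x + Y - \<theta> *\<^sub>R y - N))\<^sup>2 + \<mu> * (norm (Y - \<theta> *\<^sub>R y - N))\<^sup>2
      = (norm (x + Y - \<theta> *\<^sub>R y))\<^sup>2 + \<mu> * (norm (Y - \<theta> *\<^sub>R y))\<^sup>2 + (1 + \<mu>) * (norm N)\<^sup>2
        + inner (- 2 *\<^sub>R ((x + Y - \<theta> *\<^sub>R y) + \<mu> *\<^sub>R (Y - \<theta> *\<^sub>R y))) N"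
    unfolding norm_diff_sq[of _ N] by (simp add: inner_add_left algebra_simps)
  also have "(norm (x + Y - \<theta> *\<^sub>R y))\<^sup>2 + \<mu> * (norm (Y - \<theta> *\<^sub>R y))\<^sup>2
      = (norm (x + Y))\<^sup>2 + \<mu> * (norm Y)\<^sup>2 - 2 * \<theta> * inner x y
        + ((1 + \<mu>) * \<theta>) * (\<theta> * (norm y)\<^sup>2 - 2 * inner y Y)"
    unfolding norm_diff_sq[of _ "\<theta> *\<^sub>R y"]
    by (simp add: inner_add_left power_mult_distrib inner_commute[of Y y] power2_eq_square algebra_simps)
  also have "\<dots> = (norm (x + Y))\<^sup>2 - \<mu> * (norm Y)\<^sup>2 - 2 * \<theta> * inner x y
      - 2 * (\<mu> * (1 - \<theta>)) * (norm y)\<^sup>2 + 2 * \<mu> * (norm D)\<^sup>2"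
    unfolding m1 D by (simp add: algebra_simps)
  also have "\<dots> \<le> (norm (x + Y))\<^sup>2 - \<mu> * (norm Y)\<^sup>2 + 2 * \<theta> * (\<kappa> * (norm y)\<^sup>2)
      - 2 * (\<mu> * (1 - \<theta>)) * (norm y)\<^sup>2 + 2 * \<mu> * (norm D)\<^sup>2"
    using mult_left_mono[OF star, of "2 * \<theta>"] \<theta> by simp
  also have "\<dots> = (norm (x + Y))\<^sup>2 - \<mu> * (norm Y)\<^sup>2 - 2 * \<theta> * ((1 - \<theta>) / (2 - \<theta>) - \<kappa>) * (norm y)\<^sup>2
      + 2 * \<mu> * (norm D)\<^sup>2"
    unfolding m2[symmetric] by (simp add: algebra_simps)
  finally show ?thesis by simp
qed

text \<open>
  Up to rearrangement this is
  \<open>(1 + 2/5 s\<^sup>2) \<parallel>x\<parallel>\<^sup>2 + 2 (1 - s) \<langle>x, Y\<rangle> + (1 + s\<^sup>2 + s/16) \<parallel>Y\<parallel>\<^sup>2\<close>. The weight of the mixed term is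
  reduced by \<open>s\<close>, which lowers the initial value when \<open>x\<close> and \<open>Y\<close> are nearly equal. As \<open>s\<close> decreases by
  \<open>\<theta>\<close> per step, that weight grows at the rate that the lower bound on \<open>\<langle>x, y\<rangle>\<close> can pay for. The
  quadratic corrections of the two diagonal weights have different tasks: the one
  of \<open>\<parallel>Y\<parallel>\<^sup>2\<close> restores the decrease \<open>2 \<theta> \<parallel>y\<parallel>\<^sup>2\<close>, and the one of \<open>\<parallel>x\<parallel>\<^sup>2\<close> dominates the mixed term between
  \<open>x\<close> and the increment of \<open>y\<close>. Without perturbations \<open>1/4\<close> in place of \<open>2/5\<close> and no \<open>s/16\<close> would do;
  the larger values leave room for drift and noise.
\<close>

definition start_potential :: "real \<Rightarrow> 'a::real_inner \<Rightarrow> 'a \<Rightarrow> real" where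
  "start_potential s x Y = (1 - s) * (norm (x + Y))\<^sup>2 + (s + 2/5 * s\<^sup>2) * (norm x)\<^sup>2
     + (s + s\<^sup>2 + s / 16) * (norm Y)\<^sup>2"

lemma start_potential_0 [simp]: "start_potential 0 x Y = (norm (x + Y))\<^sup>2"
  by (simp add: start_potential_def)

lemma start_potential_nonneg: "0 \<le> s \<Longrightarrow> s \<le> 1 \<Longrightarrow> 0 \<le> start_potential s x Y"
  by (simp add: start_potential_def)

lemma start_potential_half_le:
  "start_potential (1/2) x Y \<le> 17/10 * ((norm x)\<^sup>2 + (norm Y)\<^sup>2)"
proof -
  have "start_potential (1/2) x Y = 11/10 * (norm x)\<^sup>2 + inner x Y + 41/32 * (norm Y)\<^sup>2"
    unfolding start_potential_def norm_add_sq by (simp add: power2_eq_square algebra_simps)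
  note eq = this
  \<comment> \<open>The parameter \<open>6/5\<close> exhausts the budget of \<open>\<parallel>x\<parallel>\<^sup>2\<close> exactly: \<open>11/10 + 3/5 = 17/10\<close>.\<close>
  have le: "inner x Y \<le> 3/5 * (norm x)\<^sup>2 + 5/12 * (norm Y)\<^sup>2"
    using young_inner[of "6/5" x Y] by simp
  have "A \<le> 17/10 * (a + c)" if "A = 11/10 * a + i + 41/32 * c" "i \<le> 3/5 * a + 5/12 * c" "0 \<le> c"
    for A a i c :: real
    using that unfolding distrib_left by linarith
  from this[OF eq le] show ?thesis by simp
qed

text \<open>
  The step on which \<open>s\<close> reaches \<open>0\<close>, and every later step. Since \<open>s \<le> \<theta>\<close>, the term \<open>2 s \<langle>x, y\<rangle>\<close> by which
  \<open>\<parallel>x + Y\<parallel>\<^sup>2\<close> exceeds the potential is covered by the decrease \<open>2 \<theta> \<langle>x, y\<rangle>\<close>.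
\<close>

lemma start_potential_last_step:
  fixes x Y D N :: "'a::real_inner"
  assumes s: "0 \<le> s" "s \<le> \<theta>" and \<kappa>: "0 \<le> \<kappa>" and \<theta>: "0 < \<theta>"
    and y: "y = Y + D"
    and star: "- inner x y \<le> \<kappa> * (norm y)\<^sup>2"
  shows "(norm (x + Y - \<theta> *\<^sub>R y - N))\<^sup>2
    \<le> start_potential s x Y - (\<theta> * (2 - \<theta> - 2 * \<kappa>) - \<theta> ^ 3 / 4) * (norm y)\<^sup>2
       + (4 / \<theta> + 5/2) * (norm D)\<^sup>2 + (norm N)\<^sup>2 + inner (- 2 *\<^sub>R (x + Y - \<theta> *\<^sub>R y)) N"
proof -
  have Y: "Y = y - D" using y by simp
  have "(norm (x + Y - \<theta> *\<^sub>R y - N))\<^sup>2 = (norm (x + Y - \<theta> *\<^sub>R y))\<^sup>2 + (norm N)\<^sup>2 + inner (- 2 *\<^sub>R (x + Y - \<theta> *\<^sub>R y)) N"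
    unfolding norm_diff_sq[of _ N] by (simp add: algebra_simps)
  also have "(norm (x + Y - \<theta> *\<^sub>R y))\<^sup>2 = (norm (x + Y))\<^sup>2 - 2 * \<theta> * inner x y
      - \<theta> * (2 - \<theta>) * (norm y)\<^sup>2 + \<theta> * (2 * inner y D)"
    unfolding norm_diff_sq[of _ "\<theta> *\<^sub>R y"] Y
    by (simp add: inner_add_left inner_diff_left power_mult_distrib power2_norm_eq_inner[of y] inner_commute[of D y]
        power2_eq_square[of \<theta>] algebra_simps)
  also have "(norm (x + Y))\<^sup>2 = start_potential s x Y + 2 * s * inner x y - 2 * s * inner x D - 2/5 * s\<^sup>2 * (norm x)\<^sup>2
      - (s\<^sup>2 + s / 16) * (norm Y)\<^sup>2"
    unfolding start_potential_def norm_add_sq unfolding Y by (simp add: inner_diff_right algebra_simps)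
  also have "\<dots> \<le> start_potential s x Y + 2 * s * inner x y + 5/2 * (norm D)\<^sup>2"
  proof -
    have "2 * inner (s *\<^sub>R x) (- D) \<le> 2/5 * (norm (s *\<^sub>R x))\<^sup>2 + 5/2 * (norm (- D))\<^sup>2"
      using young_inner[of "2/5" "s *\<^sub>R x" "- D"] by simp
    then have "- (2 * s * inner x D) \<le> 2/5 * s\<^sup>2 * (norm x)\<^sup>2 + 5/2 * (norm D)\<^sup>2"
      by (simp add: power_mult_distrib)
    moreover have "0 \<le> (s\<^sup>2 + s / 16) * (norm Y)\<^sup>2" using s by simp
    ultimately show ?thesis by linarith
  qed
  also have "\<theta> * (2 * inner y D) \<le> \<theta> ^ 3 / 4 * (norm y)\<^sup>2 + 4 / \<theta> * (norm D)\<^sup>2"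
  proof -
    have "\<theta> * (2 * inner y D) \<le> \<theta> * (\<theta>\<^sup>2 / 4 * (norm y)\<^sup>2 + 1 / (\<theta>\<^sup>2 / 4) * (norm D)\<^sup>2)"
      using \<theta> by (intro mult_left_mono young_inner) auto
    also have "\<dots> = \<theta> ^ 3 / 4 * (norm y)\<^sup>2 + 4 / \<theta> * (norm D)\<^sup>2"
      using \<theta> by (simp add: distrib_left power2_eq_square power3_eq_cube)
    finally show ?thesis .
  qed
  finally have *: "(norm (x + Y - \<theta> *\<^sub>R y - N))\<^sup>2
      \<le> start_potential s x Y + 2 * s * inner x y + 5/2 * (norm D)\<^sup>2 - 2 * \<theta> * inner x y
      - \<theta> * (2 - \<theta>) * (norm y)\<^sup>2 + (\<theta> ^ 3 / 4 * (norm y)\<^sup>2 + 4 / \<theta> * (norm D)\<^sup>2)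
      + (norm N)\<^sup>2 + inner (- 2 *\<^sub>R (x + Y - \<theta> *\<^sub>R y)) N"
    by simp
  have "2 * (\<theta> - s) * (- inner x y) \<le> 2 * (\<theta> - s) * (\<kappa> * (norm y)\<^sup>2)"
    using s star by (intro mult_left_mono) auto
  also have "\<dots> \<le> 2 * \<theta> * (\<kappa> * (norm y)\<^sup>2)"
    using s \<kappa> by (intro mult_right_mono) auto
  finally have "2 * s * inner x y - 2 * \<theta> * inner x y \<le> 2 * \<theta> * \<kappa> * (norm y)\<^sup>2"
    by (simp add: algebra_simps)
  with * show ?thesis by (simp add: algebra_simps)
qed

lemma quadratic_form_nonneg:
  fixes x q :: "'a::real_inner"
  assumes "0 \<le> a" "0 \<le> c" "b\<^sup>2 \<le> a * c"
  shows "0 \<le> a * (norm x)\<^sup>2 + 2 * b * inner x q + c * (norm q)\<^sup>2"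
proof (cases "a = 0")
  case True
  then show ?thesis using assms by simp
next
  case False
  then have a: "a > 0" using assms by simp
  have "0 \<le> (norm (a *\<^sub>R x + b *\<^sub>R q))\<^sup>2 + (a * c - b\<^sup>2) * (norm q)\<^sup>2"
    using assms by simp
  also have "\<dots> = a * (a * (norm x)\<^sup>2 + 2 * b * inner x q + c * (norm q)\<^sup>2)"
    unfolding norm_add_sq by (simp add: power_mult_distrib power2_eq_square algebra_simps)
  finally show ?thesis using a by (simp add: zero_le_mult_iff)
qed

text \<open>
  Collects the coefficients of the inner products in a full step of the potential. The arguments stand
  for these inner products; \<open>r\<close>, \<open>t\<close> and \<open>k\<close> stand for \<open>4 / \<theta>\<close>, \<open>7 / (4 \<theta>)\<close> and \<open>4 C' / \<theta>\<close>.
\<close>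

lemma full_step_coefficients:
  fixes P xx xy xq xD yy yD DD qq KN I A' C' C E \<theta> s' r t k :: real
  assumes C: "C = C' + \<theta> + 2 * \<theta> * s' + \<theta>\<^sup>2 + \<theta> / 16" and A': "A' = s' + 2/5 * s'\<^sup>2"
    and E: "E = C + 2/5 * \<theta> * s'\<^sup>2" and k: "k = C' * r"
  shows "P + (- (2/5 * \<theta> * (2 * s' + \<theta>)) * xx + 2 * \<theta> * xy - 2 * \<theta> * xD + (\<theta> - C) * (yy - 2 * yD + DD))
     + (1 - s') * (- 2 * \<theta> * xy - \<theta> * (2 - \<theta>) * yy + 2 * \<theta> * yD)
     + A' * (- 2 * \<theta> * xy - 2 * xD - 2 * xq + (\<theta>\<^sup>2 * yy + 2 * \<theta> * yD + DD) - qq)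
     + C' * (yy + (1 - t) * qq + r * DD) + KN + I
   = P + (- (2/5 * \<theta> * (2 * s' + \<theta>)) * xx - 2 * A' * xq - 2 * (\<theta> + A') * xD - (A' + C' * (t - 1)) * qq)
     + 4/5 * \<theta> * s'\<^sup>2 * (- xy) + (2 * E * yD)
     - (\<theta> * (2 - \<theta>) + \<theta>\<^sup>2 + \<theta> / 16 - 2/5 * \<theta>\<^sup>2 * s'\<^sup>2) * yy + (\<theta> + A' - C + k) * DD + KN + I"
proof -
  have y: "(\<theta> - C) * yy + C' * yy = - (2 * \<theta> * s' + \<theta>\<^sup>2 + \<theta> / 16) * yy"
    unfolding C by (simp add: algebra_simps)
  have A'y: "A' * (\<theta>\<^sup>2 * yy) = \<theta>\<^sup>2 * s' * yy + 2/5 * \<theta>\<^sup>2 * s'\<^sup>2 * yy"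
    "A' * (2 * \<theta> * xy) = 2 * \<theta> * s' * xy + 4/5 * \<theta> * s'\<^sup>2 * xy"
    "A' * (2 * \<theta> * yD) = 2 * \<theta> * s' * yD + 4/5 * \<theta> * s'\<^sup>2 * yD"
    unfolding A' by (simp_all add: algebra_simps)
  have "2 * E * yD = 2 * C * yD + 4/5 * \<theta> * s'\<^sup>2 * yD" unfolding E by (simp add: algebra_simps)
  with y A'y show ?thesis unfolding k by (simp add: algebra_simps power2_eq_square)
qed

text \<open>
  A step from \<open>s\<close> to \<open>s' = s - \<theta>\<close>. Here \<open>q\<close> is the increment \<open>Y' - y\<close>, a multiple of the increment of
  \<open>v\<close>, and the assumption on it is monotonicity of \<open>T\<close>. It bounds \<open>\<langle>y, q\<rangle>\<close> by about \<open>- \<parallel>q\<parallel>\<^sup>2 / \<theta>\<close>, so the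
  term \<open>\<parallel>Y'\<parallel>\<^sup>2\<close> yields a large negative multiple of \<open>\<parallel>q\<parallel>\<^sup>2\<close>. This multiple and the decrease of the weight of
  \<open>\<parallel>x\<parallel>\<^sup>2\<close> absorb the mixed term \<open>\<langle>x, q\<rangle>\<close>. One quarter of the latter decrease is set aside for \<open>\<langle>x, D\<rangle>\<close>.
\<close>

lemma start_potential_full_step:
  fixes x Y D N q :: "'a::real_inner"
  assumes s': "0 \<le> s'" and s: "s = s' + \<theta>" "s \<le> 1/2" and \<kappa>: "0 \<le> \<kappa>" and \<theta>: "0 < \<theta>"
    and y: "y = Y + D"
    and star: "- inner x y \<le> \<kappa> * (norm y)\<^sup>2"
    and mono: "(norm q)\<^sup>2 + inner (\<theta> *\<^sub>R y + D + N) q \<le> 0"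
  defines "x' \<equiv> x - (\<theta> *\<^sub>R y + D + N) - q" and "Y' \<equiv> y + q"
  shows "start_potential s' x' Y'
    \<le> start_potential s x Y - (\<theta> * (2 - \<theta> - 2 * \<kappa>) + \<theta>\<^sup>2 * (1 - 2/5 * s'\<^sup>2)) * (norm y)\<^sup>2
       + (40 * s / \<theta>) * (norm D)\<^sup>2 + (1 + 13/2 * (s / \<theta>)) * (norm N)\<^sup>2
       + inner (- (2 * (1 - s')) *\<^sub>R (x + Y - \<theta> *\<^sub>R y) - (2 * (s' + 2/5 * s'\<^sup>2)) *\<^sub>R (x - \<theta> *\<^sub>R y - D)
           + (8 * (s' + s'\<^sup>2 + s' / 16) / \<theta>) *\<^sub>R D) N"
proof -
  define A' where "A' = s' + 2/5 * s'\<^sup>2"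
  define C' where "C' = s' + s'\<^sup>2 + s' / 16"
  define C where "C = s + s\<^sup>2 + s / 16"
  define E where "E = C + 2/5 * \<theta> * s'\<^sup>2"
  have nn: "0 \<le> A'" "0 \<le> C'" "0 \<le> C" "0 \<le> E" using s' s \<theta> by (auto simp: A'_def C'_def C_def E_def)
  have Y: "Y = y - D" using y by simp
  have u: "x' + Y' = (x + Y - \<theta> *\<^sub>R y) - N" by (simp add: x'_def Y'_def Y)
  have 1: "(norm (x' + Y'))\<^sup>2 = (norm (x + Y))\<^sup>2 - 2 * \<theta> * inner x y
      - \<theta> * (2 - \<theta>) * (norm y)\<^sup>2 + 2 * \<theta> * inner y D + (norm N)\<^sup>2 - 2 * inner (x + Y - \<theta> *\<^sub>R y) N"
  proof -
    have "(norm (x + Y - \<theta> *\<^sub>R y))\<^sup>2 = (norm (x + Y))\<^sup>2 - 2 * \<theta> * inner x y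
      - \<theta> * (2 - \<theta>) * (norm y)\<^sup>2 + 2 * \<theta> * inner y D"
      unfolding norm_diff_sq[of _ "\<theta> *\<^sub>R y"] Y
      by (simp add: inner_add_left inner_diff_left power_mult_distrib power2_norm_eq_inner[of y] inner_commute[of D y]
        power2_eq_square[of \<theta>] algebra_simps)
    then show ?thesis unfolding u norm_diff_sq[of _ N] by simp
  qed
  have 2: "(norm x')\<^sup>2 \<le> (norm x)\<^sup>2 - 2 * \<theta> * inner x y - 2 * inner x D - 2 * inner x q
      + (\<theta>\<^sup>2 * (norm y)\<^sup>2 + 2 * \<theta> * inner y D + (norm D)\<^sup>2 + (norm N)\<^sup>2) - (norm q)\<^sup>2
      - 2 * inner (x - \<theta> *\<^sub>R y - D) N"
  proof -
    have "(norm x')\<^sup>2 = (norm x)\<^sup>2 - 2 * inner x (\<theta> *\<^sub>R y + D + N) - 2 * inner x q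
       + (norm (\<theta> *\<^sub>R y + D + N))\<^sup>2 + 2 * inner (\<theta> *\<^sub>R y + D + N) q + (norm q)\<^sup>2"
      unfolding x'_def norm_diff_sq by (simp add: inner_diff_left)
    also have "(norm (\<theta> *\<^sub>R y + D + N))\<^sup>2
      = \<theta>\<^sup>2 * (norm y)\<^sup>2 + 2 * \<theta> * inner y D + (norm D)\<^sup>2 + (norm N)\<^sup>2 + 2 * inner (\<theta> *\<^sub>R y + D) N"
      unfolding norm_add_sq by (simp add: power_mult_distrib)
    finally show ?thesis using mono
      by (simp add: inner_add_right inner_diff_left inner_add_left algebra_simps)
  qed
  have 3: "(norm Y')\<^sup>2 \<le> (norm y)\<^sup>2 + (1 - 7 / (4 * \<theta>)) * (norm q)\<^sup>2 + 4 / \<theta> * ((norm D)\<^sup>2 + (norm N)\<^sup>2 + 2 * inner D N)"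
  proof -
    have "2 * inner (D + N) (- q) \<le> 4 * (norm (D + N))\<^sup>2 + 1/4 * (norm (- q))\<^sup>2"
      using young_inner[of 4 "D + N" "- q"] by simp
    then have "2 * \<theta> * inner y q \<le> 4 * (norm (D + N))\<^sup>2 - 7/4 * (norm q)\<^sup>2"
      using mono by (simp add: inner_add_left)
    then have "2 * inner y q \<le> (4 * (norm (D + N))\<^sup>2 - 7/4 * (norm q)\<^sup>2) / \<theta>"
      using \<theta> by (simp add: field_simps)
    also have "\<dots> = 4 / \<theta> * (norm (D + N))\<^sup>2 - 7 / (4 * \<theta>) * (norm q)\<^sup>2"
      using \<theta> by (simp add: field_simps)
    finally show ?thesis unfolding Y'_def norm_add_sq by (simp add: algebra_simps)
  qed
  have x_terms: "- (2/5 * \<theta> * (2 * s' + \<theta>)) * (norm x)\<^sup>2 - 2 * A' * inner x q - 2 * (\<theta> + A') * inner x D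
      - (A' + C' * (7 / (4 * \<theta>) - 1)) * (norm q)\<^sup>2 \<le> 10 * (\<theta> + A') / \<theta> * (norm D)\<^sup>2"
  proof -
    let ?r = "\<theta> * (2 * s' + \<theta>)"
    have r: "?r > 0" using s' \<theta> by simp
    have A2: "\<theta> + A' \<le> 2 * s' + \<theta>"
    proof -
      have "s' * s' \<le> 1/2 * s'" using s s' \<theta> by (intro mult_right_mono) auto
      then show ?thesis using s' by (simp add: A'_def power2_eq_square)
    qed
    have "0 \<le> 1/10 * ?r * (norm x)\<^sup>2 + 2 * (\<theta> + A') * inner x D + (10 * (\<theta> + A') / \<theta>) * (norm D)\<^sup>2"
    proof (rule quadratic_form_nonneg)
      have "(\<theta> + A')\<^sup>2 \<le> (2 * s' + \<theta>) * (\<theta> + A')"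
        using A2 nn \<theta> by (simp add: power2_eq_square mult_right_mono)
      also have "\<dots> = 1/10 * ?r * (10 * (\<theta> + A') / \<theta>)" using \<theta> by simp
      finally show "(\<theta> + A')\<^sup>2 \<le> 1/10 * ?r * (10 * (\<theta> + A') / \<theta>)" .
    qed (use r nn \<theta> in auto)
    moreover have "0 \<le> 3/10 * ?r * (norm x)\<^sup>2 + 2 * A' * inner x q + (A' + C' * (7 / (4 * \<theta>) - 1)) * (norm q)\<^sup>2"
    proof (rule quadratic_form_nonneg)
      have th: "\<theta> \<le> 1/2" "s' \<le> 1/2" using s s' \<theta> by auto
      have g: "A' + C' * (7 / (4 * \<theta>) - 1) = (\<theta> * A' + C' * (7/4 - \<theta>)) / \<theta>"
        using \<theta> by (simp add: field_simps)
      show "0 \<le> A' + C' * (7 / (4 * \<theta>) - 1)" unfolding g using nn \<theta> th by simp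
      have st: "s' * \<theta> \<le> s' * (1/2)" "s' * s' \<le> s' * (1/2)"
        by (rule mult_left_mono; use s' th in simp)+
      have "(1 + 2/5 * s')\<^sup>2 \<le> 6/10 * (\<theta> * (1 + 2/5 * s') + (1 + s') * (7/4 - \<theta>))"
      proof -
        have "(1 + 2/5 * s')\<^sup>2 = 1 + 4/5 * s' + 4/25 * (s' * s')"
          by (simp add: power2_eq_square algebra_simps)
        moreover have "6/10 * (\<theta> * (1 + 2/5 * s') + (1 + s') * (7/4 - \<theta>))
            = 21/20 + 21/20 * s' - 9/25 * (s' * \<theta>)"
          by (simp add: algebra_simps)
        ultimately show ?thesis using st s' th by linarith
      qed
      then have "s' * s' * (1 + 2/5 * s')\<^sup>2 \<le> s' * s' * (6/10 * (\<theta> * (1 + 2/5 * s') + (1 + s') * (7/4 - \<theta>)))"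
        using s' by (intro mult_left_mono) auto
      also have "\<dots> = 6/10 * s' * (\<theta> * A' + (s' + s'\<^sup>2) * (7/4 - \<theta>))"
        by (simp add: A'_def power2_eq_square algebra_simps)
      also have "\<dots> \<le> 6/10 * s' * (\<theta> * A' + C' * (7/4 - \<theta>))"
        using s' th by (intro mult_left_mono add_left_mono mult_right_mono) (auto simp: C'_def)
      also have "\<dots> \<le> 3/10 * (2 * s' + \<theta>) * (\<theta> * A' + C' * (7/4 - \<theta>))"
        using nn \<theta> th by (intro mult_right_mono) auto
      finally have "A'\<^sup>2 \<le> 3/10 * (2 * s' + \<theta>) * (\<theta> * A' + C' * (7/4 - \<theta>))"
        by (simp add: A'_def power2_eq_square algebra_simps)
      also have "\<dots> = 3/10 * ?r * (A' + C' * (7 / (4 * \<theta>) - 1))"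
        unfolding g using \<theta> by (simp add: field_simps)
      finally show "A'\<^sup>2 \<le> 3/10 * ?r * (A' + C' * (7 / (4 * \<theta>) - 1))" .
    qed (use r in auto)
    moreover have "- (2/5 * \<theta> * (2 * s' + \<theta>)) * (norm x)\<^sup>2
        = - (1/10 * ?r * (norm x)\<^sup>2) - 3/10 * ?r * (norm x)\<^sup>2"
      by (simp add: algebra_simps)
    ultimately show ?thesis by linarith
  qed
  have y_terms: "2 * E * inner y D \<le> \<theta> / 16 * (norm y)\<^sup>2 + 16 * E\<^sup>2 / \<theta> * (norm D)\<^sup>2"
    using young_inner[of "\<theta> / 16" y "E *\<^sub>R D"] \<theta> by (simp add: power_mult_distrib field_simps)
  have "start_potential s' x' Y' = (1 - s') * (norm (x' + Y'))\<^sup>2 + A' * (norm x')\<^sup>2 + C' * (norm Y')\<^sup>2"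
    by (simp add: start_potential_def A'_def C'_def)
  also have "\<dots> \<le> (1 - s') * ((norm (x + Y))\<^sup>2 - 2 * \<theta> * inner x y
      - \<theta> * (2 - \<theta>) * (norm y)\<^sup>2 + 2 * \<theta> * inner y D + (norm N)\<^sup>2 - 2 * inner (x + Y - \<theta> *\<^sub>R y) N)
     + A' * ((norm x)\<^sup>2 - 2 * \<theta> * inner x y - 2 * inner x D - 2 * inner x q
      + (\<theta>\<^sup>2 * (norm y)\<^sup>2 + 2 * \<theta> * inner y D + (norm D)\<^sup>2 + (norm N)\<^sup>2) - (norm q)\<^sup>2
      - 2 * inner (x - \<theta> *\<^sub>R y - D) N)
     + C' * ((norm y)\<^sup>2 + (1 - 7 / (4 * \<theta>)) * (norm q)\<^sup>2 + 4 / \<theta> * ((norm D)\<^sup>2 + (norm N)\<^sup>2 + 2 * inner D N))"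
    unfolding 1 by (intro add_mono mult_left_mono 2 3 order_refl nn)
  also have "\<dots> = start_potential s x Y
     + (\<theta> * (norm (x + Y))\<^sup>2 + (A' - (s + 2/5 * s\<^sup>2)) * (norm x)\<^sup>2 - C * (norm Y)\<^sup>2)
     + (1 - s') * (- 2 * \<theta> * inner x y
      - \<theta> * (2 - \<theta>) * (norm y)\<^sup>2 + 2 * \<theta> * inner y D)
     + A' * (- 2 * \<theta> * inner x y - 2 * inner x D - 2 * inner x q
      + (\<theta>\<^sup>2 * (norm y)\<^sup>2 + 2 * \<theta> * inner y D + (norm D)\<^sup>2) - (norm q)\<^sup>2)
     + C' * ((norm y)\<^sup>2 + (1 - 7 / (4 * \<theta>)) * (norm q)\<^sup>2 + 4 / \<theta> * ((norm D)\<^sup>2))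
     + (1 + 2/5 * s'\<^sup>2 + 4 * C' / \<theta>) * (norm N)\<^sup>2
     + inner (- (2 * (1 - s')) *\<^sub>R (x + Y - \<theta> *\<^sub>R y) - (2 * A') *\<^sub>R (x - \<theta> *\<^sub>R y - D)
           + (8 * C' / \<theta>) *\<^sub>R D) N"
  proof -
    have e1: "start_potential s x Y = (1 - s' - \<theta>) * (norm (x + Y))\<^sup>2 + (s + 2/5 * s\<^sup>2) * (norm x)\<^sup>2 + C * (norm Y)\<^sup>2"
      by (simp add: start_potential_def C_def s algebra_simps)
    have e2: "inner (- (2 * (1 - s')) *\<^sub>R (x + Y - \<theta> *\<^sub>R y) - (2 * A') *\<^sub>R (x - \<theta> *\<^sub>R y - D)
           + (8 * C' / \<theta>) *\<^sub>R D) N = - (2 * (1 - s')) * inner (x + Y - \<theta> *\<^sub>R y) N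
           - 2 * A' * inner (x - \<theta> *\<^sub>R y - D) N + 8 * C' / \<theta> * inner D N"
      by (simp only: inner_add_left inner_diff_left inner_scaleR_left)
    have e3: "1 + 2/5 * s'\<^sup>2 = (1 - s') + A'" by (simp add: A'_def)
    show ?thesis unfolding e1 e2 e3 by (simp add: algebra_simps)
  qed
  also have "\<theta> * (norm (x + Y))\<^sup>2 + (A' - (s + 2/5 * s\<^sup>2)) * (norm x)\<^sup>2 - C * (norm Y)\<^sup>2
      = - (2/5 * \<theta> * (2 * s' + \<theta>)) * (norm x)\<^sup>2 + 2 * \<theta> * inner x y - 2 * \<theta> * inner x D
       + (\<theta> - C) * ((norm y)\<^sup>2 - 2 * inner y D + (norm D)\<^sup>2)"
  proof -
    have e1: "(norm (x + Y))\<^sup>2 = (norm x)\<^sup>2 + 2 * inner x y - 2 * inner x D + (norm Y)\<^sup>2"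
      unfolding norm_add_sq by (simp add: Y inner_diff_right)
    have e2: "(norm Y)\<^sup>2 = (norm y)\<^sup>2 - 2 * inner y D + (norm D)\<^sup>2"
      unfolding Y norm_diff_sq ..
    show ?thesis unfolding e1 e2 by (simp add: A'_def s power2_sum power2_eq_square[of s'] power2_eq_square[of \<theta>] algebra_simps)
  qed
  finally have main: "start_potential s' x' Y' \<le> start_potential s x Y
     + (- (2/5 * \<theta> * (2 * s' + \<theta>)) * (norm x)\<^sup>2 - 2 * A' * inner x q - 2 * (\<theta> + A') * inner x D
      - (A' + C' * (7 / (4 * \<theta>) - 1)) * (norm q)\<^sup>2)
     + 4/5 * \<theta> * s'\<^sup>2 * (- inner x y)
     + (2 * E * inner y D)
     - (\<theta> * (2 - \<theta>) + \<theta>\<^sup>2 + \<theta> / 16 - 2/5 * \<theta>\<^sup>2 * s'\<^sup>2) * (norm y)\<^sup>2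
     + (\<theta> + A' - C + 4 * C' / \<theta>) * (norm D)\<^sup>2
     + (1 + 2/5 * s'\<^sup>2 + 4 * C' / \<theta>) * (norm N)\<^sup>2
     + inner (- (2 * (1 - s')) *\<^sub>R (x + Y - \<theta> *\<^sub>R y) - (2 * A') *\<^sub>R (x - \<theta> *\<^sub>R y - D)
           + (8 * C' / \<theta>) *\<^sub>R D) N"
    by (rule ord_le_eq_trans[OF _ full_step_coefficients])
       (simp_all add: A'_def C'_def C_def E_def s power2_sum power2_eq_square algebra_simps add_divide_distrib)
  have th: "\<theta> \<le> 1/2" "s' \<le> 1/2" "s' \<le> s" "0 \<le> s" using s s' \<theta> by auto
  have s'2: "s' * s' \<le> 1/2 * s'" and s2: "s * s \<le> 1/2 * s"
    using mult_right_mono[of s' "1/2" s'] mult_right_mono[of s "1/2" s] th s(2) s' by auto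
  have A'_le: "\<theta> + A' \<le> 6/5 * s" using s'2 s \<theta> by (simp add: A'_def power2_eq_square)
  have C'_le: "C' \<le> 25/16 * s'" using s'2 by (simp add: C'_def power2_eq_square)
  have E_le: "E \<le> 8/5 * s"
  proof -
    have "0 \<le> (\<theta> - s')\<^sup>2" by simp
    then have "4 * (\<theta> * s') \<le> s * s" by (simp add: s power2_eq_square algebra_simps)
    then have "\<theta> * s' \<le> 1/16" using s2 s by linarith
    then have "\<theta> * s' * s' \<le> 1/16 * s'" using s' by (rule mult_right_mono)
    then show ?thesis using s2 th by (simp add: E_def C_def power2_eq_square)
  qed
  have D_coeff: "10 * (\<theta> + A') / \<theta> + 16 * E\<^sup>2 / \<theta> + (\<theta> + A' - C + 4 * C' / \<theta>) \<le> 40 * s / \<theta>"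
  proof -
    have "E\<^sup>2 \<le> (8/5 * s)\<^sup>2" using E_le nn by (intro power_mono) auto
    then have "E\<^sup>2 \<le> 32/25 * s" using s2 by (simp add: power2_eq_square)
    then have "10 * (\<theta> + A') + 16 * E\<^sup>2 + 4 * C' \<le> 40 * s"
      using A'_le C'_le th unfolding distrib_left by linarith
    then have "(10 * (\<theta> + A') + 16 * E\<^sup>2 + 4 * C') / \<theta> \<le> 40 * s / \<theta>"
      using \<theta> by (simp add: divide_right_mono)
    moreover have "\<theta> + A' - C \<le> 0"
    proof -
      have "s' * s' \<le> s * s" using th s' by (intro mult_mono) auto
      moreover have "0 \<le> s' * s'" by simp
      moreover have "\<theta> + A' - C = 2/5 * (s' * s') - s * s - s / 16"
        by (simp add: A'_def C_def power2_eq_square s(1))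
      ultimately show ?thesis using th by linarith
    qed
    ultimately show ?thesis by (simp add: add_divide_distrib)
  qed
  have N_coeff: "1 + 2/5 * s'\<^sup>2 + 4 * C' / \<theta> \<le> 1 + 13/2 * (s / \<theta>)"
  proof -
    have "2/5 * s'\<^sup>2 \<le> 1/10" using s'2 th by (simp add: power2_eq_square)
    then have "\<theta> * (2/5 * s'\<^sup>2) \<le> \<theta> * (1/10)" using \<theta> by (intro mult_left_mono) auto
    then have "\<theta> * (2/5 * s'\<^sup>2) + 4 * C' \<le> 13/2 * s" using C'_le s s' \<theta> by linarith
    then have "(\<theta> * (2/5 * s'\<^sup>2) + 4 * C') / \<theta> \<le> 13/2 * s / \<theta>"
      by (rule divide_right_mono) (use \<theta> in simp)
    then show ?thesis using \<theta> by (simp add: add_divide_distrib)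
  qed
  have star': "4/5 * \<theta> * s'\<^sup>2 * (- inner x y) \<le> 2 * \<theta> * \<kappa> * (norm y)\<^sup>2"
  proof -
    have "4/5 * \<theta> * s'\<^sup>2 * (- inner x y) \<le> 4/5 * \<theta> * s'\<^sup>2 * (\<kappa> * (norm y)\<^sup>2)"
      using star \<theta> by (intro mult_left_mono) auto
    also have "\<dots> \<le> 2 * \<theta> * (\<kappa> * (norm y)\<^sup>2)"
    proof (rule mult_right_mono)
      have "4/5 * s'\<^sup>2 \<le> 2" using s'2 th by (simp add: power2_eq_square)
      then have "\<theta> * (4/5 * s'\<^sup>2) \<le> \<theta> * 2" using \<theta> by (intro mult_left_mono) auto
      then show "4/5 * \<theta> * s'\<^sup>2 \<le> 2 * \<theta>" by simp
    qed (use \<kappa> in simp)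
    finally show ?thesis by simp
  qed
  have "10 * (\<theta> + A') / \<theta> * (norm D)\<^sup>2 + 16 * E\<^sup>2 / \<theta> * (norm D)\<^sup>2 + (\<theta> + A' - C + 4 * C' / \<theta>) * (norm D)\<^sup>2
      \<le> 40 * s / \<theta> * (norm D)\<^sup>2"
    using mult_right_mono[OF D_coeff, of "(norm D)\<^sup>2"] by (simp only: ring_distribs) simp
  moreover have "(1 + 2/5 * s'\<^sup>2 + 4 * C' / \<theta>) * (norm N)\<^sup>2 \<le> (1 + 13/2 * (s / \<theta>)) * (norm N)\<^sup>2"
    by (rule mult_right_mono[OF N_coeff]) simp
  moreover have "(\<theta> * (2 - \<theta>) + \<theta>\<^sup>2 + \<theta> / 16 - 2/5 * \<theta>\<^sup>2 * s'\<^sup>2) * (norm y)\<^sup>2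
      = (\<theta> * (2 - \<theta> - 2 * \<kappa>) + \<theta>\<^sup>2 * (1 - 2/5 * s'\<^sup>2)) * (norm y)\<^sup>2 + 2 * \<theta> * \<kappa> * (norm y)\<^sup>2 + \<theta> / 16 * (norm y)\<^sup>2"
    by (simp add: algebra_simps)
  ultimately show ?thesis
    using main x_terms y_terms star' unfolding A'_def[symmetric] C'_def[symmetric] by linarith
qed

section \<open>Size of the step-size constant\<close>

text \<open>
  The constant \<open>(C + C_hat) / \<rho>\<close> is \<open>variance_factor (1 + \<gamma>\<^sup>2)\<close>; the analysis of the table gives the
  smaller \<open>variance_factor ((1 - \<gamma>)\<^sup>2)\<close>.
\<close>

definition variance_factor :: "real \<Rightarrow> real \<Rightarrow> real \<Rightarrow> real" where
  "variance_factor c N b = 2 / b ^ 3 * (2 * c * ((N - b) * (2 * N + b)) + b\<^sup>2)"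

lemma cube_times_variance_factor: "b \<noteq> 0 \<Longrightarrow> b ^ 3 * variance_factor c N b = 4 * c * ((N - b) * (2 * N + b)) + 2 * b\<^sup>2"
  by (simp add: variance_factor_def)

lemma batch_gap_le: "b \<le> N \<Longrightarrow> 0 < b \<Longrightarrow> (N - b) * (2 * N + b) \<le> 2 * N\<^sup>2 - 2 * (b::real)\<^sup>2"
proof -
  assume "b \<le> N" "0 < b"
  then have "b * b \<le> N * b" by (intro mult_right_mono) auto
  then show ?thesis by (simp add: algebra_simps power2_eq_square)
qed

text \<open>
  With \<open>N = n\<close> and multiplied by \<open>4 \<gamma> / (1 - \<gamma>)\<close> this is \<open>M b\<^sup>3 \<le> n\<^sup>2 / \<sigma>\<^sup>2\<close>.
\<close>

lemma variance_factor_le: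
  fixes b N \<gamma> :: real
  assumes b: "0 < b" "b \<le> N" "b ^ 3 \<le> N\<^sup>2" and \<gamma>: "0 < \<gamma>" "\<gamma> < 1"
  shows "b ^ 3 * (\<gamma> * (1 - \<gamma>) + variance_factor (1 + \<gamma>\<^sup>2) N b) \<le> (10 + \<gamma> + 7 * \<gamma>\<^sup>2) * N\<^sup>2"
proof -
  have "b ^ 3 * (\<gamma> * (1 - \<gamma>)) \<le> N\<^sup>2 * (\<gamma> * (1 - \<gamma>))"
    using b \<gamma> by (intro mult_right_mono) auto
  moreover have "4 * (1 + \<gamma>\<^sup>2) * ((N - b) * (2 * N + b)) \<le> 4 * (1 + \<gamma>\<^sup>2) * (2 * N\<^sup>2 - 2 * b\<^sup>2)"
    using b by (intro mult_left_mono batch_gap_le) auto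
  moreover have "4 * (1 + \<gamma>\<^sup>2) * (2 * N\<^sup>2 - 2 * b\<^sup>2) + 2 * b\<^sup>2 = 8 * N\<^sup>2 + 8 * (\<gamma>\<^sup>2 * N\<^sup>2) - 6 * b\<^sup>2 - 8 * (\<gamma>\<^sup>2 * b\<^sup>2)"
    by (simp add: algebra_simps)
  moreover have "0 \<le> \<gamma>\<^sup>2 * b\<^sup>2" "0 \<le> b\<^sup>2" "0 \<le> N\<^sup>2" by simp_all
  moreover have "b ^ 3 * (\<gamma> * (1 - \<gamma>) + variance_factor (1 + \<gamma>\<^sup>2) N b)
      = b ^ 3 * (\<gamma> * (1 - \<gamma>)) + (4 * (1 + \<gamma>\<^sup>2) * ((N - b) * (2 * N + b)) + 2 * b\<^sup>2)"
    using cube_times_variance_factor[of b "1 + \<gamma>\<^sup>2" N] b by (simp add: distrib_left)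
  moreover have "(10 + \<gamma> + 7 * \<gamma>\<^sup>2) * N\<^sup>2 = 10 * N\<^sup>2 + \<gamma> * N\<^sup>2 + 7 * (\<gamma>\<^sup>2 * N\<^sup>2)"
     "N\<^sup>2 * (\<gamma> * (1 - \<gamma>)) = \<gamma> * N\<^sup>2 - \<gamma>\<^sup>2 * N\<^sup>2"
    by (simp_all add: algebra_simps power2_eq_square)
  ultimately show ?thesis by linarith
qed

text \<open>
  The assumption bounds \<open>n\<close> by \<open>2\<close> if \<open>b = 1\<close> and by \<open>5\<close> if \<open>b = 2\<close>. Equality holds for \<open>b = 1\<close>, \<open>n = 2\<close>.
  For \<open>b \<ge> 3\<close> replacing \<open>n\<^sup>2\<close> by \<open>(b + 1)\<^sup>3 - 1\<close> is accurate enough.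
\<close>

lemma batch_gap_le_cube:
  fixes n b :: nat
  assumes b: "1 \<le> b" "b \<le> n" and n: "n\<^sup>2 < (b + 1) ^ 3"
  shows "(real n - real b) * (2 * real n + real b) \<le> 5 * real b ^ 3"
proof -
  consider "b = 1" | "b = 2" | "3 \<le> b" using b by linarith
  then show ?thesis
  proof cases
    case 1
    have "n \<le> 2"
    proof (rule ccontr)
      assume "\<not> n \<le> 2"
      then have "3\<^sup>2 \<le> n\<^sup>2" by (intro power_mono) auto
      then show False using n 1 by (simp add: power3_eq_cube)
    qed
    then have "(real n - 1) * (2 * real n + 1) \<le> 1 * 5" using b by (intro mult_mono) auto
    then show ?thesis using 1 by simp
  next
    case 2
    have "n \<le> 5"
    proof (rule ccontr)
      assume "\<not> n \<le> 5"
      then have "6\<^sup>2 \<le> n\<^sup>2" by (intro power_mono) auto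
      then show False using n 2 by (simp add: power3_eq_cube)
    qed
    then have "(real n - 2) * (2 * real n + 2) \<le> 3 * 12" using b 2 by (intro mult_mono) auto
    then show ?thesis using 2 by simp
  next
    case 3
    have "real (n\<^sup>2) \<le> real ((b + 1) ^ 3 - 1)" using n by linarith
    then have n2: "(real n)\<^sup>2 \<le> (real b + 1) ^ 3 - 1" by (simp add: of_nat_diff add.commute)
    have "(real n - real b) * (2 * real n + real b) \<le> 2 * (real n)\<^sup>2 - 2 * (real b)\<^sup>2"
      using b by (intro batch_gap_le) auto
    also have "\<dots> \<le> 2 * ((real b + 1) ^ 3 - 1) - 2 * (real b)\<^sup>2" using n2 by simp
    also have "\<dots> = 2 * real b ^ 3 + 4 * (real b)\<^sup>2 + 6 * real b"
      by (simp add: power3_eq_cube power2_eq_square algebra_simps)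
    also have "\<dots> \<le> 5 * real b ^ 3"
    proof -
      have "3 * real b \<le> real b * real b" using 3 by (intro mult_right_mono) auto
      moreover have "3 * (real b * real b) \<le> real b * (real b * real b)" using 3 by (intro mult_right_mono) auto
      ultimately show ?thesis by (simp add: power2_eq_square power3_eq_cube)
    qed
    finally show ?thesis .
  qed
qed

text \<open>
  This is \<open>M \<sigma>\<^sup>2 \<le> 7/3\<close> for \<open>b = \<lfloor>n powr (2/3)\<rfloor>\<close>. The two sides meet for \<open>n = 2\<close>, \<open>b = 1\<close>, \<open>\<gamma> = 1\<close>.
\<close>

lemma variance_factor_le_of_floor:
  fixes n b :: nat and \<gamma> :: real
  assumes b: "1 \<le> b" "b \<le> n" and n: "n\<^sup>2 < (b + 1) ^ 3" and \<gamma>: "0 < \<gamma>" "\<gamma> < 1"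
  shows "\<gamma> * (1 - \<gamma>) + variance_factor (1 + \<gamma>\<^sup>2) (real n) (real b) \<le> 7/3 * (10 + \<gamma> + 7 * \<gamma>\<^sup>2)"
proof -
  let ?b = "real b"
  have "?b ^ 3 * variance_factor (1 + \<gamma>\<^sup>2) (real n) ?b = 4 * (1 + \<gamma>\<^sup>2) * ((real n - ?b) * (2 * real n + ?b)) + 2 * ?b\<^sup>2"
    using b by (intro cube_times_variance_factor) simp
  also have "\<dots> \<le> 4 * (1 + \<gamma>\<^sup>2) * (5 * ?b ^ 3) + 2 * ?b ^ 3"
    using b by (intro add_mono mult_left_mono batch_gap_le_cube n power_increasing) auto
  also have "\<dots> = ?b ^ 3 * (22 + 20 * \<gamma>\<^sup>2)" by (simp add: algebra_simps)
  finally have "variance_factor (1 + \<gamma>\<^sup>2) (real n) ?b \<le> 22 + 20 * \<gamma>\<^sup>2"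
    by (rule mult_left_le_imp_le) (use b in simp)
  moreover have "\<gamma> * \<gamma> \<le> 1 * \<gamma>" using \<gamma> by (intro mult_right_mono) auto
  moreover have "\<gamma> * (1 - \<gamma>) = \<gamma> - \<gamma> * \<gamma>"
    "7/3 * (10 + \<gamma> + 7 * \<gamma>\<^sup>2) = 70/3 + 7/3 * \<gamma> + 49/3 * (\<gamma> * \<gamma>)" "\<gamma>\<^sup>2 = \<gamma> * \<gamma>"
    by (simp_all add: power2_eq_square algebra_simps)
  ultimately show ?thesis using \<gamma> by linarith
qed

text \<open>
  The assumption is \<open>M \<sigma>\<^sup>2 > 1\<close>. It forces the first bound, which makes \<open>\<eta>\<close> small, and it also forces
  \<open>(n - b) (2 n + b)\<close> to dominate \<open>b\<^sup>2\<close>, so that the true variance constant is a small fraction of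
  the one that enters \<open>M\<close>.
\<close>

lemma variance_factor_large:
  fixes b N \<gamma> :: real
  assumes b: "1 \<le> b" "b \<le> N" and \<gamma>: "1/2 < \<gamma>" "\<gamma> < 1"
    and large: "10 + \<gamma> + 7 * \<gamma>\<^sup>2 < \<gamma> * (1 - \<gamma>) + variance_factor (1 + \<gamma>\<^sup>2) N b"
  defines "\<theta> \<equiv> (1 - \<gamma>) / \<gamma>"
  shows "10 + 8 * \<gamma>\<^sup>2 < variance_factor (1 + \<gamma>\<^sup>2) N b"
    and "variance_factor ((1 - \<gamma>)\<^sup>2) N b \<le> (1 + 2 * \<theta>) / 9 * variance_factor (1 + \<gamma>\<^sup>2) N b"
proof -
  let ?F = "(N - b) * (2 * N + b)"
  show Q: "10 + 8 * \<gamma>\<^sup>2 < variance_factor (1 + \<gamma>\<^sup>2) N b"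
    using large by (simp add: power2_eq_square algebra_simps)
  have F: "2 * b\<^sup>2 \<le> ?F"
  proof -
    have b23: "b\<^sup>2 \<le> b ^ 3" using b by (intro power_increasing) auto
    have "b ^ 3 * (10 + 8 * \<gamma>\<^sup>2) \<le> b ^ 3 * variance_factor (1 + \<gamma>\<^sup>2) N b"
      using Q b by (intro mult_left_mono) auto
    also have "\<dots> = 4 * (1 + \<gamma>\<^sup>2) * ?F + 2 * b\<^sup>2"
      using b by (intro cube_times_variance_factor) auto
    finally have "b ^ 3 * (10 + 8 * \<gamma>\<^sup>2) \<le> 4 * (1 + \<gamma>\<^sup>2) * ?F + 2 * b\<^sup>2" .
    moreover have "b\<^sup>2 * (10 + 8 * \<gamma>\<^sup>2) \<le> b ^ 3 * (10 + 8 * \<gamma>\<^sup>2)"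
      using b23 by (intro mult_right_mono) auto
    ultimately have "4 * (1 + \<gamma>\<^sup>2) * (2 * b\<^sup>2) \<le> 4 * (1 + \<gamma>\<^sup>2) * ?F" by (simp add: algebra_simps)
    moreover have "0 < 4 * (1 + \<gamma>\<^sup>2)" by (simp add: add_pos_nonneg)
    ultimately show ?thesis by (rule mult_left_le_imp_le)
  qed
  let ?K = "2 * (1 + \<gamma>\<^sup>2) * (1 + 2 * \<theta>) - 18 * (1 - \<gamma>)\<^sup>2"
  have "0 \<le> 5 * (1 - \<gamma>) * (1 - 2 * \<gamma>)\<^sup>2" using \<gamma> by simp
  also have "\<dots> = \<gamma> * (?K - (4 - \<theta>))"
    using \<gamma> by (simp add: \<theta>_def field_simps power2_eq_square)
  finally have K: "4 - \<theta> \<le> ?K" using \<gamma> by (simp add: zero_le_mult_iff)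
  have "\<theta> < 1" using \<gamma> by (simp add: \<theta>_def field_simps)
  with K have "(4 - \<theta>) * (2 * b\<^sup>2) \<le> ?K * ?F"
    by (intro mult_mono[OF K F]) auto
  moreover have "(1 + 2 * \<theta>) * (2 * g * f + B) - 9 * (2 * c * f + B)
      = (2 * g * (1 + 2 * \<theta>) - 18 * c) * f - (4 - \<theta>) * (2 * B)" for g f B c :: real
    by (simp add: algebra_simps)
  from this[of "1 + \<gamma>\<^sup>2" ?F "b\<^sup>2" "(1 - \<gamma>)\<^sup>2"]
  have "(1 + 2 * \<theta>) * (2 * (1 + \<gamma>\<^sup>2) * ?F + b\<^sup>2) - 9 * (2 * (1 - \<gamma>)\<^sup>2 * ?F + b\<^sup>2)
      = ?K * ?F - (4 - \<theta>) * (2 * b\<^sup>2)" .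
  ultimately have "9 * (2 * (1 - \<gamma>)\<^sup>2 * ?F + b\<^sup>2) \<le> (1 + 2 * \<theta>) * (2 * (1 + \<gamma>\<^sup>2) * ?F + b\<^sup>2)"
    by linarith
  then have *: "2 / b ^ 3 * (9 * (2 * (1 - \<gamma>)\<^sup>2 * ?F + b\<^sup>2)) \<le> 2 / b ^ 3 * ((1 + 2 * \<theta>) * (2 * (1 + \<gamma>\<^sup>2) * ?F + b\<^sup>2))"
    using b by (intro mult_left_mono) auto
  show "variance_factor ((1 - \<gamma>)\<^sup>2) N b \<le> (1 + 2 * \<theta>) / 9 * variance_factor (1 + \<gamma>\<^sup>2) N b"
  proof -
    have "r * u \<le> (1 + 2 * \<theta>) / 9 * (r * w)" if "r * (9 * u) \<le> r * ((1 + 2 * \<theta>) * w)" for r u w :: real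
      using that by (simp add: field_simps)
    from this[OF *] show ?thesis unfolding variance_factor_def .
  qed
qed

section \<open>The SAGA recursion in normalised variables\<close>

text \<open>
  Nonincreasing weights may be shifted together with the index, so a geometric contraction with source
  \<open>u\<close> can be summed against them at the cost of the usual factor \<open>1 / r\<close>.
\<close>

lemma sum_contraction_le:
  fixes h u \<sigma> :: "nat \<Rightarrow> real"
  assumes rec: "\<And>k. h (Suc k) \<le> (1 - r) * h k + c * u k" and h0: "h 0 = 0"
    and r: "0 < r" "r \<le> 1" and c: "0 \<le> c"
    and nonneg: "\<And>k. 0 \<le> h k" "\<And>k. 0 \<le> u k" "\<And>k. 0 \<le> \<sigma> k"
    and decr: "\<And>k. \<sigma> (Suc k) \<le> \<sigma> k"
  shows "(\<Sum>k\<le>K. \<sigma> k * h k) \<le> c / r * (\<Sum>k\<le>K. \<sigma> k * u k)"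
proof -
  have "(\<Sum>k\<le>K. \<sigma> k * h k) = (\<Sum>k<K. \<sigma> (Suc k) * h (Suc k))"
    by (subst sum.atMost_shift) (simp add: h0)
  also have "\<dots> \<le> (\<Sum>k<K. \<sigma> k * ((1 - r) * h k + c * u k))"
    by (intro sum_mono mult_mono rec decr nonneg)
  also have "\<dots> \<le> (\<Sum>k\<le>K. \<sigma> k * ((1 - r) * h k + c * u k))"
    by (rule sum_mono2) (use r c nonneg in \<open>auto intro!: mult_nonneg_nonneg add_nonneg_nonneg\<close>)
  also have "\<dots> = (1 - r) * (\<Sum>k\<le>K. \<sigma> k * h k) + c * (\<Sum>k\<le>K. \<sigma> k * u k)"
    by (simp only: distrib_left mult.left_commute[of "\<sigma> _"] sum.distrib sum_distrib_left)
  finally have "r * (\<Sum>k\<le>K. \<sigma> k * h k) \<le> c * (\<Sum>k\<le>K. \<sigma> k * u k)"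
    by (simp add: left_diff_distrib)
  then show ?thesis using r by (simp add: field_simps)
qed

lemma norm_average_sq_le:
  fixes f :: "nat \<Rightarrow> 'a::real_inner"
  assumes "1 \<le> n"
  shows "(norm (average {1..n} f))\<^sup>2 \<le> (1 / real n) * (\<Sum>i=1..n. (norm (f i))\<^sup>2)"
proof -
  define m where "m = average {1..n} f"
  have m: "(\<Sum>i=1..n. f i) = real n *\<^sub>R m" using assms by (simp add: m_def average_def del: One_nat_def)
  have "0 \<le> (\<Sum>i=1..n. (norm (f i - m))\<^sup>2)" by (intro sum_nonneg) simp
  also have "\<dots> = (\<Sum>i=1..n. (norm (f i))\<^sup>2) - 2 * inner (\<Sum>i=1..n. f i) m + real n * (norm m)\<^sup>2"
    unfolding norm_diff_sq by (simp add: sum.distrib sum_subtractf inner_sum_left sum_distrib_left)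
  also have "\<dots> = (\<Sum>i=1..n. (norm (f i))\<^sup>2) - real n * (norm m)\<^sup>2"
    unfolding m by (simp add: power2_norm_eq_inner)
  finally show ?thesis using assms unfolding m_def[symmetric] by (simp add: field_simps)
qed

lemma average_diff: "average S (\<lambda>i. f i - g i) = average S f - average S g"
  by (simp add: average_def sum_subtractf scaleR_diff_right)

lemma average_scaleR: "average S (\<lambda>i. c *\<^sub>R f i) = c *\<^sub>R average S f"
  by (simp add: average_def scaleR_sum_right[symmetric])

lemma saga_table_cong:
  assumes "\<And>j. j \<le> k \<Longrightarrow> x j = x' j" "\<And>j. j < k \<Longrightarrow> B j = B' j"
  shows "saga_table Gs x B k i = saga_table Gs x' B' k i"
  using assms by (induction k) auto

locale saga_process = batch_process P n b B
  for P :: "'w measure" and n b :: nat and B :: "nat \<Rightarrow> 'w \<Rightarrow> nat set" +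
  fixes Gs :: "nat \<Rightarrow> 'a::real_inner \<Rightarrow> 'a" and T :: "'a operator" and x_star x0 v0 :: 'a
    and L \<kappa> \<gamma> \<eta> :: real and x v :: "nat \<Rightarrow> 'w \<Rightarrow> 'a"
  assumes lipschitz: "\<And>y z. (1 / real n) * (\<Sum>i=1..n. (norm (Gs i y - Gs i z))\<^sup>2) \<le> L\<^sup>2 * (norm (y - z))\<^sup>2"
    and mono: "monotone_operator T"
    and \<kappa>_nonneg: "0 \<le> \<kappa>"
    and star: "\<And>z u. u \<in> T z \<Longrightarrow>
      - \<kappa> * (norm (average {1..n} (\<lambda>i. Gs i z) + u))\<^sup>2 \<le> inner (average {1..n} (\<lambda>i. Gs i z) + u) (z - x_star)"
    and \<gamma>: "1 / 2 < \<gamma>" "\<gamma> < 1" and \<eta>: "0 < \<eta>"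
    and init: "\<And>\<omega>. \<omega> \<in> space P \<Longrightarrow> x 0 \<omega> = x0" "\<And>\<omega>. \<omega> \<in> space P \<Longrightarrow> v 0 \<omega> = v0" "v0 \<in> T x0"
    and step: "\<And>\<omega> k. \<omega> \<in> space P \<Longrightarrow> x (Suc k) \<omega> = x k \<omega>
          - \<eta> *\<^sub>R saga_estimator n \<gamma> Gs (\<lambda>j. x j \<omega>) (\<lambda>j. B j \<omega>) k
          - \<eta> *\<^sub>R (\<gamma> *\<^sub>R v (Suc k) \<omega> - (2 * \<gamma> - 1) *\<^sub>R v k \<omega>)"
    and v_Suc_in: "\<And>\<omega> k. \<omega> \<in> space P \<Longrightarrow> v (Suc k) \<omega> \<in> T (x (Suc k) \<omega>)"
begin

definition G :: "'a \<Rightarrow> 'a" where "G z = average {1..n} (\<lambda>i. Gs i z)"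

definition \<theta> :: real where "\<theta> = (1 - \<gamma>) / \<gamma>"

text \<open>
  With the factor \<open>\<gamma> \<eta>\<close> in \<open>y\<close>, \<open>Y\<close> and \<open>D\<close> the recursion has \<open>\<theta>\<close> as its only coefficient. \<open>D\<close> is the drift of
  \<open>G\<close> along the last move and \<open>N\<close> the estimator noise; \<open>D 0\<close> vanishes because \<open>0 - 1 = 0\<close>.
\<close>

definition X where "X k \<omega> = x k \<omega> - x_star"
definition Y where "Y k \<omega> = (\<gamma> * \<eta>) *\<^sub>R (G (x (k - 1) \<omega>) + v k \<omega>)"
definition D where "D k \<omega> = (\<gamma> * \<eta>) *\<^sub>R (G (x k \<omega>) - G (x (k - 1) \<omega>))"
definition y where "y k \<omega> = (\<gamma> * \<eta>) *\<^sub>R (G (x k \<omega>) + v k \<omega>)"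
definition N where "N k \<omega> = \<eta> *\<^sub>R (saga_estimator n \<gamma> Gs (\<lambda>j. x j \<omega>) (\<lambda>j. B j \<omega>) k
   - (G (x k \<omega>) - \<gamma> *\<^sub>R G (x (k - 1) \<omega>)))"
definition table where "table k \<omega> = saga_table Gs (\<lambda>j. x j \<omega>) (\<lambda>j. B j \<omega>) k"

text \<open>
  The estimator error is governed by the change \<open>jump\<close> of each component along the last move and by the
  \<open>staleness\<close> of its table entry with respect to the previous iterate. The previous
  iterate is the right base point because an entry refreshed at step \<open>k\<close> has no staleness at step
  \<open>k + 1\<close>, while that of every other entry is then \<open>jump k + staleness k\<close>, which does not depend on
  the batch \<open>B k\<close> that decides about the refreshment.
\<close>

definition jump where "jump k \<omega> i = Gs i (x k \<omega>) - Gs i (x (k - 1) \<omega>)"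
definition staleness where "staleness k \<omega> i = Gs i (x (k - 1) \<omega>) - table k \<omega> i"

lemma \<theta>: "0 < \<theta>" "\<theta> < 1" and \<gamma>_\<theta>: "\<gamma> * \<theta> = 1 - \<gamma>"
  using \<gamma> by (simp_all add: \<theta>_def field_simps)

lemma v_in: "\<omega> \<in> space P \<Longrightarrow> v k \<omega> \<in> T (x k \<omega>)"
  using v_Suc_in init by (cases k) auto

lemma y_eq: "y k \<omega> = Y k \<omega> + D k \<omega>"
  by (simp add: y_def Y_def D_def algebra_simps)

lemma Y_Suc_minus_y: "Y (Suc k) \<omega> - y k \<omega> = (\<gamma> * \<eta>) *\<^sub>R (v (Suc k) \<omega> - v k \<omega>)"
  by (simp add: y_def Y_def algebra_simps)

lemma X_Suc:
  assumes "\<omega> \<in> space P"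
  shows "X (Suc k) \<omega> = X k \<omega> - (\<theta> *\<^sub>R y k \<omega> + D k \<omega> + N k \<omega>) - (Y (Suc k) \<omega> - y k \<omega>)"
proof -
  have "\<theta> *\<^sub>R y k \<omega> = ((1 - \<gamma>) * \<eta>) *\<^sub>R (G (x k \<omega>) + v k \<omega>)"
  proof -
    have "\<theta> * (\<gamma> * \<eta>) = (1 - \<gamma>) * \<eta>" by (simp only: \<gamma>_\<theta>[symmetric] ac_simps)
    then show ?thesis by (simp add: y_def)
  qed
  moreover have "(2 * \<gamma> - 1) *\<^sub>R v k \<omega> = \<gamma> *\<^sub>R v k \<omega> + \<gamma> *\<^sub>R v k \<omega> - v k \<omega>"
    by (simp add: scaleR_diff_left scaleR_add_left[symmetric])
  ultimately show ?thesis
    unfolding Y_Suc_minus_y X_def step[OF assms] N_def D_def by (simp add: algebra_simps)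
qed

lemma Y_increment_monotone:
  fixes k
  assumes "\<omega> \<in> space P"
  defines "q \<equiv> Y (Suc k) \<omega> - y k \<omega>"
  shows "(norm q)\<^sup>2 + inner (\<theta> *\<^sub>R y k \<omega> + D k \<omega> + N k \<omega>) q \<le> 0"
proof -
  have "0 \<le> inner (v (Suc k) \<omega> - v k \<omega>) (x (Suc k) \<omega> - x k \<omega>)"
    using mono v_in[OF assms(1)] unfolding monotone_operator_def by blast
  then have "0 \<le> inner q (x (Suc k) \<omega> - x k \<omega>)"
    using \<gamma> \<eta> by (simp add: q_def Y_Suc_minus_y)
  also have "x (Suc k) \<omega> - x k \<omega> = - (\<theta> *\<^sub>R y k \<omega> + D k \<omega> + N k \<omega>) - q"
    using X_Suc[OF assms(1), of k] by (simp add: q_def X_def algebra_simps)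
  finally have *: "0 \<le> inner q (- (\<theta> *\<^sub>R y k \<omega> + D k \<omega> + N k \<omega>) - q)" .
  have "(norm q)\<^sup>2 + inner w q \<le> 0" if "0 \<le> inner q (- w - q)" for w
    using that by (simp add: power2_norm_eq_inner inner_diff_right inner_commute)
  from this[OF *] show ?thesis .
qed

lemma star_y:
  assumes "\<omega> \<in> space P"
  shows "- inner (X k \<omega>) (y k \<omega>) \<le> \<kappa> / (\<gamma> * \<eta>) * (norm (y k \<omega>))\<^sup>2"
proof -
  let ?w = "G (x k \<omega>) + v k \<omega>"
  have "- inner (X k \<omega>) ?w \<le> \<kappa> * (norm ?w)\<^sup>2"
    using star[OF v_in[OF assms], of k] by (simp add: G_def X_def inner_commute)
  then have "(\<gamma> * \<eta>) * - inner (X k \<omega>) ?w \<le> (\<gamma> * \<eta>) * (\<kappa> * (norm ?w)\<^sup>2)"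
    using \<gamma> \<eta> by (intro mult_left_mono) auto
  also have "\<dots> = \<kappa> / (\<gamma> * \<eta>) * (norm (y k \<omega>))\<^sup>2"
    using \<gamma> \<eta> by (simp add: y_def power_mult_distrib power2_eq_square)
  finally show ?thesis by (simp add: y_def)
qed

lemma n_pos: "1 \<le> n" using b_pos b_le_n by simp

lemma D_le:
  shows "(norm (D k \<omega>))\<^sup>2 \<le> (\<gamma>\<^sup>2 * \<eta>\<^sup>2 * L\<^sup>2) * (norm (x k \<omega> - x (k - 1) \<omega>))\<^sup>2"
proof -
  have eq: "G (x k \<omega>) - G (x (k - 1) \<omega>) = average {1..n} (\<lambda>i. Gs i (x k \<omega>) - Gs i (x (k - 1) \<omega>))"
    by (simp add: G_def average_def sum_subtractf scaleR_diff_right)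
  have "(norm (G (x k \<omega>) - G (x (k - 1) \<omega>)))\<^sup>2 \<le> L\<^sup>2 * (norm (x k \<omega> - x (k - 1) \<omega>))\<^sup>2"
    unfolding eq by (rule order_trans[OF norm_average_sq_le[OF n_pos] lipschitz])
  then have "(\<gamma>\<^sup>2 * \<eta>\<^sup>2) * (norm (G (x k \<omega>) - G (x (k - 1) \<omega>)))\<^sup>2
      \<le> (\<gamma>\<^sup>2 * \<eta>\<^sup>2) * (L\<^sup>2 * (norm (x k \<omega> - x (k - 1) \<omega>))\<^sup>2)"
    by (intro mult_left_mono) auto
  then show ?thesis by (simp add: D_def power_mult_distrib mult.assoc)
qed

text \<open>
  Given the past and the batch, \<open>x (k + 1) + \<gamma> \<eta> v (k + 1)\<close> is known; two solutions of the step would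
  differ by \<open>x - x' = - \<gamma> \<eta> (v - v')\<close>, which monotonicity of \<open>T\<close> allows only for \<open>v = v'\<close>.
\<close>

lemma adapted_iterates: "adapted k (x k) \<and> adapted k (v k)"
proof (induction k rule: less_induct)
  case (less k)
  show ?case
  proof (cases k)
    case 0
    then show ?thesis using init by (simp add: adapted_def)
  next
    case (Suc m)
    have eq: "x k \<omega> = x k \<omega>' \<and> v k \<omega> = v k \<omega>'"
      if w: "\<omega> \<in> space P" "\<omega>' \<in> space P" and B: "\<forall>j<k. B j \<omega> = B j \<omega>'" for \<omega> \<omega>'
    proof -
      have xj: "x j \<omega> = x j \<omega>'" "v j \<omega> = v j \<omega>'" if "j \<le> m" for j
      proof -
        have "adapted j (x j)" "adapted j (v j)" using less.IH[of j] that Suc by simp_all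
        moreover have "\<forall>i<j. B i \<omega> = B i \<omega>'" using B that Suc by simp
        ultimately show "x j \<omega> = x j \<omega>'" "v j \<omega> = v j \<omega>'"
          using w unfolding adapted_def by blast+
      qed
      have Bj: "B j \<omega> = B j \<omega>'" if "j \<le> m" for j using B that Suc by simp
      have "saga_table Gs (\<lambda>j. x j \<omega>) (\<lambda>j. B j \<omega>) m i = saga_table Gs (\<lambda>j. x j \<omega>') (\<lambda>j. B j \<omega>') m i" for i
        by (rule saga_table_cong) (use xj Bj in auto)
      then have tab: "saga_table Gs (\<lambda>j. x j \<omega>) (\<lambda>j. B j \<omega>) m = saga_table Gs (\<lambda>j. x j \<omega>') (\<lambda>j. B j \<omega>') m"
        by blast
      have est: "saga_estimator n \<gamma> Gs (\<lambda>j. x j \<omega>) (\<lambda>j. B j \<omega>) m = saga_estimator n \<gamma> Gs (\<lambda>j. x j \<omega>') (\<lambda>j. B j \<omega>') m"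
        unfolding saga_estimator_def tab using xj[of m] xj[of "m - 1"] Bj[of m] by simp
      have diff: "x k \<omega> - x k \<omega>' = - ((\<gamma> * \<eta>) *\<^sub>R (v k \<omega> - v k \<omega>'))"
        unfolding Suc step[OF w(1)] step[OF w(2)] est xj[OF order_refl] by (simp add: algebra_simps)
      have "0 \<le> inner (v k \<omega> - v k \<omega>') (x k \<omega> - x k \<omega>')"
        using mono v_in w unfolding monotone_operator_def by blast
      then have "(\<gamma> * \<eta>) * (norm (v k \<omega> - v k \<omega>'))\<^sup>2 \<le> 0"
        unfolding diff by (simp add: power2_norm_eq_inner)
      then have "v k \<omega> = v k \<omega>'" using \<gamma> \<eta> by (simp add: mult_le_0_iff)
      with diff show ?thesis by simp
    qed
    then show ?thesis unfolding adapted_def by blast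
  qed
qed

lemma adapted_x: "j \<le> k \<Longrightarrow> adapted k (x j)" and adapted_v: "j \<le> k \<Longrightarrow> adapted k (v j)"
  using adapted_iterates adapted_mono by blast+

lemma adapted_Gs_x: "j \<le> k \<Longrightarrow> adapted k (\<lambda>\<omega>. Gs i (x j \<omega>))" and adapted_G_x: "j \<le> k \<Longrightarrow> adapted k (\<lambda>\<omega>. G (x j \<omega>))"
  by (rule adapted_comp[OF adapted_x], simp)+

lemma adapted_XY: "adapted k (X k)" "adapted k (Y k)" "adapted k (D k)" "adapted k (y k)"
  unfolding X_def Y_def D_def y_def by (intro adapted_intros adapted_x adapted_v adapted_G_x; simp)+

lemma adapted_table: "adapted k (\<lambda>\<omega>. table k \<omega> i)"
  unfolding table_def adapted_def
proof (intro ballI impI saga_table_cong)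
  fix \<omega> \<omega>' j assume w: "\<omega> \<in> space P" "\<omega>' \<in> space P" and B: "\<forall>j<k. B j \<omega> = B j \<omega>'" and "j \<le> k"
  then show "x j \<omega> = x j \<omega>'" using adapted_x[of j k] unfolding adapted_def by blast
qed blast

lemma adapted_jump: "adapted k (\<lambda>\<omega>. jump k \<omega> i)" and adapted_staleness: "adapted k (\<lambda>\<omega>. staleness k \<omega> i)"
  unfolding jump_def staleness_def by (intro adapted_intros adapted_Gs_x adapted_table; simp)+

definition saga_summand where "saga_summand k \<omega> i = jump k \<omega> i + (1 - \<gamma>) *\<^sub>R staleness k \<omega> i"

lemma adapted_saga_summand: "adapted k (saga_summand k)"
  unfolding saga_summand_def by (intro adapted_fun adapted_intros adapted_jump adapted_staleness)

text \<open>
  The noise is the deviation of a batch average from the full average of vectors that do not depend on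
  the batch.
\<close>

lemma N_eq:
  assumes "\<omega> \<in> space P"
  shows "N k \<omega> = \<eta> *\<^sub>R (average (B k \<omega>) (saga_summand k \<omega>)
     - average {1..n} (saga_summand k \<omega>))"
proof -
  have lin: "average S (saga_summand k \<omega>)
     = average S (\<lambda>i. Gs i (x k \<omega>)) - \<gamma> *\<^sub>R average S (\<lambda>i. Gs i (x (k - 1) \<omega>)) - (1 - \<gamma>) *\<^sub>R average S (table k \<omega>)" for S
  proof -
    have "saga_summand k \<omega> i
        = Gs i (x k \<omega>) - \<gamma> *\<^sub>R Gs i (x (k - 1) \<omega>) - (1 - \<gamma>) *\<^sub>R table k \<omega> i" for i
      by (simp add: saga_summand_def jump_def staleness_def algebra_simps)
    then have "saga_summand k \<omega> = (\<lambda>i. Gs i (x k \<omega>) - \<gamma> *\<^sub>R Gs i (x (k - 1) \<omega>) - (1 - \<gamma>) *\<^sub>R table k \<omega> i)"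
      by (rule ext)
    then show ?thesis by (simp only: average_diff average_scaleR)
  qed
  have tab: "((1 - \<gamma>) / real n) *\<^sub>R (\<Sum>i=1..n. table k \<omega> i) = (1 - \<gamma>) *\<^sub>R average {1..n} (table k \<omega>)"
    by (simp add: average_def)
  show ?thesis
    unfolding N_def lin saga_estimator_def table_def[symmetric] tab G_def by (simp add: algebra_simps)
qed

lemma adapted_N: "adapted (Suc k) (N k)"
proof -
  have f: "adapted (Suc k) (saga_summand k)" by (rule adapted_mono[OF adapted_saga_summand]) simp
  have "adapted (Suc k) (\<lambda>\<omega>. \<eta> *\<^sub>R (average (B k \<omega>) (saga_summand k \<omega>) - average {1..n} (saga_summand k \<omega>)))"
    by (intro adapted_intros adapted_comp2[where h = average, OF adapted_batch f]
          adapted_comp[where h = "average {1..n}", OF f]) simp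
  then show ?thesis using N_eq unfolding adapted_def by simp
qed

lemma expectation_inner_N:
  assumes "adapted k a"
  shows "expectation (\<lambda>\<omega>. inner (a \<omega>) (N k \<omega>)) = 0"
proof -
  let ?g = "\<lambda>\<omega> S. inner (a \<omega>) (\<eta> *\<^sub>R (average S (saga_summand k \<omega>) - average {1..n} (saga_summand k \<omega>)))"
  note f = adapted_saga_summand[of k]
  have "adapted k ?g"
    by (rule adapted_fun) (intro adapted_intros assms adapted_comp[where h = "average _", OF f])
  have "expectation (\<lambda>\<omega>. inner (a \<omega>) (N k \<omega>)) = expectation (\<lambda>\<omega>. ?g \<omega> (B k \<omega>))"
    by (intro Bochner_Integration.integral_cong refl) (simp add: N_eq)
  also have "\<dots> = (LINT \<omega>|P. (1 / real (card (batches n b))) * (\<Sum>S\<in>batches n b. ?g \<omega> S))"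
    by (rule expectation_next_batch) fact
  also have "\<dots> = 0"
    by (simp only: inner_sum_right[symmetric] scaleR_sum_right[symmetric] average_batches_unbiased[OF b_pos]) simp
  finally show ?thesis .
qed

lemma expectation_N_sq_le:
  "expectation (\<lambda>\<omega>. (norm (N k \<omega>))\<^sup>2)
    \<le> \<eta>\<^sup>2 / real b * expectation (\<lambda>\<omega>. 1 / real n * (\<Sum>i=1..n. (norm (saga_summand k \<omega> i))\<^sup>2))"
proof -
  let ?g = "\<lambda>\<omega> S. (norm (\<eta> *\<^sub>R (average S (saga_summand k \<omega>) - average {1..n} (saga_summand k \<omega>))))\<^sup>2"
  note f = adapted_saga_summand[of k]
  have g: "adapted k ?g"
    by (rule adapted_fun) (intro adapted_intros adapted_comp[where h = "average _", OF f])
  have "expectation (\<lambda>\<omega>. (norm (N k \<omega>))\<^sup>2) = expectation (\<lambda>\<omega>. ?g \<omega> (B k \<omega>))"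
    by (intro Bochner_Integration.integral_cong refl) (simp add: N_eq)
  also have "\<dots> = (LINT \<omega>|P. (1 / real (card (batches n b))) * (\<Sum>S\<in>batches n b. ?g \<omega> S))"
    by (rule expectation_next_batch[OF g])
  also have "\<dots> \<le> expectation (\<lambda>\<omega>. \<eta>\<^sup>2 / real b * (1 / real n * (\<Sum>i=1..n. (norm (saga_summand k \<omega> i))\<^sup>2)))"
  proof (rule integral_mono)
    show "integrable P (\<lambda>\<omega>. 1 / real (card (batches n b)) * (\<Sum>S\<in>batches n b. ?g \<omega> S))"
      by (rule adapted_integrable[of k], rule adapted_comp[where h = "\<lambda>G. 1 / real (card (batches n b)) * (\<Sum>S\<in>batches n b. G S)", OF g])
    show "integrable P (\<lambda>\<omega>. \<eta>\<^sup>2 / real b * (1 / real n * (\<Sum>i=1..n. (norm (saga_summand k \<omega> i))\<^sup>2)))"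
      by (rule adapted_integrable[of k], rule adapted_comp[where h = "\<lambda>f. \<eta>\<^sup>2 / real b * (1 / real n * (\<Sum>i=1..n. (norm (f i))\<^sup>2))", OF f])
    show "1 / real (card (batches n b)) * (\<Sum>S\<in>batches n b. ?g \<omega> S) \<le> \<eta>\<^sup>2 / real b * (1 / real n * (\<Sum>i=1..n. (norm (saga_summand k \<omega> i))\<^sup>2))" for \<omega>
    proof -
      have "1 / real (card (batches n b)) * (\<Sum>S\<in>batches n b. ?g \<omega> S)
          = \<eta>\<^sup>2 * (1 / real (card (batches n b)) * (\<Sum>S\<in>batches n b. (norm (average S (saga_summand k \<omega>) - average {1..n} (saga_summand k \<omega>)))\<^sup>2))"
        by (simp add: power_mult_distrib sum_distrib_left[symmetric])
      also have "\<dots> \<le> \<eta>\<^sup>2 * (1 / (real b * real n) * (\<Sum>i=1..n. (norm (saga_summand k \<omega> i))\<^sup>2))"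
        by (intro mult_left_mono average_batches_variance_le b_pos b_le_n) simp
      finally show ?thesis by simp
    qed
  qed
  finally show ?thesis by simp
qed

definition mean_sq_move where "mean_sq_move k = expectation (\<lambda>\<omega>. (norm (x k \<omega> - x (k - 1) \<omega>))\<^sup>2)"
definition mean_sq_noise where "mean_sq_noise k = expectation (\<lambda>\<omega>. (norm (N k \<omega>))\<^sup>2)"
definition mean_sq_staleness where "mean_sq_staleness k = expectation (\<lambda>\<omega>. 1 / real n * (\<Sum>i=1..n. (norm (staleness k \<omega> i))\<^sup>2))"
definition mean_sq_jump where "mean_sq_jump k = expectation (\<lambda>\<omega>. 1 / real n * (\<Sum>i=1..n. (norm (jump k \<omega> i))\<^sup>2))"

lemma moments_nonneg: "0 \<le> mean_sq_move k" "0 \<le> mean_sq_noise k" "0 \<le> mean_sq_staleness k" "0 \<le> mean_sq_jump k"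
  unfolding mean_sq_move_def mean_sq_noise_def mean_sq_staleness_def mean_sq_jump_def by (intro Bochner_Integration.integral_nonneg mult_nonneg_nonneg sum_nonneg; simp)+

text \<open>
  A refreshed entry equals the component at \<open>x k\<close>, the base point of \<open>staleness (k + 1)\<close>.
\<close>

lemma staleness_Suc:
  "staleness (Suc k) \<omega> i = (if i \<in> B k \<omega> then 0 else jump k \<omega> i + staleness k \<omega> i)"
  by (simp add: staleness_def jump_def table_def)

lemma integrable_sum_sq:
  "integrable P (\<lambda>\<omega>. c * (\<Sum>i=1..n. (norm (jump k \<omega> i))\<^sup>2))"
  "integrable P (\<lambda>\<omega>. c * (\<Sum>i=1..n. (norm (staleness k \<omega> i))\<^sup>2))"
  "integrable P (\<lambda>\<omega>. c * (\<Sum>i=1..n. (norm (jump k \<omega> i + d *\<^sub>R staleness k \<omega> i))\<^sup>2))"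
proof -
  have j: "adapted k (jump k)" and h: "adapted k (staleness k)"
    by (auto intro!: adapted_fun adapted_jump adapted_staleness)
  show "integrable P (\<lambda>\<omega>. c * (\<Sum>i=1..n. (norm (jump k \<omega> i))\<^sup>2))"
    by (rule adapted_integrable[of k], rule adapted_comp[OF j])
  show "integrable P (\<lambda>\<omega>. c * (\<Sum>i=1..n. (norm (staleness k \<omega> i))\<^sup>2))"
    by (rule adapted_integrable[of k], rule adapted_comp[OF h])
  show "integrable P (\<lambda>\<omega>. c * (\<Sum>i=1..n. (norm (jump k \<omega> i + d *\<^sub>R staleness k \<omega> i))\<^sup>2))"
    by (rule adapted_integrable[of k], rule adapted_comp2[OF j h])
qed

lemma mean_sq_jump_plus_staleness_le:
  assumes "0 < \<alpha>"
  shows "expectation (\<lambda>\<omega>. 1 / real n * (\<Sum>i=1..n. (norm (jump k \<omega> i + d *\<^sub>R staleness k \<omega> i))\<^sup>2))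
    \<le> (1 + 1 / \<alpha>) * mean_sq_jump k + (1 + \<alpha>) * (d\<^sup>2 * mean_sq_staleness k)"
proof -
  have "expectation (\<lambda>\<omega>. 1 / real n * (\<Sum>i=1..n. (norm (jump k \<omega> i + d *\<^sub>R staleness k \<omega> i))\<^sup>2))
    \<le> expectation (\<lambda>\<omega>. (1 + 1 / \<alpha>) * (1 / real n * (\<Sum>i=1..n. (norm (jump k \<omega> i))\<^sup>2)) +
        (1 + \<alpha>) * (d\<^sup>2 * (1 / real n * (\<Sum>i=1..n. (norm (staleness k \<omega> i))\<^sup>2))))"
  proof (rule integral_mono)
    show "1 / real n * (\<Sum>i=1..n. (norm (jump k \<omega> i + d *\<^sub>R staleness k \<omega> i))\<^sup>2)
      \<le> (1 + 1 / \<alpha>) * (1 / real n * (\<Sum>i=1..n. (norm (jump k \<omega> i))\<^sup>2)) +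
        (1 + \<alpha>) * (d\<^sup>2 * (1 / real n * (\<Sum>i=1..n. (norm (staleness k \<omega> i))\<^sup>2)))" for \<omega>
    proof -
      have "(\<Sum>i=1..n. (norm (jump k \<omega> i + d *\<^sub>R staleness k \<omega> i))\<^sup>2)
          \<le> (\<Sum>i=1..n. (1 + 1 / \<alpha>) * (norm (jump k \<omega> i))\<^sup>2 + (1 + \<alpha>) * (d\<^sup>2 * (norm (staleness k \<omega> i))\<^sup>2))"
        using norm_add_sq_le[of "1 / \<alpha>" "jump k \<omega> _" "d *\<^sub>R staleness k \<omega> _"] assms
        by (intro sum_mono) (simp add: power_mult_distrib)
      also have "\<dots> = (1 + 1 / \<alpha>) * (\<Sum>i=1..n. (norm (jump k \<omega> i))\<^sup>2) + (1 + \<alpha>) * (d\<^sup>2 * (\<Sum>i=1..n. (norm (staleness k \<omega> i))\<^sup>2))"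
        by (simp only: sum.distrib sum_distrib_left)
      finally have "1 / real n * (\<Sum>i=1..n. (norm (jump k \<omega> i + d *\<^sub>R staleness k \<omega> i))\<^sup>2) \<le> 1 / real n * \<dots>"
        by (rule mult_left_mono) simp
      then show ?thesis by (simp add: algebra_simps add_divide_distrib)
    qed
  qed (intro Bochner_Integration.integrable_add integrable_mult_right integrable_sum_sq)+
  also have "\<dots> = (1 + 1 / \<alpha>) * mean_sq_jump k + (1 + \<alpha>) * (d\<^sup>2 * mean_sq_staleness k)"
    unfolding mean_sq_jump_def mean_sq_staleness_def
    by (subst Bochner_Integration.integral_add; (intro integrable_mult_right integrable_sum_sq)?)
       (simp only: integral_mult_right_zero)
  finally show ?thesis .
qed

lemma mean_sq_jump_le: "mean_sq_jump k \<le> L\<^sup>2 * mean_sq_move k"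
proof -
  have "mean_sq_jump k \<le> expectation (\<lambda>\<omega>. L\<^sup>2 * (norm (x k \<omega> - x (k - 1) \<omega>))\<^sup>2)"
    unfolding mean_sq_jump_def
  proof (rule integral_mono)
    show "integrable P (\<lambda>\<omega>. L\<^sup>2 * (norm (x k \<omega> - x (k - 1) \<omega>))\<^sup>2)"
      by (rule adapted_integrable[of k]) (intro adapted_intros adapted_x; simp)
    show "1 / real n * (\<Sum>i=1..n. (norm (jump k \<omega> i))\<^sup>2) \<le> L\<^sup>2 * (norm (x k \<omega> - x (k - 1) \<omega>))\<^sup>2" for \<omega>
      unfolding jump_def by (rule lipschitz)
  qed (rule integrable_sum_sq)
  then show ?thesis by (simp add: mean_sq_move_def)
qed

lemma mean_sq_staleness_Suc:
  "mean_sq_staleness (Suc k) = (1 - real b / real n) * expectation (\<lambda>\<omega>. 1 / real n * (\<Sum>i=1..n. (norm (jump k \<omega> i + 1 *\<^sub>R staleness k \<omega> i))\<^sup>2))"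
proof -
  let ?f = "\<lambda>\<omega> i. (norm (jump k \<omega> i + staleness k \<omega> i))\<^sup>2"
  let ?g = "\<lambda>\<omega> S. 1 / real n * (\<Sum>i=1..n. if i \<in> S then 0 else ?f \<omega> i)"
  let ?N = "real (card (batches n b))"
  have f: "adapted k ?f"
    by (intro adapted_fun adapted_intros adapted_jump adapted_staleness)
  have g: "adapted k ?g"
    by (rule adapted_comp[where h = "\<lambda>F S. 1 / real n * (\<Sum>i=1..n. if i \<in> S then 0 else F i)", OF f])
  have "mean_sq_staleness (Suc k) = expectation (\<lambda>\<omega>. ?g \<omega> (B k \<omega>))"
    unfolding mean_sq_staleness_def staleness_Suc
    by (intro Bochner_Integration.integral_cong refl arg_cong2[of _ _ _ _ "(*)"] sum.cong) simp
  also have "\<dots> = expectation (\<lambda>\<omega>. (1 / ?N) * (\<Sum>S\<in>batches n b. ?g \<omega> S))"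
    by (rule expectation_next_batch[OF g])
  also have "\<dots> = expectation (\<lambda>\<omega>. (1 - real b / real n) * (1 / real n * (\<Sum>i=1..n. ?f \<omega> i)))"
  proof (intro Bochner_Integration.integral_cong refl)
    fix \<omega>
    have "(\<Sum>S\<in>batches n b. \<Sum>i=1..n. if i \<in> S then 0 else ?f \<omega> i)
        = (\<Sum>S\<in>batches n b. (\<Sum>i=1..n. ?f \<omega> i) - (\<Sum>i\<in>S. ?f \<omega> i))"
    proof (rule sum.cong[OF refl])
      fix S assume "S \<in> batches n b"
      then have S: "S \<subseteq> {1..n}" by (simp add: batches_def)
      have "(\<Sum>i=1..n. if i \<in> S then 0 else ?f \<omega> i) = (\<Sum>i\<in>{1..n} - S. ?f \<omega> i)"
        by (rule sum.mono_neutral_cong_right) auto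
      then show "(\<Sum>i=1..n. if i \<in> S then 0 else ?f \<omega> i) = (\<Sum>i=1..n. ?f \<omega> i) - (\<Sum>i\<in>S. ?f \<omega> i)"
        using S by (simp add: sum_diff)
    qed
    also have "\<dots> = (1 - real b / real n) * ?N * (\<Sum>i=1..n. ?f \<omega> i)"
      using sum_batches_members[OF b_pos, where f = "?f \<omega>" and n = n] by (simp add: sum_subtractf algebra_simps)
    finally show "(1 / ?N) * (\<Sum>S\<in>batches n b. ?g \<omega> S) = (1 - real b / real n) * (1 / real n * (\<Sum>i=1..n. ?f \<omega> i))"
      using card_batches_pos by (simp add: sum_distrib_left[symmetric] sum_divide_distrib[symmetric])
  qed
  finally show ?thesis by simp
qed

definition Q where "Q = variance_factor ((1 - \<gamma>)\<^sup>2) (real n) (real b)"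

text \<open>
  With \<open>r = b / (2 n)\<close>, an entry survives with probability \<open>1 - 2 r\<close>, and Young's inequality with
  parameter \<open>r\<close> turns \<open>staleness_Suc\<close> into a contraction with factor \<open>1 - r\<close> and source
  \<open>mean_sq_jump\<close>.
\<close>

lemma sum_mean_sq_noise_le:
  assumes \<sigma>: "\<And>k. 0 \<le> \<sigma> k" "\<And>k. \<sigma> (Suc k) \<le> \<sigma> k"
  shows "(\<Sum>k\<le>K. \<sigma> k * mean_sq_noise k) \<le> \<eta>\<^sup>2 * L\<^sup>2 * Q * (\<Sum>k\<le>K. \<sigma> k * mean_sq_move k)"
proof -
  define r where "r = real b / (2 * real n)"
  have nb: "0 < real b" "real b \<le> real n" "0 < real n" using b_pos b_le_n by auto
  have r: "0 < r" "r \<le> 1" using nb by (auto simp: r_def field_simps)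
  define c where "c = (1 - 2 * r) * (1 + 1 / r)"
  have r2: "1 - 2 * r = 1 - real b / real n" "0 \<le> 1 - 2 * r" using nb by (auto simp: r_def field_simps)
  have c: "0 \<le> c" using r2 r by (simp add: c_def)
  have rec: "mean_sq_staleness (Suc k) \<le> (1 - r) * mean_sq_staleness k + c * mean_sq_jump k" for k
  proof -
    have "mean_sq_staleness (Suc k) \<le> (1 - 2 * r) * ((1 + 1 / r) * mean_sq_jump k + (1 + r) * (1\<^sup>2 * mean_sq_staleness k))"
      unfolding mean_sq_staleness_Suc r2(1)[symmetric] by (intro mult_left_mono mean_sq_jump_plus_staleness_le r r2)
    also have "\<dots> = ((1 - 2 * r) * (1 + r)) * mean_sq_staleness k + c * mean_sq_jump k"
    proof -
      have "p * (u * a + w * (1\<^sup>2 * h)) = (p * w) * h + (p * u) * a" for p u a w h :: real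
        by (simp add: algebra_simps)
      then show ?thesis unfolding c_def .
    qed
    also have "\<dots> \<le> (1 - r) * mean_sq_staleness k + c * mean_sq_jump k"
      by (intro add_right_mono mult_right_mono moments_nonneg) (use r in \<open>simp add: algebra_simps\<close>)
    finally show ?thesis .
  qed
  have staleness_0: "mean_sq_staleness 0 = 0" by (simp add: mean_sq_staleness_def staleness_def table_def)
  have H: "(\<Sum>k\<le>K. \<sigma> k * mean_sq_staleness k) \<le> c / r * (\<Sum>k\<le>K. \<sigma> k * mean_sq_jump k)"
    by (rule sum_contraction_le[OF rec staleness_0 r c]) (use moments_nonneg \<sigma> in auto)
  have mean_sq_noise: "mean_sq_noise k \<le> \<eta>\<^sup>2 / real b * (2 * mean_sq_jump k + 2 * ((1 - \<gamma>)\<^sup>2 * mean_sq_staleness k))" for k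
  proof -
    have "mean_sq_noise k \<le> \<eta>\<^sup>2 / real b * expectation (\<lambda>\<omega>. 1 / real n * (\<Sum>i=1..n. (norm (jump k \<omega> i + (1 - \<gamma>) *\<^sub>R staleness k \<omega> i))\<^sup>2))"
      unfolding mean_sq_noise_def by (rule expectation_N_sq_le[of k, unfolded saga_summand_def])
    also have "\<dots> \<le> \<eta>\<^sup>2 / real b * ((1 + 1 / 1) * mean_sq_jump k + (1 + 1) * ((1 - \<gamma>)\<^sup>2 * mean_sq_staleness k))"
      by (intro mult_left_mono mean_sq_jump_plus_staleness_le) auto
    finally show ?thesis by simp
  qed
  have Qc: "1 / real b * (2 + 2 * (1 - \<gamma>)\<^sup>2 * (c / r)) = Q"
    using nb by (simp add: Q_def variance_factor_def c_def r_def field_simps power2_eq_square power3_eq_cube)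
  have "(\<Sum>k\<le>K. \<sigma> k * mean_sq_noise k) \<le> (\<Sum>k\<le>K. \<sigma> k * (\<eta>\<^sup>2 / real b * (2 * mean_sq_jump k + 2 * ((1 - \<gamma>)\<^sup>2 * mean_sq_staleness k))))"
    by (intro sum_mono mult_left_mono mean_sq_noise \<sigma>)
  also have "\<dots> = \<eta>\<^sup>2 / real b * (2 * (\<Sum>k\<le>K. \<sigma> k * mean_sq_jump k) + 2 * (1 - \<gamma>)\<^sup>2 * (\<Sum>k\<le>K. \<sigma> k * mean_sq_staleness k))"
    by (simp add: sum_distrib_left sum.distrib algebra_simps)
  also have "\<dots> \<le> \<eta>\<^sup>2 / real b * (2 * (\<Sum>k\<le>K. \<sigma> k * mean_sq_jump k) + 2 * (1 - \<gamma>)\<^sup>2 * (c / r * (\<Sum>k\<le>K. \<sigma> k * mean_sq_jump k)))"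
    by (intro mult_left_mono add_left_mono H) (use nb in auto)
  also have "\<dots> = \<eta>\<^sup>2 * (1 / real b * (2 + 2 * (1 - \<gamma>)\<^sup>2 * (c / r))) * (\<Sum>k\<le>K. \<sigma> k * mean_sq_jump k)"
    by (simp add: algebra_simps)
  also have "\<dots> = \<eta>\<^sup>2 * Q * (\<Sum>k\<le>K. \<sigma> k * mean_sq_jump k)" unfolding Qc ..
  also have "\<dots> \<le> \<eta>\<^sup>2 * Q * (\<Sum>k\<le>K. \<sigma> k * (L\<^sup>2 * mean_sq_move k))"
    by (intro mult_left_mono sum_mono mean_sq_jump_le \<sigma>) (use nb in \<open>auto simp: Q_def variance_factor_def\<close>)
  finally show ?thesis by (simp add: sum_distrib_left algebra_simps)
qed

end

section \<open>Summed residuals\<close>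

lemma sum_telescope_le:
  fixes p a c :: "nat \<Rightarrow> real"
  assumes "\<And>k. p (Suc k) \<le> p k - a k + c k"
  shows "p (Suc K) + (\<Sum>k\<le>K. a k) \<le> p 0 + (\<Sum>k\<le>K. c k)"
proof (induction K)
  case 0
  show ?case using assms[of 0] by simp
next
  case (Suc K)
  show ?case using Suc assms[of "Suc K"] by simp
qed

context saga_process begin

definition mean_sq_residual where "mean_sq_residual k = expectation (\<lambda>\<omega>. (norm (y k \<omega>))\<^sup>2)"
definition mean_sq_drift where "mean_sq_drift k = expectation (\<lambda>\<omega>. (norm (D k \<omega>))\<^sup>2)"

lemma mean_sq_residual_nonneg: "0 \<le> mean_sq_residual k" and mean_sq_drift_nonneg: "0 \<le> mean_sq_drift k"
  by (simp_all add: mean_sq_residual_def mean_sq_drift_def)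

lemma mean_sq_move_0: "mean_sq_move 0 = 0"
  by (simp add: mean_sq_move_def)

lemma mean_sq_drift_le: "mean_sq_drift k \<le> (\<gamma>\<^sup>2 * \<eta>\<^sup>2 * L\<^sup>2) * mean_sq_move k"
proof -
  have "mean_sq_drift k \<le> expectation (\<lambda>\<omega>. (\<gamma>\<^sup>2 * \<eta>\<^sup>2 * L\<^sup>2) * (norm (x k \<omega> - x (k - 1) \<omega>))\<^sup>2)"
    unfolding mean_sq_drift_def
  proof (rule integral_mono)
    show "integrable P (\<lambda>\<omega>. (norm (D k \<omega>))\<^sup>2)"
      by (rule adapted_integrable[of k]) (intro adapted_intros adapted_XY)
    show "integrable P (\<lambda>\<omega>. (\<gamma>\<^sup>2 * \<eta>\<^sup>2 * L\<^sup>2) * (norm (x k \<omega> - x (k - 1) \<omega>))\<^sup>2)"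
      by (rule adapted_integrable[of k]) (intro adapted_intros adapted_x; simp)
  qed (rule D_le)
  then show ?thesis by (simp add: mean_sq_move_def)
qed

text \<open>
  Takes expectations in a one-step inequality: the term linear in the noise has mean zero.
\<close>

lemma expectation_step_le:
  assumes f': "adapted (Suc k) f'" and f: "adapted k f" and e: "adapted k e"
    and le: "\<And>\<omega>. \<omega> \<in> space P \<Longrightarrow> f' \<omega> \<le> f \<omega> - ca * (norm (y k \<omega>))\<^sup>2 + cd * (norm (D k \<omega>))\<^sup>2
       + cn * (norm (N k \<omega>))\<^sup>2 + inner (e \<omega>) (N k \<omega>)"
  shows "expectation f' \<le> expectation f - ca * mean_sq_residual k + cd * mean_sq_drift k + cn * mean_sq_noise k"
proof -
  have int: "integrable P f'" "integrable P f"
    "integrable P (\<lambda>\<omega>. ca * (norm (y k \<omega>))\<^sup>2)" "integrable P (\<lambda>\<omega>. cd * (norm (D k \<omega>))\<^sup>2)"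
    "integrable P (\<lambda>\<omega>. cn * (norm (N k \<omega>))\<^sup>2)" "integrable P (\<lambda>\<omega>. inner (e \<omega>) (N k \<omega>))"
    by (rule adapted_integrable[of "Suc k"] adapted_integrable[of k],
        (intro adapted_intros adapted_XY adapted_N f' f e adapted_mono[OF e]; simp))+
  have "expectation f' \<le> expectation (\<lambda>\<omega>. f \<omega> - ca * (norm (y k \<omega>))\<^sup>2 + cd * (norm (D k \<omega>))\<^sup>2
       + cn * (norm (N k \<omega>))\<^sup>2 + inner (e \<omega>) (N k \<omega>))"
    by (intro integral_mono le Bochner_Integration.integrable_add Bochner_Integration.integrable_diff int)
  also have "\<dots> = expectation f - ca * mean_sq_residual k + cd * mean_sq_drift k + cn * mean_sq_noise k"
    using int expectation_inner_N[OF e] by (simp add: mean_sq_residual_def mean_sq_drift_def mean_sq_noise_def)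
  finally show ?thesis .
qed

definition \<kappa>' where "\<kappa>' = \<kappa> / (\<gamma> * \<eta>)"
definition R_sq where "R_sq = (norm (x0 - x_star))\<^sup>2 + \<gamma>\<^sup>2 * \<eta>\<^sup>2 * (norm (G x0 + v0))\<^sup>2"
definition rate where "rate = (1 - \<theta>) / (2 - \<theta>)"

lemma \<kappa>'_nonneg: "0 \<le> \<kappa>'"
  using \<kappa>_nonneg \<gamma> \<eta> by (simp add: \<kappa>'_def)

lemma R_sq_eq: "\<omega> \<in> space P \<Longrightarrow> R_sq = (norm (X 0 \<omega>))\<^sup>2 + (norm (Y 0 \<omega>))\<^sup>2"
  by (simp add: R_sq_def X_def Y_def init power_mult_distrib)

lemma XY_Suc:
  assumes "\<omega> \<in> space P"
  shows "X (Suc k) \<omega> + Y (Suc k) \<omega> = X k \<omega> + Y k \<omega> - \<theta> *\<^sub>R y k \<omega> - N k \<omega>"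
  unfolding X_Suc[OF assms] y_eq by (simp add: algebra_simps)

lemma expectation_le_const:
  assumes "\<And>\<omega>. \<omega> \<in> space P \<Longrightarrow> f \<omega> \<le> c"  "integrable P f"
  shows "expectation f \<le> (c::real)"
proof -
  have "expectation f \<le> expectation (\<lambda>_. c)" using assms by (intro integral_mono) auto
  then show ?thesis by (simp add: prob_space)
qed

text \<open>
  Telescoping \<open>reflected_step\<close>. The term \<open>- \<mu> \<parallel>Y\<parallel>\<^sup>2\<close> and the part \<open>\<mu> \<parallel>\<Delta>x + Y\<parallel>\<^sup>2\<close> of the previous Lyapunov
  value leave at least \<open>\<mu>/2\<close> times the squared move, which pays for drift and noise.
\<close>

lemma sum_mean_sq_residual_le:
  assumes step_size: "\<eta>\<^sup>2 * L\<^sup>2 * (4 * \<gamma>\<^sup>2 + 4 / \<theta> * Q) \<le> 1" and rate: "\<kappa>' < rate"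
  shows "(\<Sum>k\<le>K. mean_sq_residual k) \<le> R_sq / (\<theta> * (rate - \<kappa>'))"
proof -
  define \<mu> where "\<mu> = \<theta> / (2 - \<theta>)"
  have \<mu>: "0 < \<mu>" and \<mu>1: "1 + \<mu> = 2 * \<mu> / \<theta>" using \<theta> by (simp_all add: \<mu>_def field_simps)
  \<comment> \<open>At \<open>k = 0\<close> there is no move, so the second term of the Lyapunov function can be dropped there;
    keeping it could make the initial value exceed \<open>2 R_sq\<close>.\<close>
  define V where "V k \<omega> = (norm (X k \<omega> + Y k \<omega>))\<^sup>2 + (if k = 0 then 0 else \<mu> * (norm (x k \<omega> - x (k - 1) \<omega> + Y k \<omega>))\<^sup>2)" for k \<omega>
  define W where "W k \<omega> = (norm (X k \<omega> + Y k \<omega>))\<^sup>2 - \<mu> * (norm (Y k \<omega>))\<^sup>2" for k \<omega>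
  have aV: "adapted k (V k)" for k
    unfolding V_def by (cases "k = 0"; simp; intro adapted_intros adapted_XY adapted_x; simp)
  have aW: "adapted k (W k)" for k
    unfolding W_def by (intro adapted_intros adapted_XY)
  have step: "expectation (V (Suc k)) \<le> expectation (W k) - 2 * \<theta> * (rate - \<kappa>') * mean_sq_residual k + 2 * \<mu> * mean_sq_drift k + (1 + \<mu>) * mean_sq_noise k" for k
  proof (rule expectation_step_le[where e = "\<lambda>\<omega>. - 2 *\<^sub>R ((X k \<omega> + Y k \<omega> - \<theta> *\<^sub>R y k \<omega>) + \<mu> *\<^sub>R (Y k \<omega> - \<theta> *\<^sub>R y k \<omega>))"])
    fix \<omega> assume w: "\<omega> \<in> space P"
    have "x (Suc k) \<omega> - x k \<omega> + Y (Suc k) \<omega> = (X (Suc k) \<omega> + Y (Suc k) \<omega>) - X k \<omega>"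
      by (simp add: X_def)
    then have d: "x (Suc k) \<omega> - x k \<omega> + Y (Suc k) \<omega> = Y k \<omega> - \<theta> *\<^sub>R y k \<omega> - N k \<omega>"
      unfolding XY_Suc[OF w] by simp
    show "V (Suc k) \<omega> \<le> W k \<omega> - 2 * \<theta> * (rate - \<kappa>') * (norm (y k \<omega>))\<^sup>2 + 2 * \<mu> * (norm (D k \<omega>))\<^sup>2
        + (1 + \<mu>) * (norm (N k \<omega>))\<^sup>2
        + inner (- 2 *\<^sub>R ((X k \<omega> + Y k \<omega> - \<theta> *\<^sub>R y k \<omega>) + \<mu> *\<^sub>R (Y k \<omega> - \<theta> *\<^sub>R y k \<omega>))) (N k \<omega>)"
      using reflected_step[OF \<theta> y_eq star_y[OF w, folded \<kappa>'_def] \<mu>_def, of k "N k \<omega>"]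
      unfolding V_def W_def XY_Suc[OF w] rate_def by (simp add: d)
  qed (rule aV aW | intro adapted_intros adapted_XY)+
  have W_le: "expectation (W k) \<le> expectation (V k) - \<mu> / 2 * mean_sq_move k" for k
  proof (cases "k = 0")
    case True
    have "expectation (W k) \<le> expectation (V k)"
      by (rule integral_mono) (use aV aW True \<mu> in \<open>auto intro: adapted_integrable simp: V_def W_def\<close>)
    then show ?thesis using True by (simp add: mean_sq_move_0)
  next
    case False
    have aU: "adapted k (\<lambda>\<omega>. \<mu> / 2 * (norm (x k \<omega> - x (k - 1) \<omega>))\<^sup>2)"
      by (intro adapted_intros adapted_x; simp)
    have "expectation (W k) \<le> expectation (\<lambda>\<omega>. V k \<omega> - \<mu> / 2 * (norm (x k \<omega> - x (k - 1) \<omega>))\<^sup>2)"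
    proof (rule integral_mono)
      show "W k \<omega> \<le> V k \<omega> - \<mu> / 2 * (norm (x k \<omega> - x (k - 1) \<omega>))\<^sup>2" for \<omega>
      proof -
        let ?d = "x k \<omega> - x (k - 1) \<omega>"
        have "(norm ?d)\<^sup>2 \<le> 2 * (norm (?d + Y k \<omega>))\<^sup>2 + 2 * (norm (Y k \<omega>))\<^sup>2"
          using norm_add_sq_le[of 1 "?d + Y k \<omega>" "- Y k \<omega>"] by simp
        then have "\<mu> / 2 * (norm ?d)\<^sup>2 \<le> \<mu> / 2 * (2 * (norm (?d + Y k \<omega>))\<^sup>2 + 2 * (norm (Y k \<omega>))\<^sup>2)"
          using \<mu> by (intro mult_left_mono) auto
        then show ?thesis using False by (simp add: V_def W_def algebra_simps)
      qed
    qed (intro Bochner_Integration.integrable_diff adapted_integrable[OF aV] adapted_integrable[OF aW] adapted_integrable[OF aU])+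
    also have "\<dots> = expectation (V k) - \<mu> / 2 * mean_sq_move k"
      using adapted_integrable[OF aV] adapted_integrable[OF aU] \<mu> by (simp add: mean_sq_move_def)
    finally show ?thesis .
  qed
  have "expectation (V (Suc k)) \<le> expectation (V k) - 2 * \<theta> * (rate - \<kappa>') * mean_sq_residual k
      + ((2 * \<mu> * (\<gamma>\<^sup>2 * \<eta>\<^sup>2 * L\<^sup>2) - \<mu> / 2) * mean_sq_move k + (1 + \<mu>) * mean_sq_noise k)" for k
  proof -
    have "2 * \<mu> * mean_sq_drift k \<le> 2 * \<mu> * ((\<gamma>\<^sup>2 * \<eta>\<^sup>2 * L\<^sup>2) * mean_sq_move k)"
      using \<mu> by (intro mult_left_mono mean_sq_drift_le) auto
    moreover have "(2 * \<mu> * (\<gamma>\<^sup>2 * \<eta>\<^sup>2 * L\<^sup>2) - \<mu> / 2) * mean_sq_move k = 2 * \<mu> * ((\<gamma>\<^sup>2 * \<eta>\<^sup>2 * L\<^sup>2) * mean_sq_move k) - \<mu> / 2 * mean_sq_move k"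
      by (simp add: left_diff_distrib mult.assoc)
    ultimately show ?thesis using step[of k] W_le[of k] by linarith
  qed
  from sum_telescope_le[of "\<lambda>k. expectation (V k)", OF this, of K]
  have "expectation (V (Suc K)) + (\<Sum>k\<le>K. 2 * \<theta> * (rate - \<kappa>') * mean_sq_residual k)
     \<le> expectation (V 0) + ((2 * \<mu> * (\<gamma>\<^sup>2 * \<eta>\<^sup>2 * L\<^sup>2) - \<mu> / 2) * (\<Sum>k\<le>K. mean_sq_move k) + (1 + \<mu>) * (\<Sum>k\<le>K. mean_sq_noise k))"
    by (simp only: sum.distrib sum_distrib_left)
  also have "(1 + \<mu>) * (\<Sum>k\<le>K. mean_sq_noise k) \<le> (1 + \<mu>) * (\<eta>\<^sup>2 * L\<^sup>2 * Q * (\<Sum>k\<le>K. mean_sq_move k))"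
    using sum_mean_sq_noise_le[of "\<lambda>_. 1" K] \<mu> by (intro mult_left_mono) auto
  also have "(2 * \<mu> * (\<gamma>\<^sup>2 * \<eta>\<^sup>2 * L\<^sup>2) - \<mu> / 2) * (\<Sum>k\<le>K. mean_sq_move k) + (1 + \<mu>) * (\<eta>\<^sup>2 * L\<^sup>2 * Q * (\<Sum>k\<le>K. mean_sq_move k))
      = \<mu> / 2 * (\<eta>\<^sup>2 * L\<^sup>2 * (4 * \<gamma>\<^sup>2 + 4 / \<theta> * Q) - 1) * (\<Sum>k\<le>K. mean_sq_move k)"
    unfolding \<mu>1 using \<theta> by (simp add: field_simps)
  also have "\<dots> \<le> 0"
    using step_size \<mu> moments_nonneg by (intro mult_nonpos_nonneg mult_nonneg_nonpos sum_nonneg) auto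
  finally have "expectation (V (Suc K)) + (\<Sum>k\<le>K. 2 * \<theta> * (rate - \<kappa>') * mean_sq_residual k) \<le> expectation (V 0)" by simp
  moreover have "0 \<le> expectation (V (Suc K))"
    using \<mu> by (intro Bochner_Integration.integral_nonneg) (simp add: V_def)
  moreover have "expectation (V 0) \<le> 2 * R_sq"
  proof (rule expectation_le_const)
    fix \<omega> assume "\<omega> \<in> space P"
    then show "V 0 \<omega> \<le> 2 * R_sq"
      using norm_add_sq_le[of 1 "X 0 \<omega>" "Y 0 \<omega>"] by (simp add: V_def R_sq_eq)
  qed (rule adapted_integrable[OF aV])
  ultimately have "2 * \<theta> * (rate - \<kappa>') * (\<Sum>k\<le>K. mean_sq_residual k) \<le> 2 * R_sq" by (simp add: sum_distrib_left)
  then show ?thesis using \<theta> rate by (simp add: field_simps)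
qed

text \<open>
  Telescoping the start potential along \<open>s k = max 0 (1/2 - k \<theta>)\<close>. Drift and noise are charged to the
  moves with weights \<open>w k\<close>, and a move is at most about \<open>\<theta>\<parallel>y\<parallel>\<close> for the preceding \<open>y\<close>. On full steps this
  cost is covered by the surplus \<open>\<theta>\<^sup>2 (1 - 2/5 s\<^sup>2)\<close> of the potential; later it is covered by the difference
  of \<open>2 - \<theta>\<close> and \<open>119/30 (1 - \<theta>) / (2 - \<theta>)\<close>.
\<close>

lemma sum_mean_sq_residual_le_improved:
  assumes D_small: "\<gamma>\<^sup>2 * \<eta>\<^sup>2 * L\<^sup>2 \<le> \<theta> / 72"
    and N_small: "\<eta>\<^sup>2 * L\<^sup>2 * Q \<le> \<theta> * (1 + 2 * \<theta>) / 36" and rate: "\<kappa>' < rate"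
  shows "(\<Sum>k\<le>K. mean_sq_residual k) \<le> 3/7 * R_sq / (\<theta> * (rate - \<kappa>'))"
proof -
  define s where "s k = max 0 (1/2 - real k * \<theta>)" for k
  define w where "w k = 1/18 + (\<theta> + \<theta>\<^sup>2) / 16 + s k" for k
  define c where "c k = \<theta> * (2 - \<theta> - 2 * \<kappa>')
     + (if s (Suc k) = 0 then - (\<theta> ^ 3 / 4) else \<theta>\<^sup>2 * (1 - 2/5 * (s (Suc k))\<^sup>2))" for k
  define V where "V k \<omega> = start_potential (s k) (X k \<omega>) (Y k \<omega>)" for k \<omega>
  have s: "0 \<le> s k" "s k \<le> 1/2" "s (Suc k) \<le> s k" for k
  proof -
    have "0 \<le> real k * \<theta>" "real (Suc k) * \<theta> = real k * \<theta> + \<theta>" using \<theta> by (simp_all add: distrib_right)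
    then show "0 \<le> s k" "s k \<le> 1/2" "s (Suc k) \<le> s k" using \<theta> unfolding s_def by linarith+
  qed
  have s_Suc: "s (Suc k) = 0 \<Longrightarrow> s k \<le> \<theta>" "s (Suc k) \<noteq> 0 \<Longrightarrow> s k = s (Suc k) + \<theta>" for k
  proof -
    have "real (Suc k) * \<theta> = real k * \<theta> + \<theta>" by (simp add: distrib_right)
    then show "s (Suc k) = 0 \<Longrightarrow> s k \<le> \<theta>" "s (Suc k) \<noteq> 0 \<Longrightarrow> s k = s (Suc k) + \<theta>"
      using \<theta> unfolding s_def by linarith+
  qed
  have s_pos: "s (Suc k) + \<theta> \<le> 1/2" if "s (Suc k) \<noteq> 0" for k
    using s_Suc(2)[OF that] s(2)[of k] by simp
  have w: "0 \<le> w k" "w (Suc k) \<le> w k" for k using s \<theta> by (auto simp: w_def)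
  have aV: "adapted k (V k)" for k
    unfolding V_def start_potential_def by (intro adapted_intros adapted_XY)
  have step: "expectation (V (Suc k)) \<le> expectation (V k) - c k * mean_sq_residual k + (4 / \<theta> + 5/2 + 40 * s k / \<theta>) * mean_sq_drift k
      + (1 + 13/2 * (s k / \<theta>)) * mean_sq_noise k" for k
  proof (cases "s (Suc k) = 0")
    case True
    have "expectation (V (Suc k)) \<le> expectation (V k) - (\<theta> * (2 - \<theta> - 2 * \<kappa>') - \<theta> ^ 3 / 4) * mean_sq_residual k
       + (4 / \<theta> + 5/2) * mean_sq_drift k + 1 * mean_sq_noise k"
    proof (rule expectation_step_le[where e = "\<lambda>\<omega>. - 2 *\<^sub>R (X k \<omega> + Y k \<omega> - \<theta> *\<^sub>R y k \<omega>)"])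
      fix \<omega> assume w: "\<omega> \<in> space P"
      show "V (Suc k) \<omega> \<le> V k \<omega> - (\<theta> * (2 - \<theta> - 2 * \<kappa>') - \<theta> ^ 3 / 4) * (norm (y k \<omega>))\<^sup>2
         + (4 / \<theta> + 5/2) * (norm (D k \<omega>))\<^sup>2 + 1 * (norm (N k \<omega>))\<^sup>2
         + inner (- 2 *\<^sub>R (X k \<omega> + Y k \<omega> - \<theta> *\<^sub>R y k \<omega>)) (N k \<omega>)"
        using start_potential_last_step[OF s(1) s_Suc(1)[OF True] \<kappa>'_nonneg \<theta>(1) y_eq[of k \<omega>] star_y[OF w, of k, folded \<kappa>'_def],
            where N = "N k \<omega>"]
        unfolding V_def True start_potential_0 XY_Suc[OF w] by simp
    qed (rule aV | intro adapted_intros adapted_XY)+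
    also have "\<dots> \<le> expectation (V k) - (\<theta> * (2 - \<theta> - 2 * \<kappa>') - \<theta> ^ 3 / 4) * mean_sq_residual k
       + (4 / \<theta> + 5/2 + 40 * s k / \<theta>) * mean_sq_drift k + (1 + 13/2 * (s k / \<theta>)) * mean_sq_noise k"
    proof -
      have "(4 / \<theta> + 5/2) * mean_sq_drift k \<le> (4 / \<theta> + 5/2 + 40 * s k / \<theta>) * mean_sq_drift k"
        by (rule mult_right_mono) (use s(1)[of k] \<theta> mean_sq_drift_nonneg in auto)
      moreover have "1 * mean_sq_noise k \<le> (1 + 13/2 * (s k / \<theta>)) * mean_sq_noise k"
        by (rule mult_right_mono) (use s(1)[of k] \<theta> moments_nonneg in auto)
      ultimately show ?thesis by linarith
    qed
    finally show ?thesis using True by (simp add: c_def)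
  next
    case False
    let ?s' = "s (Suc k)"
    let ?e = "\<lambda>\<omega>. - (2 * (1 - ?s')) *\<^sub>R (X k \<omega> + Y k \<omega> - \<theta> *\<^sub>R y k \<omega>)
        - (2 * (?s' + 2/5 * ?s'\<^sup>2)) *\<^sub>R (X k \<omega> - \<theta> *\<^sub>R y k \<omega> - D k \<omega>)
        + (8 * (?s' + ?s'\<^sup>2 + ?s' / 16) / \<theta>) *\<^sub>R D k \<omega>"
    have "expectation (V (Suc k)) \<le> expectation (V k)
       - (\<theta> * (2 - \<theta> - 2 * \<kappa>') + \<theta>\<^sup>2 * (1 - 2/5 * ?s'\<^sup>2)) * mean_sq_residual k
       + (40 * s k / \<theta>) * mean_sq_drift k + (1 + 13/2 * (s k / \<theta>)) * mean_sq_noise k"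
    proof (rule expectation_step_le[where e = ?e])
      fix \<omega> assume w: "\<omega> \<in> space P"
      let ?q = "Y (Suc k) \<omega> - y k \<omega>"
      have Y_Suc: "y k \<omega> + ?q = Y (Suc k) \<omega>" by simp
      show "V (Suc k) \<omega> \<le> V k \<omega> - (\<theta> * (2 - \<theta> - 2 * \<kappa>') + \<theta>\<^sup>2 * (1 - 2/5 * ?s'\<^sup>2)) * (norm (y k \<omega>))\<^sup>2
         + (40 * s k / \<theta>) * (norm (D k \<omega>))\<^sup>2 + (1 + 13/2 * (s k / \<theta>)) * (norm (N k \<omega>))\<^sup>2
         + inner (?e \<omega>) (N k \<omega>)"
        using start_potential_full_step[OF s(1)[of "Suc k"] s_Suc(2)[OF False] s(2)[of k] \<kappa>'_nonneg \<theta>(1) y_eq[of k \<omega>]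
          star_y[OF w, of k, folded \<kappa>'_def] Y_increment_monotone[OF w, of k],
          folded X_Suc[OF w], unfolded Y_Suc]
        unfolding V_def .
    qed (rule aV | intro adapted_intros adapted_XY)+
    also have "\<dots> \<le> expectation (V k)
       - (\<theta> * (2 - \<theta> - 2 * \<kappa>') + \<theta>\<^sup>2 * (1 - 2/5 * ?s'\<^sup>2)) * mean_sq_residual k
       + (4 / \<theta> + 5/2 + 40 * s k / \<theta>) * mean_sq_drift k + (1 + 13/2 * (s k / \<theta>)) * mean_sq_noise k"
    proof -
      have "40 * s k / \<theta> * mean_sq_drift k \<le> (4 / \<theta> + 5/2 + 40 * s k / \<theta>) * mean_sq_drift k"
        by (rule mult_right_mono) (use \<theta> mean_sq_drift_nonneg in auto)
      then show ?thesis by linarith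
    qed
    finally show ?thesis using False by (simp add: c_def)
  qed
  have mean_sq_drift: "mean_sq_drift k \<le> \<theta> / 72 * mean_sq_move k" for k
    using mean_sq_drift_le[of k] mult_right_mono[OF D_small moments_nonneg(1)[of k]] by linarith
  have sum_noise: "(\<Sum>k\<le>K. \<sigma> k * mean_sq_noise k) \<le> \<theta> * (1 + 2 * \<theta>) / 36 * (\<Sum>k\<le>K. \<sigma> k * mean_sq_move k)"
    if "\<And>k. 0 \<le> \<sigma> k" "\<And>k. \<sigma> (Suc k) \<le> \<sigma> k" for \<sigma>
  proof -
    have "(\<Sum>k\<le>K. \<sigma> k * mean_sq_noise k) \<le> \<eta>\<^sup>2 * L\<^sup>2 * Q * (\<Sum>k\<le>K. \<sigma> k * mean_sq_move k)"
      by (rule sum_mean_sq_noise_le) (rule that)+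
    also have "\<dots> \<le> \<theta> * (1 + 2 * \<theta>) / 36 * (\<Sum>k\<le>K. \<sigma> k * mean_sq_move k)"
      by (rule mult_right_mono[OF N_small]) (intro sum_nonneg mult_nonneg_nonneg moments_nonneg that)
    finally show ?thesis .
  qed
  have jumps: "(\<Sum>k\<le>K. w k * mean_sq_move k) \<le> 3/2 * \<theta>\<^sup>2 * (\<Sum>k\<le>K. w (Suc k) * mean_sq_residual k)"
  proof -
    let ?Z = "\<Sum>k\<le>K. w k * mean_sq_move k"
    have move_Suc: "mean_sq_move (Suc k) \<le> 5/4 * \<theta>\<^sup>2 * mean_sq_residual k + 5 * mean_sq_drift k + mean_sq_noise k" for k
    proof -
      have "expectation (\<lambda>\<omega>. (norm (x (Suc k) \<omega> - x k \<omega>))\<^sup>2)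
          \<le> expectation (\<lambda>\<omega>. 0) - (- (5/4 * \<theta>\<^sup>2)) * mean_sq_residual k + 5 * mean_sq_drift k + 1 * mean_sq_noise k"
      proof (rule expectation_step_le[where e = "\<lambda>\<omega>. 2 *\<^sub>R (\<theta> *\<^sub>R y k \<omega> + D k \<omega>)"])
        fix \<omega> assume w: "\<omega> \<in> space P"
        let ?q = "Y (Suc k) \<omega> - y k \<omega>" and ?a = "\<theta> *\<^sub>R y k \<omega> + D k \<omega> + N k \<omega>"
        have d: "x (Suc k) \<omega> - x k \<omega> = - ?a - ?q"
          using X_Suc[OF w, of k] by (simp add: X_def algebra_simps)
        have e: "(norm (- a - q))\<^sup>2 = (norm a)\<^sup>2 + 2 * inner a q + (norm q)\<^sup>2" for a q :: 'a
          using norm_diff_sq[of "- a" q] by simp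
        have "(norm (x (Suc k) \<omega> - x k \<omega>))\<^sup>2 = (norm ?a)\<^sup>2 + 2 * inner ?a ?q + (norm ?q)\<^sup>2"
          unfolding d by (rule e)
        also have "\<dots> \<le> (norm ?a)\<^sup>2"
          using Y_increment_monotone[OF w, of k] zero_le_power2[of "norm ?q"] by linarith
        also have "\<dots> = (norm (\<theta> *\<^sub>R y k \<omega> + D k \<omega>))\<^sup>2 + (norm (N k \<omega>))\<^sup>2 + inner (2 *\<^sub>R (\<theta> *\<^sub>R y k \<omega> + D k \<omega>)) (N k \<omega>)"
          unfolding norm_add_sq[of _ "N k \<omega>"] by simp
        also have "(norm (\<theta> *\<^sub>R y k \<omega> + D k \<omega>))\<^sup>2 \<le> 5/4 * \<theta>\<^sup>2 * (norm (y k \<omega>))\<^sup>2 + 5 * (norm (D k \<omega>))\<^sup>2"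
          using norm_add_sq_le[of "1/4" "\<theta> *\<^sub>R y k \<omega>" "D k \<omega>"] by (simp add: power_mult_distrib)
        finally show "(norm (x (Suc k) \<omega> - x k \<omega>))\<^sup>2
            \<le> 0 - (- (5/4 * \<theta>\<^sup>2)) * (norm (y k \<omega>))\<^sup>2 + 5 * (norm (D k \<omega>))\<^sup>2 + 1 * (norm (N k \<omega>))\<^sup>2
             + inner (2 *\<^sub>R (\<theta> *\<^sub>R y k \<omega> + D k \<omega>)) (N k \<omega>)" by simp
      qed (intro adapted_intros adapted_XY adapted_x; simp)+
      then show ?thesis by (simp add: mean_sq_move_def)
    qed
    have "?Z = (\<Sum>k<K. w (Suc k) * mean_sq_move (Suc k))"
      by (subst sum.atMost_shift) (simp add: mean_sq_move_0)
    also have "\<dots> \<le> (\<Sum>k<K. w (Suc k) * (5/4 * \<theta>\<^sup>2 * mean_sq_residual k) + w k * (5 * \<theta> / 72 * mean_sq_move k) + w k * mean_sq_noise k)"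
    proof (rule sum_mono)
      fix k
      have "w (Suc k) * mean_sq_move (Suc k) \<le> w (Suc k) * (5/4 * \<theta>\<^sup>2 * mean_sq_residual k + (5 * \<theta> / 72 * mean_sq_move k + mean_sq_noise k))"
        using move_Suc[of k] mean_sq_drift[of k] by (intro mult_left_mono w) auto
      also have "\<dots> = w (Suc k) * (5/4 * \<theta>\<^sup>2 * mean_sq_residual k) + w (Suc k) * (5 * \<theta> / 72 * mean_sq_move k + mean_sq_noise k)"
        by (rule distrib_left)
      also have "w (Suc k) * (5 * \<theta> / 72 * mean_sq_move k + mean_sq_noise k) \<le> w k * (5 * \<theta> / 72 * mean_sq_move k + mean_sq_noise k)"
        by (intro mult_right_mono w add_nonneg_nonneg mult_nonneg_nonneg moments_nonneg) (use \<theta> in auto)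
      finally show "w (Suc k) * mean_sq_move (Suc k) \<le> w (Suc k) * (5/4 * \<theta>\<^sup>2 * mean_sq_residual k) + w k * (5 * \<theta> / 72 * mean_sq_move k) + w k * mean_sq_noise k"
        by (simp add: distrib_left)
    qed
    also have "\<dots> \<le> (\<Sum>k\<le>K. w (Suc k) * (5/4 * \<theta>\<^sup>2 * mean_sq_residual k) + w k * (5 * \<theta> / 72 * mean_sq_move k) + w k * mean_sq_noise k)"
      by (rule sum_mono2) (use \<theta> in \<open>auto intro!: add_nonneg_nonneg mult_nonneg_nonneg w mean_sq_residual_nonneg moments_nonneg\<close>)
    also have "\<dots> = 5/4 * \<theta>\<^sup>2 * (\<Sum>k\<le>K. w (Suc k) * mean_sq_residual k) + 5 * \<theta> / 72 * ?Z + (\<Sum>k\<le>K. w k * mean_sq_noise k)"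
      by (simp only: sum.distrib sum_distrib_left mult.left_commute[of "w _"])
    also have "(\<Sum>k\<le>K. w k * mean_sq_noise k) \<le> \<theta> * (1 + 2 * \<theta>) / 36 * ?Z"
      by (rule sum_noise) (rule w)+
    finally have 1: "?Z \<le> 5/4 * \<theta>\<^sup>2 * (\<Sum>k\<le>K. w (Suc k) * mean_sq_residual k) + 5 * \<theta> / 72 * ?Z + \<theta> * (1 + 2 * \<theta>) / 36 * ?Z"
      by simp
    have "5 * \<theta> / 72 + \<theta> * (1 + 2 * \<theta>) / 36 \<le> 1/6"
    proof -
      have "\<theta> * \<theta> \<le> 1 * 1" using \<theta> by (intro mult_mono) auto
      moreover have "5 * \<theta> / 72 + \<theta> * (1 + 2 * \<theta>) / 36 = 7/72 * \<theta> + 1/18 * (\<theta> * \<theta>)"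
        by (simp add: field_simps)
      ultimately show ?thesis using \<theta> by linarith
    qed
    then have "(5 * \<theta> / 72 + \<theta> * (1 + 2 * \<theta>) / 36) * ?Z \<le> 1/6 * ?Z"
      by (intro mult_right_mono sum_nonneg mult_nonneg_nonneg w moments_nonneg)
    then have "?Z \<le> 5/4 * \<theta>\<^sup>2 * (\<Sum>k\<le>K. w (Suc k) * mean_sq_residual k) + 1/6 * ?Z"
      using 1 unfolding distrib_right by linarith
    then show ?thesis by linarith
  qed
  have errors: "(\<Sum>k\<le>K. (4 / \<theta> + 5/2 + 40 * s k / \<theta>) * mean_sq_drift k + (1 + 13/2 * (s k / \<theta>)) * mean_sq_noise k) \<le> (\<Sum>k\<le>K. w k * mean_sq_move k)"
  proof -
    have "(\<Sum>k\<le>K. (4 / \<theta> + 5/2 + 40 * s k / \<theta>) * mean_sq_drift k + (1 + 13/2 * (s k / \<theta>)) * mean_sq_noise k)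
        \<le> (\<Sum>k\<le>K. (4 / \<theta> + 5/2 + 40 * s k / \<theta>) * (\<theta> / 72 * mean_sq_move k))
          + \<theta> * (1 + 2 * \<theta>) / 36 * (\<Sum>k\<le>K. (1 + 13/2 * (s k / \<theta>)) * mean_sq_move k)"
      unfolding sum.distrib
      by (intro add_mono sum_mono mult_left_mono mean_sq_drift sum_noise)
         (use s \<theta> in \<open>auto intro!: add_nonneg_nonneg divide_nonneg_nonneg divide_right_mono\<close>)
    also have "\<dots> = (\<Sum>k\<le>K. ((4 / \<theta> + 5/2 + 40 * s k / \<theta>) * (\<theta> / 72) + \<theta> * (1 + 2 * \<theta>) / 36 * (1 + 13/2 * (s k / \<theta>))) * mean_sq_move k)"
      unfolding sum_distrib_left sum.distrib[symmetric]
      by (intro sum.cong refl) (simp only: distrib_right mult.assoc)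
    also have "\<dots> \<le> (\<Sum>k\<le>K. w k * mean_sq_move k)"
    proof (rule sum_mono)
      fix k
      show "((4 / \<theta> + 5/2 + 40 * s k / \<theta>) * (\<theta> / 72) + \<theta> * (1 + 2 * \<theta>) / 36 * (1 + 13/2 * (s k / \<theta>))) * mean_sq_move k \<le> w k * mean_sq_move k"
      proof (cases k)
        case 0
        then show ?thesis by (simp add: mean_sq_move_0)
      next
        case (Suc j)
        \<comment> \<open>A positive \<open>s k\<close> with \<open>k > 0\<close> means that a full step of length \<open>\<theta> \<le> 1/2\<close> has been made.\<close>
        have st: "\<theta> * s k \<le> 1/2 * s k"
        proof (cases "s k = 0")
          case False
          then show ?thesis using s_pos[of j] s(1)[of k] Suc by (intro mult_right_mono) auto
        qed simp
        have "(4 / \<theta> + 5/2 + 40 * s k / \<theta>) * (\<theta> / 72) + \<theta> * (1 + 2 * \<theta>) / 36 * (1 + 13/2 * (s k / \<theta>))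
            = 1/18 + 1/16 * \<theta> + 1/18 * \<theta>\<^sup>2 + 53/72 * s k + 13/36 * (\<theta> * s k)"
          using \<theta> by (simp add: field_simps power2_eq_square)
        also have "\<dots> \<le> w k"
        proof -
          have "w k = 1/18 + 1/16 * \<theta> + 1/16 * \<theta>\<^sup>2 + s k" by (simp add: w_def add_divide_distrib)
          then show ?thesis using st s(1)[of k] zero_le_power2[of \<theta>] by linarith
        qed
        finally show ?thesis by (rule mult_right_mono) (rule moments_nonneg)
      qed
    qed
    finally show ?thesis .
  qed
  have coeff: "\<theta> * (119/30 * (rate - \<kappa>')) \<le> c k - 3/2 * \<theta>\<^sup>2 * w (Suc k)" for k
  proof -
    have div: "p / (2 - \<theta>) \<le> z" if "0 \<le> (2 - \<theta>) * z - p" for p z :: real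
      using that \<theta> by (simp add: pos_divide_le_eq mult.commute)
    have "119/30 * (rate - \<kappa>') \<le> 119/30 * rate - 2 * \<kappa>'" using \<kappa>'_nonneg by simp
    also have "\<dots> \<le> c k / \<theta> - 3/2 * \<theta> * w (Suc k)"
    proof (cases "s (Suc k) = 0")
      case True
      \<comment> \<open>Clearing the denominator leaves a polynomial whose lower part \<open>1/30 - \<theta>/5 + 19/48 \<theta>\<^sup>2\<close> contains
        the square \<open>3/10 (\<theta> - 1/3)\<^sup>2\<close>.\<close>
      have "0 \<le> 3/10 * (\<theta> - 1/3)\<^sup>2 + 23/240 * \<theta>\<^sup>2 + 5/32 * \<theta> ^ 3 + 3/32 * \<theta> ^ 4" using \<theta> by simp
      also have "\<dots> = (2 - \<theta>) * (2 - \<theta> - \<theta>\<^sup>2 / 4 - 3/2 * \<theta> * (1/18 + (\<theta> + \<theta>\<^sup>2) / 16)) - 119/30 * (1 - \<theta>)"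
        by (simp add: field_simps power2_eq_square power3_eq_cube power4_eq_xxxx)
      finally have d: "119/30 * (1 - \<theta>) / (2 - \<theta>) \<le> 2 - \<theta> - \<theta>\<^sup>2 / 4 - 3/2 * \<theta> * (1/18 + (\<theta> + \<theta>\<^sup>2) / 16)"
        by (rule div)
      have "c k / \<theta> = 2 - \<theta> - 2 * \<kappa>' - \<theta>\<^sup>2 / 4"
        using True \<theta> by (simp add: c_def field_simps power2_eq_square power3_eq_cube)
      with d show ?thesis using True by (simp add: rate_def w_def)
    next
      case False
      let ?s = "s (Suc k)"
      have th: "\<theta> \<le> 1/2" "?s \<le> 1/2" using s_pos[OF False] s(1)[of "Suc k"] \<theta> by auto
      have q: "\<theta> * \<theta> \<le> 1/2 * \<theta>" "?s * ?s \<le> 1/2 * ?s" using mult_right_mono[of \<theta> "1/2" \<theta>] mult_right_mono[of ?s "1/2" ?s] th \<theta> s(1)[of "Suc k"] by auto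
      have "0 \<le> (2 - \<theta>) * (2 - \<theta>) - 119/30 * (1 - \<theta>)"
      proof -
        have "(2 - \<theta>) * (2 - \<theta>) - 119/30 * (1 - \<theta>) = 1/30 * (1 - \<theta>) + \<theta> * \<theta>"
          by (simp add: field_simps)
        then show ?thesis using \<theta> by simp
      qed
      then have "119/30 * (1 - \<theta>) / (2 - \<theta>) \<le> 2 - \<theta>"
        by (rule div)
      moreover have "3/2 * w (Suc k) \<le> 1 - 2/5 * ?s\<^sup>2"
      proof -
        have "w (Suc k) = 1/18 + 1/16 * \<theta> + 1/16 * (\<theta> * \<theta>) + ?s"
          by (simp add: w_def power2_eq_square add_divide_distrib)
        then show ?thesis using q s_pos[OF False] \<theta> s(1)[of "Suc k"] unfolding power2_eq_square by linarith
      qed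
      then have "\<theta> * (3/2 * w (Suc k)) \<le> \<theta> * (1 - 2/5 * ?s\<^sup>2)" using \<theta> by (intro mult_left_mono) auto
      moreover have "c k / \<theta> = 2 - \<theta> - 2 * \<kappa>' + \<theta> * (1 - 2/5 * ?s\<^sup>2)"
        using False \<theta> by (simp add: c_def add_divide_distrib power2_eq_square[of \<theta>])
      moreover have "119/30 * rate = 119/30 * (1 - \<theta>) / (2 - \<theta>)" "3/2 * \<theta> * w (Suc k) = \<theta> * (3/2 * w (Suc k))"
        by (simp_all add: rate_def)
      ultimately show ?thesis by linarith
    qed
    finally have "\<theta> * (119/30 * (rate - \<kappa>')) \<le> \<theta> * (c k / \<theta> - 3/2 * \<theta> * w (Suc k))"
      using \<theta> by (intro mult_left_mono) auto
    also have "\<dots> = c k - 3/2 * \<theta>\<^sup>2 * w (Suc k)" using \<theta> by (simp add: right_diff_distrib power2_eq_square)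
    finally show ?thesis .
  qed
  have "expectation (V (Suc K)) + (\<Sum>k\<le>K. c k * mean_sq_residual k) \<le> expectation (V 0)
      + (\<Sum>k\<le>K. (4 / \<theta> + 5/2 + 40 * s k / \<theta>) * mean_sq_drift k + (1 + 13/2 * (s k / \<theta>)) * mean_sq_noise k)"
    by (rule sum_telescope_le[of "\<lambda>k. expectation (V k)"]) (use step in \<open>simp add: add.assoc\<close>)
  also note errors
  also note jumps
  finally have "expectation (V (Suc K)) + (\<Sum>k\<le>K. (c k - 3/2 * \<theta>\<^sup>2 * w (Suc k)) * mean_sq_residual k) \<le> expectation (V 0)"
    by (simp add: left_diff_distrib sum_subtractf sum_distrib_left mult.assoc)
  moreover have "(\<Sum>k\<le>K. \<theta> * (119/30 * (rate - \<kappa>')) * mean_sq_residual k) \<le> (\<Sum>k\<le>K. (c k - 3/2 * \<theta>\<^sup>2 * w (Suc k)) * mean_sq_residual k)"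
    by (intro sum_mono mult_right_mono coeff mean_sq_residual_nonneg)
  moreover have "0 \<le> expectation (V (Suc K))"
  proof (rule Bochner_Integration.integral_nonneg)
    show "0 \<le> V (Suc K) \<omega>" for \<omega>
      unfolding V_def by (rule start_potential_nonneg) (use s(1)[of "Suc K"] s(2)[of "Suc K"] in linarith)+
  qed
  moreover have "expectation (V 0) \<le> 17/10 * R_sq"
  proof (rule expectation_le_const)
    fix \<omega> assume "\<omega> \<in> space P"
    then show "V 0 \<omega> \<le> 17/10 * R_sq"
      using start_potential_half_le[of "X 0 \<omega>" "Y 0 \<omega>"] by (simp add: V_def R_sq_eq s_def)
  qed (rule adapted_integrable[OF aV])
  ultimately have "\<theta> * (119/30 * (rate - \<kappa>')) * (\<Sum>k\<le>K. mean_sq_residual k) \<le> 17/10 * R_sq"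
    unfolding sum_distrib_left by linarith
  then show ?thesis using \<theta> rate by (simp add: field_simps)
qed

end

section \<open>Complexity of the method\<close>

theorem corollary4p3:
  fixes Gs :: "nat \<Rightarrow> real ^ 'p \<Rightarrow> real ^ 'p"
    and G :: "real ^ 'p \<Rightarrow> real ^ 'p"
    and T :: "real ^ 'p \<Rightarrow> (real ^ 'p) set"
    and x_star x0 v0 :: "real ^ 'p"
    and n b :: nat
    and L \<kappa> \<gamma> \<rho> C C_hat M \<delta> \<eta> \<sigma> R0_sq \<Theta> :: real
    and P :: "'w measure"
    and B :: "nat \<Rightarrow> 'w \<Rightarrow> nat set"
    and x v :: "nat \<Rightarrow> 'w \<Rightarrow> real ^ 'p"
  assumes "n \<ge> 1"
    and "G = (\<lambda>z. (1 / real n) *\<^sub>R (\<Sum>i=1..n. Gs i z))"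
    and "inclusion_zeros G T \<noteq> {}"
    and "maximally_monotone T"
    and "L > 0"
    and "\<forall>y z. (1 / real n) * (\<Sum>i=1..n. (norm (Gs i y - Gs i z))\<^sup>2) \<le> L\<^sup>2 * (norm (y - z))\<^sup>2"
    and "x_star \<in> inclusion_zeros G T"
    and "\<kappa> \<ge> 0"
    and "\<forall>z\<in>op_dom T. \<forall>u\<in>T z. inner (G z + u) (z - x_star) \<ge> - \<kappa> * (norm (G z + u))\<^sup>2"
    and "1 / 2 < \<gamma>" and "\<gamma> < 1"
    and "1 \<le> b" and "real b \<le> real n powr (2 / 3)"
    and "\<rho> = real b / (2 * real n)"
    and "C = (2 * (real n - real b) * (2 * real n + real b) + (real b)\<^sup>2) / (real n * (real b)\<^sup>2)"
    and "C_hat = 2 * (real n - real b) * (2 * real n + real b) * \<gamma>\<^sup>2 / (real n * (real b)\<^sup>2)"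
    and "M = 4 * \<gamma>\<^sup>2 + 4 * \<gamma> / (1 - \<gamma>) * ((C + C_hat) / \<rho>)"
    and "\<delta> = \<gamma> * (2 * \<gamma> - 1) / ((3 * \<gamma> - 1) * sqrt M)"
    and "L * \<kappa> < \<delta>"
    and "\<eta> = 1 / (L * sqrt M)"
    and "\<sigma> = sqrt (1 - \<gamma>) / (2 * sqrt (\<gamma> * (10 + \<gamma> + 7 * \<gamma>\<^sup>2)))"
    and "x0 \<in> op_dom T" and "v0 \<in> T x0"
    and "saga_run P n b \<gamma> \<eta> Gs T x0 v0 B x v"
    and "R0_sq = (norm (x0 - x_star))\<^sup>2 + \<gamma>\<^sup>2 * \<eta>\<^sup>2 * (norm (G x0 + v0))\<^sup>2"
    and "\<Theta> = (3 * \<gamma> - 1) * \<eta> / ((1 - \<gamma>) * (\<gamma> * (2 * \<gamma> - 1) * \<eta> - (3 * \<gamma> - 1) * \<kappa>))"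
  shows "\<eta> \<ge> \<sigma> * real b powr (3 / 2) / (real n * L)
    \<and> (\<forall>K::nat. 1 / (real K + 1) * (\<Sum>k=0..K. LINT \<omega>|P. (norm (G (x k \<omega>) + v k \<omega>))\<^sup>2)
          \<le> (real n)\<^sup>2 * \<Theta> * L\<^sup>2 * R0_sq / (\<sigma>\<^sup>2 * real b ^ 3 * (real K + 1)))
    \<and> (\<forall>\<epsilon>>0. b = nat \<lfloor>real n powr (2 / 3)\<rfloor> \<longrightarrow>
         (let \<Gamma> = \<Theta> / \<sigma>\<^sup>2;
              T_G = int n + \<lfloor>3 * \<Gamma> * L\<^sup>2 * R0_sq * real n powr (2 / 3) / \<epsilon>\<^sup>2\<rfloor>;
              T_T = \<lfloor>\<Gamma> * L\<^sup>2 * R0_sq / \<epsilon>\<^sup>2\<rfloor>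
          in \<exists>K::nat.
               1 / (real K + 1) * (\<Sum>k=0..K. LINT \<omega>|P. (norm (G (x k \<omega>) + v k \<omega>))\<^sup>2) \<le> \<epsilon>\<^sup>2
             \<and> (\<forall>\<omega>\<in>space P. int (component_evals n (\<lambda>k. B k \<omega>) K) \<le> T_G)
             \<and> int (resolvent_evals K) \<le> T_T))"
proof -

  have n: "n \<ge> 1" and G: "G = (\<lambda>z. (1 / real n) *\<^sub>R (\<Sum>i=1..n. Gs i z))" and L: "L > 0"
    and \<kappa>: "\<kappa> \<ge> 0" and \<gamma>: "1 / 2 < \<gamma>" "\<gamma> < 1" and b: "1 \<le> b" and b_powr: "real b \<le> real n powr (2 / 3)"
    using assms(1,2,5,8,10-13) by blast+
  let ?N = "real n" and ?b = "real b"
  have N: "1 \<le> ?N" and b1: "1 \<le> ?b" using n b by auto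
  have b_cube: "?b ^ 3 \<le> ?N\<^sup>2"
  proof -
    have "?b ^ 3 \<le> (?N powr (2 / 3)) ^ 3" using b_powr by (intro power_mono) auto
    also have "\<dots> = ?N powr (real 3 * (2 / 3))" using N by (subst powr_power) (auto simp: mult.commute)
    also have "\<dots> = ?N\<^sup>2" using N by (simp add: powr_numeral)
    finally show ?thesis .
  qed
  have b_le: "b \<le> n"
  proof -
    have "?N powr (2 / 3) \<le> ?N powr 1" using N by (intro powr_mono) auto
    then show ?thesis using b_powr N by simp
  qed
  have bN: "?b \<le> ?N" using b_le by simp
  \<comment> \<open>In these terms \<open>M = a A\<close> and \<open>1 / \<sigma>\<^sup>2 = a S\<close>, so \<open>M \<sigma>\<^sup>2 = A / S\<close>.\<close>
  define A where "A = \<gamma> * (1 - \<gamma>) + variance_factor (1 + \<gamma>\<^sup>2) ?N ?b"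
  define S where "S = 10 + \<gamma> + 7 * \<gamma>\<^sup>2"
  define a where "a = 4 * \<gamma> / (1 - \<gamma>)"
  define \<theta> where "\<theta> = (1 - \<gamma>) / \<gamma>"
  have a: "0 < a" "a = 4 / \<theta>" "a * (\<gamma> * (1 - \<gamma>)) = 4 * \<gamma>\<^sup>2" and S: "0 < S" and \<theta>: "0 < \<theta>" "\<theta> < 1"
    using \<gamma> by (auto simp: a_def S_def \<theta>_def field_simps power2_eq_square intro!: add_pos_nonneg)
  have Q_pos: "0 < variance_factor c ?N ?b" if "0 \<le> c" for c
    unfolding variance_factor_def using that b1 bN by (intro mult_pos_pos add_nonneg_pos) auto
  have M: "M = a * A"
  proof -
    have "(C + C_hat) / \<rho> = variance_factor (1 + \<gamma>\<^sup>2) ?N ?b"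
      unfolding assms(14-16) variance_factor_def using N b1 by (simp add: field_simps power2_eq_square power3_eq_cube)
    then show ?thesis unfolding assms(17) A_def distrib_left a(3) by (simp add: a_def)
  qed
  have A_pos: "0 < A" using \<gamma> Q_pos[of "1 + \<gamma>\<^sup>2"] by (simp add: A_def add_pos_pos)
  then have M_pos: "0 < M" using a by (simp add: M)
  have \<sigma>_sq: "\<sigma>\<^sup>2 = 1 / (a * S)"
    unfolding assms(21) a_def S_def using \<gamma> by (simp add: power_divide power_mult_distrib)
  have \<sigma>: "0 < \<sigma>" unfolding assms(21) using \<gamma> by (simp add: add_pos_nonneg)
  have \<eta>: "0 < \<eta>" and \<eta>_sq: "\<eta>\<^sup>2 * L\<^sup>2 = 1 / M" and \<eta>_inv: "1 / \<eta>\<^sup>2 = L\<^sup>2 * M"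
    unfolding assms(20) using L M_pos by (auto simp: power_divide power_mult_distrib)

  have M_le: "M \<le> ?N\<^sup>2 / (\<sigma>\<^sup>2 * ?b ^ 3)"
  proof -
    have "?b ^ 3 * A \<le> S * ?N\<^sup>2"
      unfolding A_def S_def using b1 bN b_cube \<gamma> by (intro variance_factor_le) auto
    then have "A \<le> S * ?N\<^sup>2 / ?b ^ 3" using b1 by (simp add: pos_le_divide_eq mult.commute)
    then have "a * A \<le> a * (S * ?N\<^sup>2 / ?b ^ 3)" using a by (intro mult_left_mono) auto
    also have "\<dots> = ?N\<^sup>2 / (\<sigma>\<^sup>2 * ?b ^ 3)" by (simp add: \<sigma>_sq)
    finally show ?thesis by (simp add: M)
  qed

  have run: "prob_space P" "prob_space.indep_vars P (\<lambda>_. count_space (batches n b)) B UNIV"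
     "\<And>k. distr P (count_space (batches n b)) (B k) = uniform_count_measure (batches n b)"
     "\<And>\<omega>. \<omega> \<in> space P \<Longrightarrow> x 0 \<omega> = x0" "\<And>\<omega>. \<omega> \<in> space P \<Longrightarrow> v 0 \<omega> = v0"
     "\<And>\<omega> k. \<omega> \<in> space P \<Longrightarrow> x (Suc k) \<omega> = x k \<omega>
          - \<eta> *\<^sub>R saga_estimator n \<gamma> Gs (\<lambda>j. x j \<omega>) (\<lambda>j. B j \<omega>) k
          - \<eta> *\<^sub>R (\<gamma> *\<^sub>R v (Suc k) \<omega> - (2 * \<gamma> - 1) *\<^sub>R v k \<omega>)"
     "\<And>\<omega> k. \<omega> \<in> space P \<Longrightarrow> v (Suc k) \<omega> \<in> T (x (Suc k) \<omega>)"
    using assms(24) unfolding saga_run_def by blast+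
  have avg: "average {1..n} (\<lambda>i. Gs i z) = G z" for z
    by (simp add: G average_def)
  interpret prob_space P by (rule run(1))
  interpret R: saga_process P n b B Gs T x_star x0 v0 L \<kappa> \<gamma> \<eta> x v
  proof unfold_locales
    show "- \<kappa> * (norm (average {1..n} (\<lambda>i. Gs i z) + u))\<^sup>2 \<le> inner (average {1..n} (\<lambda>i. Gs i z) + u) (z - x_star)"
      if "u \<in> T z" for z u
      unfolding avg using assms(9) that by (auto simp: op_dom_def)
    show "monotone_operator T" using assms(4) by (simp add: maximally_monotone_def)
    show "(1 / real n) * (\<Sum>i=1..n. (norm (Gs i y - Gs i z))\<^sup>2) \<le> L\<^sup>2 * (norm (y - z))\<^sup>2" for y z
      using assms(6) by blast
  qed (fact b b_le run \<kappa> \<gamma> \<eta> assms(23))+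

  have R_G: "R.G = G" by (rule ext) (simp only: R.G_def avg)
  have R_\<theta>: "R.\<theta> = \<theta>" by (simp add: R.\<theta>_def \<theta>_def)
  have R_sq: "R.R_sq = R0_sq" by (simp add: R.R_sq_def R_G assms(25))
  have R_Q: "R.Q = variance_factor ((1 - \<gamma>)\<^sup>2) ?N ?b" by (rule R.Q_def)
  have R0: "0 \<le> R0_sq" by (simp add: assms(25))

  have rate: "R.rate = (2 * \<gamma> - 1) / (3 * \<gamma> - 1)"
    unfolding R.rate_def R_\<theta> \<theta>_def using \<gamma> by (simp add: field_simps)
  have \<kappa>_less: "R.\<kappa>' < R.rate"
  proof -
    have "L * \<kappa> * sqrt M < \<gamma> * (2 * \<gamma> - 1) / (3 * \<gamma> - 1)"
    proof -
      have "L * \<kappa> * sqrt M < \<delta> * sqrt M" using assms(19) M_pos by (intro mult_strict_right_mono) auto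
      also have "\<dots> = \<gamma> * (2 * \<gamma> - 1) / (3 * \<gamma> - 1)" unfolding assms(18) using M_pos by simp
      finally show ?thesis .
    qed
    then have "L * \<kappa> * sqrt M / \<gamma> < \<gamma> * (2 * \<gamma> - 1) / (3 * \<gamma> - 1) / \<gamma>"
      using \<gamma> by (intro divide_strict_right_mono) auto
    moreover have "R.\<kappa>' = L * \<kappa> * sqrt M / \<gamma>"
      unfolding R.\<kappa>'_def unfolding assms(20) by simp
    ultimately show ?thesis unfolding rate using \<gamma> by simp
  qed
  have \<Theta>: "\<Theta> = 1 / (\<gamma>\<^sup>2 * (\<theta> * (R.rate - R.\<kappa>')))"
  proof -
    have "(3 * \<gamma> - 1) * \<eta> * (\<gamma> * (R.rate - R.\<kappa>')) = \<gamma> * (2 * \<gamma> - 1) * \<eta> - (3 * \<gamma> - 1) * \<kappa>"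
      unfolding rate R.\<kappa>'_def using \<gamma> \<eta> by (simp add: field_simps)
    moreover have "\<gamma>\<^sup>2 * \<theta> = (1 - \<gamma>) * \<gamma>" using \<gamma> by (simp add: \<theta>_def power2_eq_square)
    ultimately have "\<Theta> = (3 * \<gamma> - 1) * \<eta> / ((1 - \<gamma>) * ((3 * \<gamma> - 1) * \<eta> * (\<gamma> * (R.rate - R.\<kappa>'))))"
      "\<gamma>\<^sup>2 * (\<theta> * (R.rate - R.\<kappa>')) = (1 - \<gamma>) * (\<gamma> * (R.rate - R.\<kappa>'))"
      unfolding assms(26) by (simp_all only: mult.assoc[symmetric])
    then show ?thesis using \<gamma> \<eta> \<kappa>_less by simp
  qed
  have \<Theta>_pos: "0 < \<Theta>" unfolding \<Theta> using \<gamma> \<theta> \<kappa>_less by simp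

  define E where "E K = (\<Sum>k=0..K. LINT \<omega>|P. (norm (G (x k \<omega>) + v k \<omega>))\<^sup>2)" for K :: nat
  have E_eq: "E K = 1 / (\<gamma>\<^sup>2 * \<eta>\<^sup>2) * (\<Sum>k\<le>K. R.mean_sq_residual k)" for K
  proof -
    have "R.mean_sq_residual k = \<gamma>\<^sup>2 * \<eta>\<^sup>2 * (LINT \<omega>|P. (norm (G (x k \<omega>) + v k \<omega>))\<^sup>2)" for k
      by (simp add: R.mean_sq_residual_def R.y_def R_G power_mult_distrib)
    then show ?thesis using \<gamma> \<eta> by (simp add: E_def atLeast0AtMost sum_distrib_left)
  qed
  have E_le: "E K \<le> c * M * (\<Theta> * L\<^sup>2 * R0_sq)"
    if "(\<Sum>k\<le>K. R.mean_sq_residual k) \<le> c * R.R_sq / (R.\<theta> * (R.rate - R.\<kappa>'))" for K c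
  proof -
    have "E K \<le> 1 / (\<gamma>\<^sup>2 * \<eta>\<^sup>2) * (c * R.R_sq / (R.\<theta> * (R.rate - R.\<kappa>')))"
      unfolding E_eq using that by (intro mult_left_mono) auto
    also have "\<dots> = c * (1 / \<eta>\<^sup>2) * (\<Theta> * R0_sq)"
      unfolding \<Theta> R_\<theta> R_sq by simp
    finally show ?thesis unfolding \<eta>_inv by (simp add: mult_ac)
  qed
  have E_bound: "E K \<le> 1 * M * (\<Theta> * L\<^sup>2 * R0_sq)" for K
  proof (rule E_le)
    have Q_le: "R.Q \<le> variance_factor (1 + \<gamma>\<^sup>2) ?N ?b"
    proof -
      have "(1 - \<gamma>)\<^sup>2 \<le> 1\<^sup>2" using \<gamma> by (intro power_mono) auto
      then have "(1 - \<gamma>)\<^sup>2 \<le> 1 + \<gamma>\<^sup>2" using zero_le_power2[of \<gamma>] unfolding one_power2 by linarith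
      then show ?thesis unfolding R_Q variance_factor_def using b1 bN
        by (intro mult_left_mono add_right_mono mult_right_mono) auto
    qed
    have "4 * \<gamma>\<^sup>2 + 4 / \<theta> * R.Q \<le> M"
      unfolding M A_def distrib_left a(3) using mult_left_mono[OF Q_le, of a] a by simp
    then have "\<eta>\<^sup>2 * L\<^sup>2 * (4 * \<gamma>\<^sup>2 + 4 / R.\<theta> * R.Q) \<le> 1"
      unfolding \<eta>_sq R_\<theta> using M_pos by (simp add: field_simps)
    from R.sum_mean_sq_residual_le[OF this \<kappa>_less, of K]
    show "(\<Sum>k\<le>K. R.mean_sq_residual k) \<le> 1 * R.R_sq / (R.\<theta> * (R.rate - R.\<kappa>'))" by simp
  qed

  have part1: "\<eta> \<ge> \<sigma> * ?b powr (3 / 2) / (?N * L)"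
  proof -
    have "(\<sigma> * ?b powr (3 / 2) * sqrt M)\<^sup>2 = \<sigma>\<^sup>2 * ?b ^ 3 * M"
    proof -
      have "(?b powr (3 / 2))\<^sup>2 = ?b ^ 3"
        using b1 by (simp add: power2_eq_square powr_add[symmetric] powr_numeral)
      then show ?thesis using M_pos by (simp add: power_mult_distrib)
    qed
    also have "\<dots> \<le> ?N\<^sup>2" using M_le \<sigma> b1 by (simp add: field_simps)
    finally have "\<sigma> * ?b powr (3 / 2) * sqrt M \<le> ?N" by (rule power2_le_imp_le) simp
    then show ?thesis unfolding assms(20) using N L M_pos by (simp add: field_simps)
  qed
  have part2: "1 / (real K + 1) * E K \<le> ?N\<^sup>2 * \<Theta> * L\<^sup>2 * R0_sq / (\<sigma>\<^sup>2 * ?b ^ 3 * (real K + 1))" for K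
  proof -
    have "E K \<le> ?N\<^sup>2 / (\<sigma>\<^sup>2 * ?b ^ 3) * (\<Theta> * L\<^sup>2 * R0_sq)"
      using E_bound[of K] mult_right_mono[OF M_le, of "\<Theta> * L\<^sup>2 * R0_sq"] \<Theta>_pos R0 by simp
    then have "1 / (real K + 1) * E K \<le> 1 / (real K + 1) * (?N\<^sup>2 / (\<sigma>\<^sup>2 * ?b ^ 3) * (\<Theta> * L\<^sup>2 * R0_sq))"
      by (intro mult_left_mono) auto
    then show ?thesis by (simp add: mult_ac)
  qed
  have sharp: "E K \<le> \<Theta> / \<sigma>\<^sup>2 * L\<^sup>2 * R0_sq" if b_floor: "b = nat \<lfloor>?N powr (2 / 3)\<rfloor>" for K
  proof -
    have "\<exists>c\<ge>0. c * M \<le> 1 / \<sigma>\<^sup>2 \<and> E K \<le> c * M * (\<Theta> * L\<^sup>2 * R0_sq)"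
    proof (cases "A \<le> S")
      case True
      then have "1 * M \<le> 1 / \<sigma>\<^sup>2" using mult_left_mono[of A S a] a(1) by (simp add: M \<sigma>_sq)
      then show ?thesis using E_bound[of K] by (intro exI[of _ 1]) auto
    next
      case False
      have n2: "n\<^sup>2 < (b + 1) ^ 3"
      proof -
        have "?N powr (2 / 3) < ?b + 1" unfolding b_floor by linarith
        then have "(?N powr (2 / 3)) ^ 3 < (?b + 1) ^ 3" by (intro power_strict_mono) auto
        moreover have "(?N powr (2 / 3)) ^ 3 = ?N powr (real 3 * (2 / 3))" using N by (subst powr_power) (auto simp: mult.commute)
        moreover have "\<dots> = ?N\<^sup>2" using N by (simp add: powr_numeral)
        ultimately have "real (n\<^sup>2) < real ((b + 1) ^ 3)" by (simp add: add.commute)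
        then show ?thesis by (simp only: of_nat_less_iff)
      qed
      have "A \<le> 7/3 * S"
        unfolding A_def S_def using b b_le n2 \<gamma> by (intro variance_factor_le_of_floor) auto
      then have "3/7 * M \<le> 1 / \<sigma>\<^sup>2" using mult_left_mono[of A "7/3 * S" a] a(1) by (simp add: M \<sigma>_sq)
      moreover have "E K \<le> 3/7 * M * (\<Theta> * L\<^sup>2 * R0_sq)"
      proof (rule E_le, rule R.sum_mean_sq_residual_le_improved)
        from False have large: "10 + \<gamma> + 7 * \<gamma>\<^sup>2 < \<gamma> * (1 - \<gamma>) + variance_factor (1 + \<gamma>\<^sup>2) ?N ?b"
          by (simp add: A_def S_def)
        note Q = variance_factor_large[OF b1 bN \<gamma> large, folded \<theta>_def]
        let ?Q = "variance_factor (1 + \<gamma>\<^sup>2) ?N ?b"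
        have M_ge: "4 / \<theta> * ?Q \<le> M" unfolding M A_def distrib_left a(3) using a by simp
        have Qp: "0 < ?Q" by (rule Q_pos) simp
        have inv_M: "1 / M \<le> \<theta> / (4 * ?Q)"
          using divide_left_mono[OF M_ge, of 1] M_pos Qp \<theta> by simp
        have "72 * \<gamma>\<^sup>2 \<le> 4 * ?Q"
        proof -
          have "\<gamma>\<^sup>2 \<le> 1\<^sup>2" using \<gamma> by (intro power_mono) auto
          then show ?thesis using Q(1) by simp
        qed
        then have "\<gamma>\<^sup>2 * (\<theta> / (4 * ?Q)) \<le> \<theta> / 72"
          using Qp \<theta> by (simp add: field_simps)
        moreover have "\<gamma>\<^sup>2 * (1 / M) \<le> \<gamma>\<^sup>2 * (\<theta> / (4 * ?Q))"
          by (rule mult_left_mono[OF inv_M]) simp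
        ultimately show "\<gamma>\<^sup>2 * \<eta>\<^sup>2 * L\<^sup>2 \<le> R.\<theta> / 72"
          unfolding R_\<theta> mult.assoc \<eta>_sq by (rule order_trans[rotated])
        have Qs: "0 < R.Q" unfolding R_Q by (rule Q_pos) simp
        have "1 / M * R.Q \<le> \<theta> / (4 * ?Q) * R.Q"
          using inv_M Qs by (intro mult_right_mono) auto
        also have "\<dots> \<le> \<theta> / (4 * ?Q) * ((1 + 2 * \<theta>) / 9 * ?Q)"
          using Q(2) Qp \<theta> unfolding R_Q by (intro mult_left_mono) auto
        also have "\<dots> = \<theta> * (1 + 2 * \<theta>) / 36" using Qp by simp
        finally show "\<eta>\<^sup>2 * L\<^sup>2 * R.Q \<le> R.\<theta> * (1 + 2 * R.\<theta>) / 36"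
          unfolding \<eta>_sq R_\<theta> .
      qed (rule \<kappa>_less)
      ultimately show ?thesis by (intro exI[of _ "3/7"]) auto
    qed
    then obtain c where c: "c * M \<le> 1 / \<sigma>\<^sup>2" "E K \<le> c * M * (\<Theta> * L\<^sup>2 * R0_sq)" by blast
    have "c * M * (\<Theta> * L\<^sup>2 * R0_sq) \<le> 1 / \<sigma>\<^sup>2 * (\<Theta> * L\<^sup>2 * R0_sq)"
      using c(1) \<Theta>_pos R0 by (intro mult_right_mono) auto
    then show ?thesis using c(2) by simp
  qed
  have part3: "let \<Gamma> = \<Theta> / \<sigma>\<^sup>2;
              T_G = int n + \<lfloor>3 * \<Gamma> * L\<^sup>2 * R0_sq * ?N powr (2 / 3) / \<epsilon>\<^sup>2\<rfloor>;
              T_T = \<lfloor>\<Gamma> * L\<^sup>2 * R0_sq / \<epsilon>\<^sup>2\<rfloor>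
          in \<exists>K::nat. 1 / (real K + 1) * E K \<le> \<epsilon>\<^sup>2
             \<and> (\<forall>\<omega>\<in>space P. int (component_evals n (\<lambda>k. B k \<omega>) K) \<le> T_G)
             \<and> int (resolvent_evals K) \<le> T_T"
    if \<epsilon>: "\<epsilon> > 0" and b_floor: "b = nat \<lfloor>?N powr (2 / 3)\<rfloor>" for \<epsilon>
  proof -
    define Z where "Z = \<Theta> / \<sigma>\<^sup>2 * L\<^sup>2 * R0_sq"
    have Z: "0 \<le> Z / \<epsilon>\<^sup>2" using \<Theta>_pos R0 by (simp add: Z_def)
    \<comment> \<open>The largest index that the resolvent budget admits.\<close>
    define K where "K = nat \<lfloor>Z / \<epsilon>\<^sup>2\<rfloor>"
    have K: "int K = \<lfloor>Z / \<epsilon>\<^sup>2\<rfloor>" using Z by (simp add: K_def)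
    have K_le: "real K \<le> Z / \<epsilon>\<^sup>2" and K_gt: "Z / \<epsilon>\<^sup>2 < real K + 1"
      using Z unfolding K_def by linarith+
    have 1: "1 / (real K + 1) * E K \<le> \<epsilon>\<^sup>2"
    proof -
      have "Z \<le> \<epsilon>\<^sup>2 * (real K + 1)" using K_gt \<epsilon> by (simp add: pos_divide_less_eq mult.commute)
      then have "E K \<le> \<epsilon>\<^sup>2 * (real K + 1)" using sharp[OF b_floor, of K] by (simp add: Z_def)
      then show ?thesis by (simp add: pos_divide_le_eq)
    qed
    have 2: "int (component_evals n (\<lambda>k. B k \<omega>) K) \<le> int n + \<lfloor>3 * Z * ?N powr (2 / 3) / \<epsilon>\<^sup>2\<rfloor>"
      if "\<omega> \<in> space P" for \<omega>
    proof -
      have "component_evals n (\<lambda>k. B k \<omega>) K = n + K * (2 * b)"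
        using R.batch_in_batches[OF that] by (simp add: component_evals_def batches_def)
      moreover have "int (K * (2 * b)) \<le> \<lfloor>3 * Z * ?N powr (2 / 3) / \<epsilon>\<^sup>2\<rfloor>"
      proof (unfold le_floor_iff)
        have "real K * (2 * ?b) \<le> Z / \<epsilon>\<^sup>2 * (3 * ?N powr (2 / 3))"
          using K_le b_powr by (intro mult_mono) (auto simp: Z)
        then show "of_int (int (K * (2 * b))) \<le> 3 * Z * ?N powr (2 / 3) / \<epsilon>\<^sup>2" by (simp add: mult_ac)
      qed
      ultimately show ?thesis by simp
    qed
    have 3: "int (resolvent_evals K) \<le> \<lfloor>Z / \<epsilon>\<^sup>2\<rfloor>"
      using K by (simp add: resolvent_evals_def)
    have "3 * (\<Theta> / \<sigma>\<^sup>2) * L\<^sup>2 * R0_sq = 3 * Z" by (simp add: Z_def)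
    then show ?thesis using 1 2 3 unfolding Let_def Z_def[symmetric] by metis
  qed
  show ?thesis
    using part1 part2 part3 unfolding E_def by blast
qed

end
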